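(* Let $G$ be a second countable infinite locally compact abelian group with dual group $\widehat{G}$, and let $\Lambda\subset G$ be a countable uniform lattice with annihilator $\Lambda^{\perp}\subset\widehat{G}$. There exist orthonormal bases $\{e_{\alpha\beta}\}_{(\alpha,\beta)\in\Lambda\times\Lambda^{\perp}}$ and $\{h_{\lambda\gamma}\}_{(\lambda,\gamma)\in\Lambda\times\Lambda^{\perp}}$ of $L^2(G)$ such that, for every $f\in L^2(G)$, the adjoint Gabor system $\{E_{\beta}\mathcal{T}_{\alpha}f\}_{(\alpha,\beta)\in\Lambda\times\Lambda^{\perp}}$ is the R-dual of the Gabor system $\{E_{\gamma}\mathcal{T}_{\lambda}f\}_{(\lambda,\gamma)\in\Lambda\times\Lambda^{\perp}}$ with respect to $\{e_{\alpha\beta}\}$ and $\{h_{\lambda\gamma}\}$.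
   Context: Groups are written additively. $\widehat{G}$ is the group of continuous characters of $G$. A uniform lattice is a discrete co-compact subgroup. For $u\in G$ and $\xi\in\widehat{G}$, the operators on $L^2(G)$ (with respect to Haar measure) are $\mathcal{T}_u f(x)=f(x-u)$ and $E_{\xi}f(x)=\xi(x)f(x)$. The annihilator of $\Lambda$ is $\Lambda^{\perp}=\{\xi\in\widehat{G}:\xi(\lambda)=1\ \forall\lambda\in\Lambda\}$. The adjoint Gabor system of $\{E_\gamma\mathcal{T}_\lambda f\}_{(\lambda,\gamma)\in\Lambda\times\Gamma}$ is $\{E_\beta\mathcal{T}_\alpha f\}_{(\alpha,\beta)\in\Gamma^\perp\times\Lambda^\perp}$; here $\Gamma=\Lambda^\perp$, so $\Gamma^\perp=\Lambda$. R-dual: let $I,J$ be countably infinite index sets, $\mathcal{H}$ a separable Hilbert space, and $\{e_j\}_{j\in J}$, $\{h_i\}_{i\in I}$ orthonormal bases of $\mathcal{H}$; if $\{f_i\}_{i\in I}\subset\mathcal{H}$ satisfies $\sum_{i\in I}|\langle f_i,e_j\rangle|^2<\infty$ for all $j\in J$, the R-dual of $\{f_i\}$ with respect to $\{e_j\}$ and $\{h_i\}$ is the family $w_j=\sum_{i\in I}\langle f_i,e_j\rangle h_i$, $j\in J$. Being the R-dual includes this square-summability condition. *)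

theory Defs
  imports "HOL-Analysis.Analysis"
begin

section \<open>Locally compact abelian groups\<close>

text \<open>
  A second countable Hausdorff abelian topological group is a type of sort
  \<open>{topological_ab_group_add, second_countable_topology, t2_space}\<close>; local compactness is the
  predicate \<^const>\<open>locally_compact_space\<close> on the topology \<^const>\<open>euclidean\<close> of that type.
\<close>

text \<open>
  A Haar measure is a nonzero translation invariant Radon measure on the Borel sets.
\<close>

definition haar_measure ::
    "'a::{topological_ab_group_add, second_countable_topology, t2_space} measure \<Rightarrow> bool" where
  "haar_measure \<mu> \<longleftrightarrow>
     sets \<mu> = sets borel \<and>
     emeasure \<mu> UNIV \<noteq> 0 \<and>
     (\<forall>x. \<forall>A\<in>sets borel. emeasure \<mu> ((+) x ` A) = emeasure \<mu> A) \<and>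
     (\<forall>K. compact K \<longrightarrow> emeasure \<mu> K < \<infinity>) \<and>
     (\<forall>A\<in>sets borel. emeasure \<mu> A = (INF U\<in>{U. open U \<and> A \<subseteq> U}. emeasure \<mu> U)) \<and>
     (\<forall>U. open U \<longrightarrow> emeasure \<mu> U = (SUP K\<in>{K. compact K \<and> K \<subseteq> U}. emeasure \<mu> K))"

text \<open>The underlying set of the dual group; characters take values in the unit circle.\<close>

definition dual_group :: "('a::topological_ab_group_add \<Rightarrow> complex) set" where
  "dual_group =
     {\<xi>. continuous_on UNIV \<xi> \<and> (\<forall>x. cmod (\<xi> x) = 1) \<and> (\<forall>x y. \<xi> (x + y) = \<xi> x * \<xi> y)}"

definition annihilator :: "'a::topological_ab_group_add set \<Rightarrow> ('a \<Rightarrow> complex) set" where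
  "annihilator \<Lambda> = {\<xi> \<in> dual_group. \<forall>x\<in>\<Lambda>. \<xi> x = 1}"

definition coset :: "'a::ab_group_add set \<Rightarrow> 'a \<Rightarrow> 'a set" where
  "coset \<Lambda> x = (+) x ` \<Lambda>"

definition coset_topology :: "'a::topological_ab_group_add set \<Rightarrow> 'a set topology" where
  "coset_topology \<Lambda> = topology (\<lambda>\<U>. \<U> \<subseteq> range (coset \<Lambda>) \<and> open (coset \<Lambda> -` \<U>))"

lemma openin_coset_topology:
  "openin (coset_topology \<Lambda>) \<U> \<longleftrightarrow> \<U> \<subseteq> range (coset \<Lambda>) \<and> open (coset \<Lambda> -` \<U>)"
proof -
  have "istopology (\<lambda>\<U>. \<U> \<subseteq> range (coset \<Lambda>) \<and> open (coset \<Lambda> -` \<U>))"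
    unfolding istopology_def by (auto simp: vimage_Union vimage_Int)
  then show ?thesis
    by (simp add: coset_topology_def topology_inverse')
qed

definition uniform_lattice :: "'a::topological_ab_group_add set \<Rightarrow> bool" where
  "uniform_lattice \<Lambda> \<longleftrightarrow>
     0 \<in> \<Lambda> \<and> (\<forall>x\<in>\<Lambda>. \<forall>y\<in>\<Lambda>. x + y \<in> \<Lambda>) \<and> (\<forall>x\<in>\<Lambda>. - x \<in> \<Lambda>) \<and>
     discrete \<Lambda> \<and>
     compact_space (coset_topology \<Lambda>)"

section \<open>The space of square integrable functions\<close>

text \<open>
  Elements of the Hilbert space are represented by functions. Two functions represent the same
  element iff they agree almost everywhere, i.e. iff the seminorm \<open>l2_norm\<close> of their difference
  vanishes; everything below respects this relation.
\<close>

definition L2 :: "'a measure \<Rightarrow> ('a \<Rightarrow> complex) set" where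
  "L2 \<mu> = {f \<in> borel_measurable \<mu>. integrable \<mu> (\<lambda>x. (cmod (f x))\<^sup>2)}"

definition l2_inner :: "'a measure \<Rightarrow> ('a \<Rightarrow> complex) \<Rightarrow> ('a \<Rightarrow> complex) \<Rightarrow> complex" where
  "l2_inner \<mu> f g = (LINT x|\<mu>. f x * cnj (g x))"

definition l2_norm :: "'a measure \<Rightarrow> ('a \<Rightarrow> complex) \<Rightarrow> real" where
  "l2_norm \<mu> f = sqrt (LINT x|\<mu>. (cmod (f x))\<^sup>2)"

text \<open>Unconditional convergence in norm of the series of the \<open>g i\<close>, over \<open>i \<in> I\<close>, to \<open>s\<close>.\<close>

definition l2_has_sum ::
    "'a measure \<Rightarrow> ('i \<Rightarrow> 'a \<Rightarrow> complex) \<Rightarrow> 'i set \<Rightarrow> ('a \<Rightarrow> complex) \<Rightarrow> bool" where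
  "l2_has_sum \<mu> g I s \<longleftrightarrow>
     ((\<lambda>F. l2_norm \<mu> (\<lambda>x. s x - (\<Sum>i\<in>F. g i x))) \<longlongrightarrow> 0) (finite_subsets_at_top I)"

text \<open>An orthonormal family whose finite linear combinations are dense.\<close>

definition orthonormal_basis ::
    "'a measure \<Rightarrow> 'i set \<Rightarrow> ('i \<Rightarrow> 'a \<Rightarrow> complex) \<Rightarrow> bool" where
  "orthonormal_basis \<mu> I e \<longleftrightarrow>
     (\<forall>i\<in>I. e i \<in> L2 \<mu>) \<and>
     (\<forall>i\<in>I. \<forall>j\<in>I. l2_inner \<mu> (e i) (e j) = (if i = j then 1 else 0)) \<and>
     (\<forall>f\<in>L2 \<mu>. \<forall>\<epsilon>>0. \<exists>F c. finite F \<and> F \<subseteq> I \<and>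
        l2_norm \<mu> (\<lambda>x. f x - (\<Sum>i\<in>F. c i * e i x)) < \<epsilon>)"

text \<open>
  \<open>is_R_dual \<mu> I J f e h w\<close>: the family \<open>w\<close>, indexed by \<open>J\<close>, is the R-dual of the family \<open>f\<close>,
  indexed by \<open>I\<close>, with respect to \<open>e\<close> and \<open>h\<close>. The standing requirements of the notion are
  part of the predicate. Separability of the space is not listed, as it follows from the
  existence of a countable orthonormal basis.
\<close>

definition is_R_dual ::
    "'a measure \<Rightarrow> 'i set \<Rightarrow> 'j set \<Rightarrow> ('i \<Rightarrow> 'a \<Rightarrow> complex) \<Rightarrow> ('j \<Rightarrow> 'a \<Rightarrow> complex) \<Rightarrow>
     ('i \<Rightarrow> 'a \<Rightarrow> complex) \<Rightarrow> ('j \<Rightarrow> 'a \<Rightarrow> complex) \<Rightarrow> bool" where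
  "is_R_dual \<mu> I J f e h w \<longleftrightarrow>
     countable I \<and> infinite I \<and> countable J \<and> infinite J \<and>
     orthonormal_basis \<mu> J e \<and> orthonormal_basis \<mu> I h \<and>
     (\<forall>i\<in>I. f i \<in> L2 \<mu>) \<and>
     (\<forall>j\<in>J. (\<lambda>i. (cmod (l2_inner \<mu> (f i) (e j)))\<^sup>2) summable_on I) \<and>
     (\<forall>j\<in>J. w j \<in> L2 \<mu> \<and> l2_has_sum \<mu> (\<lambda>i x. l2_inner \<mu> (f i) (e j) * h i x) I (w j))"

section \<open>Gabor systems\<close>

definition translation :: "'a::ab_group_add \<Rightarrow> ('a \<Rightarrow> complex) \<Rightarrow> 'a \<Rightarrow> complex" where
  "translation u f = (\<lambda>x. f (x - u))"

definition modulation :: "('a \<Rightarrow> complex) \<Rightarrow> ('a \<Rightarrow> complex) \<Rightarrow> 'a \<Rightarrow> complex" where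
  "modulation \<xi> f = (\<lambda>x. \<xi> x * f x)"

text \<open>
  The Gabor system of \<open>f\<close> over \<open>\<Lambda> \<times> \<Gamma>\<close> and its adjoint over the product of the annihilators
  \<open>\<Gamma>\<^sup>\<bottom> \<times> \<Lambda>\<^sup>\<bottom>\<close> are the restrictions of one family to different index sets.
\<close>

definition gabor ::
    "('a::ab_group_add \<Rightarrow> complex) \<Rightarrow> 'a \<times> ('a \<Rightarrow> complex) \<Rightarrow> 'a \<Rightarrow> complex" where
  "gabor f = (\<lambda>(u, \<xi>). modulation \<xi> (translation u f))"

end

theory Submission
  imports Defs
begin

text \<open>
  Let \<open>Q\<close> be a Borel fundamental domain of \<open>\<Lambda>\<close>. The functions
  \<open>e\<^sub>\<alpha>\<^sub>\<beta> = \<mu>(Q)\<^sup>-\<^sup>1\<^sup>/\<^sup>2 E\<^sub>-\<^sub>\<beta> T\<^sub>-\<^sub>\<alpha> 1\<^sub>Q\<close> form an orthonormal basis, and one may take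
  \<open>h = e\<close>: since the operators \<open>E\<^sub>\<gamma> T\<^sub>\<lambda>\<close> with \<open>\<lambda> \<in> \<Lambda>\<close>, \<open>\<gamma> \<in> \<Lambda>\<^sup>\<bottom>\<close> commute, the coefficient of
  \<open>E\<^sub>\<gamma> T\<^sub>\<lambda> f\<close> at \<open>e\<^sub>\<alpha>\<^sub>\<beta>\<close> equals that of \<open>E\<^sub>\<beta> T\<^sub>\<alpha> f\<close> at \<open>e\<^sub>\<lambda>\<^sub>\<gamma>\<close>, and the R-dual series is
  the basis expansion of \<open>E\<^sub>\<beta> T\<^sub>\<alpha> f\<close>.

  Completeness of the basis is the completeness of the characters of the compact group \<open>G/\<Lambda>\<close>.
  Without spectral theory: on the space of \<open>L\<^sup>2\<close> functions orthogonal to all characters, consider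
  the energy \<open>\<integral>\<bar>\<langle>T\<^sub>y f, f\<rangle>\<bar>\<^sup>2 dy\<close>. A near-maximizer of it on the unit sphere is, up to scalars,
  nearly invariant under all translations, so \<open>y \<mapsto> \<langle>T\<^sub>y f, f\<rangle>\<close> is nearly multiplicative; its
  multiplicative defect is a small 2-cocycle, hence a coboundary, and correcting by it gives a
  genuine character that is not orthogonal to \<open>f\<close>.
\<close>

section \<open>Square integrable functions\<close>

text \<open>The quotient by \<open>\<Lambda>\<close> is never formed as a group: a probability
  measure on \<open>G\<close> stands in for its Haar measure, with translation invariance available
  for periodic integrands only. So every set or function in an invariance argument is made periodic
  first. Compactness that would make the energy attain its supremum is not at hand. This is why
  near-maximizers \<open>g\<close> occur and why the constants matter: squared moduli of the
  autocorrelation above 9/10 leave a multiplicative defect too small to reach a quarter turn of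
  phase. The orthogonal space is stable under translations, so the test vectors
  \<open>g + c * shift a g\<close> stay inside it. The contradiction is that the autocorrelation of
  \<open>g\<close> has coefficient |<g, \<kappa>>|^2 = 0 at the character found, although its
  product with \<open>cnj \<kappa>\<close> has positive real part everywhere. Topology enters
  through continuity of translations in the square norm, a consequence of the regularity of Haar
  measure; it makes measurable characters continuous and the energy of nonzero functions
  positive.\<close>

lemma L2_iff:
  "f \<in> L2 M \<longleftrightarrow> f \<in> borel_measurable M \<and> integrable M (\<lambda>x. (cmod (f x))\<^sup>2)"
  by (simp add: L2_def)

lemma L2_measurable: "f \<in> L2 M \<Longrightarrow> f \<in> borel_measurable M"
  by (simp add: L2_def)

lemma L2_square_integrable: "f \<in> L2 M \<Longrightarrow> integrable M (\<lambda>x. (cmod (f x))\<^sup>2)"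
  by (simp add: L2_def)

lemma L2_mult_integrable:
  assumes "f \<in> L2 M" "g \<in> L2 M"
  shows "integrable M (\<lambda>x. f x * cnj (g x))"
proof (rule Bochner_Integration.integrable_bound)
  show "integrable M (\<lambda>x. (cmod (f x))\<^sup>2 + (cmod (g x))\<^sup>2)"
    using assms by (simp add: L2_iff)
  show "(\<lambda>x. f x * cnj (g x)) \<in> borel_measurable M"
    by (intro borel_measurable_times L2_measurable[OF assms(1)]
        measurable_compose[OF L2_measurable[OF assms(2)] borel_measurable_continuous_onI])
      (intro continuous_intros)
  have "cmod z * cmod w \<le> (cmod z)\<^sup>2 + (cmod w)\<^sup>2" for z w :: complex
    using sum_squares_bound[of "cmod z" "cmod w"] mult_nonneg_nonneg[OF norm_ge_zero[of z] norm_ge_zero[of w]]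
    by linarith
  then show "AE x in M. norm (f x * cnj (g x)) \<le> norm ((cmod (f x))\<^sup>2 + (cmod (g x))\<^sup>2)"
    by (auto simp: norm_mult)
qed

lemma L2_scale: "f \<in> L2 M \<Longrightarrow> (\<lambda>x. c * f x) \<in> L2 M"
  by (auto simp: L2_iff norm_mult power_mult_distrib)

lemma L2_zero: "(\<lambda>x. 0) \<in> L2 M"
  by (simp add: L2_iff)

lemma L2_add:
  assumes "f \<in> L2 M" "g \<in> L2 M"
  shows "(\<lambda>x. f x + g x) \<in> L2 M"
proof -
  have "integrable M (\<lambda>x. (cmod (f x + g x))\<^sup>2)"
  proof (rule Bochner_Integration.integrable_bound)
    show "integrable M (\<lambda>x. 2 * (cmod (f x))\<^sup>2 + 2 * (cmod (g x))\<^sup>2)"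
      using assms by (simp add: L2_iff)
    show "(\<lambda>x. (cmod (f x + g x))\<^sup>2) \<in> borel_measurable M"
      using assms by (auto simp: L2_iff)
    have "(cmod (z + w))\<^sup>2 \<le> 2 * (cmod z)\<^sup>2 + 2 * (cmod w)\<^sup>2" for z w
    proof -
      have "(cmod (z + w))\<^sup>2 \<le> (cmod z + cmod w)\<^sup>2"
        by (intro power_mono norm_triangle_ineq) auto
      also have "\<dots> \<le> 2 * (cmod z)\<^sup>2 + 2 * (cmod w)\<^sup>2"
        using sum_squares_bound[of "cmod z" "cmod w"] by (simp add: power2_sum)
      finally show ?thesis .
    qed
    then show "AE x in M. norm ((cmod (f x + g x))\<^sup>2) \<le> norm (2 * (cmod (f x))\<^sup>2 + 2 * (cmod (g x))\<^sup>2)"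
      by auto
  qed
  then show ?thesis using assms by (auto simp: L2_iff)
qed

lemma L2_diff:
  assumes "f \<in> L2 M" "g \<in> L2 M"
  shows "(\<lambda>x. f x - g x) \<in> L2 M"
  using L2_add[OF assms(1) L2_scale[OF assms(2), of "-1"]] by simp

lemma L2_sum: "(\<And>i. i \<in> F \<Longrightarrow> f i \<in> L2 M) \<Longrightarrow> (\<lambda>x. \<Sum>i\<in>F. f i x) \<in> L2 M"
  by (induction F rule: infinite_finite_induct) (auto intro: L2_zero L2_add)

lemma l2_inner_scale_left: "l2_inner M (\<lambda>x. c * f x) g = c * l2_inner M f g"
  unfolding l2_inner_def by (simp add: mult.assoc)

lemma l2_inner_commute: "l2_inner M g f = cnj (l2_inner M f g)"
  unfolding l2_inner_def by (subst Bochner_Integration.integral_cnj[symmetric]) (simp add: mult.commute)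

lemma l2_inner_scale_right: "l2_inner M f (\<lambda>x. c * g x) = cnj c * l2_inner M f g"
  using l2_inner_scale_left[of M c g f] by (metis complex_cnj_mult l2_inner_commute)

lemma l2_inner_add_left:
  "f \<in> L2 M \<Longrightarrow> g \<in> L2 M \<Longrightarrow> h \<in> L2 M \<Longrightarrow>
     l2_inner M (\<lambda>x. f x + g x) h = l2_inner M f h + l2_inner M g h"
  unfolding l2_inner_def by (simp add: L2_mult_integrable distrib_right)

lemma l2_inner_diff_left:
  "f \<in> L2 M \<Longrightarrow> g \<in> L2 M \<Longrightarrow> h \<in> L2 M \<Longrightarrow>
     l2_inner M (\<lambda>x. f x - g x) h = l2_inner M f h - l2_inner M g h"
  unfolding l2_inner_def by (simp add: L2_mult_integrable left_diff_distrib)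

lemma l2_inner_add_right:
  "f \<in> L2 M \<Longrightarrow> g \<in> L2 M \<Longrightarrow> h \<in> L2 M \<Longrightarrow>
     l2_inner M h (\<lambda>x. f x + g x) = l2_inner M h f + l2_inner M h g"
  unfolding l2_inner_commute[of M h] by (simp add: l2_inner_add_left)

lemma l2_inner_sum_left:
  assumes "\<And>i. i \<in> F \<Longrightarrow> f i \<in> L2 M" "h \<in> L2 M"
  shows "l2_inner M (\<lambda>x. \<Sum>i\<in>F. f i x) h = (\<Sum>i\<in>F. l2_inner M (f i) h)"
  using assms(1)
proof (induction F rule: infinite_finite_induct)
  case (insert i F)
  then show ?case
    by (simp add: l2_inner_add_left[OF _ L2_sum assms(2)])
qed (auto simp: l2_inner_def)

lemma l2_norm_nonneg: "0 \<le> l2_norm M f"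
  by (simp add: l2_norm_def)

lemma l2_norm_power2: "(l2_norm M f)\<^sup>2 = (LINT x|M. (cmod (f x))\<^sup>2)"
  by (simp add: l2_norm_def)

lemma l2_inner_self: "l2_inner M f f = of_real ((l2_norm M f)\<^sup>2)"
  by (simp add: l2_norm_power2 l2_inner_def complex_norm_square[symmetric] flip: of_real_power)

lemma l2_norm_scale: "l2_norm M (\<lambda>x. c * f x) = cmod c * l2_norm M f"
  by (simp add: l2_norm_def norm_mult power_mult_distrib real_sqrt_mult)

lemma l2_norm_eq_0_iff:
  "f \<in> L2 M \<Longrightarrow> l2_norm M f = 0 \<longleftrightarrow> (AE x in M. f x = 0)"
  by (simp add: l2_norm_def L2_iff integral_nonneg_eq_0_iff_AE)

lemma l2_norm_power2_add:
  assumes "f \<in> L2 M" "g \<in> L2 M"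
  shows "(l2_norm M (\<lambda>x. f x + g x))\<^sup>2 =
           (l2_norm M f)\<^sup>2 + (l2_norm M g)\<^sup>2 + 2 * Re (l2_inner M f g)"
proof -
  have "complex_of_real ((l2_norm M (\<lambda>x. f x + g x))\<^sup>2) =
     of_real ((l2_norm M f)\<^sup>2) + of_real ((l2_norm M g)\<^sup>2) + (l2_inner M f g + cnj (l2_inner M f g))"
    unfolding l2_inner_self[symmetric]
    using assms L2_add[OF assms]
    by (simp add: l2_inner_add_left l2_inner_add_right l2_inner_commute[of M g f])
  then show ?thesis
    by (simp add: complex_add_cnj complex_eq_iff)
qed

lemma l2_norm_power2_diff:
  assumes "f \<in> L2 M" "g \<in> L2 M"
  shows "(l2_norm M (\<lambda>x. f x - g x))\<^sup>2 =
           (l2_norm M f)\<^sup>2 + (l2_norm M g)\<^sup>2 - 2 * Re (l2_inner M f g)"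
  using l2_norm_power2_add[OF assms(1) L2_scale[OF assms(2), of "-1"]]
    l2_norm_scale[of M "-1" g] l2_inner_scale_right[of M f "-1" g]
  by simp

lemma l2_Cauchy_Schwarz:
  assumes "f \<in> L2 M" "g \<in> L2 M"
  shows "cmod (l2_inner M f g) \<le> l2_norm M f * l2_norm M g"
proof (cases "l2_norm M g = 0")
  case True
  then have "AE x in M. f x * cnj (g x) = 0"
    using assms by (auto simp: l2_norm_eq_0_iff)
  then have "l2_inner M f g = 0"
    unfolding l2_inner_def by (rule integral_eq_zero_AE)
  then show ?thesis
    by (simp add: l2_norm_nonneg)
next
  case False
  define G a where "G = (l2_norm M g)\<^sup>2" and "a = l2_inner M f g"
  have G: "G > 0" using False by (simp add: G_def)
  have "0 \<le> (l2_norm M (\<lambda>x. f x - (a / of_real G) * g x))\<^sup>2" by simp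
  also have "\<dots> = (l2_norm M f)\<^sup>2 + (cmod a / G * l2_norm M g)\<^sup>2 - 2 * Re (cnj (a / of_real G) * a)"
    using G unfolding l2_norm_power2_diff[OF assms(1) L2_scale[OF assms(2)]] l2_norm_scale
      l2_inner_scale_right a_def[symmetric] by (simp add: norm_divide)
  also have "(cmod a / G * l2_norm M g)\<^sup>2 = (cmod a)\<^sup>2 / G"
    using G by (simp add: power_mult_distrib power_divide G_def power2_eq_square)
  also have "cnj (a / of_real G) * a = cnj a * a / of_real G"
    by simp
  also have "cnj a * a = of_real ((cmod a)\<^sup>2)"
    by (simp add: complex_norm_square mult.commute flip: of_real_power)
  finally have "(cmod a)\<^sup>2 / G \<le> (l2_norm M f)\<^sup>2" by (simp flip: of_real_divide)
  then have "(cmod a)\<^sup>2 \<le> (l2_norm M f * l2_norm M g)\<^sup>2"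
    using G by (simp add: field_simps power_mult_distrib G_def)
  then show ?thesis
    unfolding a_def by (rule power2_le_imp_le) (intro mult_nonneg_nonneg l2_norm_nonneg)
qed

lemma l2_norm_triangle:
  assumes "f \<in> L2 M" "g \<in> L2 M"
  shows "l2_norm M (\<lambda>x. f x + g x) \<le> l2_norm M f + l2_norm M g"
proof (rule power2_le_imp_le)
  have "Re (l2_inner M f g) \<le> l2_norm M f * l2_norm M g"
    by (rule order_trans[OF complex_Re_le_cmod l2_Cauchy_Schwarz[OF assms]])
  then show "(l2_norm M (\<lambda>x. f x + g x))\<^sup>2 \<le> (l2_norm M f + l2_norm M g)\<^sup>2"
    by (simp add: l2_norm_power2_add[OF assms] power2_sum)
qed (simp add: l2_norm_nonneg)

lemma l2_norm_triangle_diff: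
  assumes "f \<in> L2 M" "g \<in> L2 M"
  shows "l2_norm M (\<lambda>x. f x - g x) \<le> l2_norm M f + l2_norm M g"
  using l2_norm_triangle[OF assms(1) L2_scale[OF assms(2), of "-1"]] l2_norm_scale[of M "-1" g]
  by simp

lemma l2_norm_triangle_sum:
  assumes "\<And>i. i \<in> F \<Longrightarrow> f i \<in> L2 M"
  shows "l2_norm M (\<lambda>x. \<Sum>i\<in>F. f i x) \<le> (\<Sum>i\<in>F. l2_norm M (f i))"
  using assms
proof (induction F rule: infinite_finite_induct)
  case (insert i F)
  then have "l2_norm M (\<lambda>x. f i x + (\<Sum>i\<in>F. f i x)) \<le> l2_norm M (f i) + l2_norm M (\<lambda>x. \<Sum>i\<in>F. f i x)"
    by (intro l2_norm_triangle L2_sum) auto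
  with insert show ?case by force
qed (auto simp: l2_norm_def)

section \<open>Orthonormal families: Bessel's inequality, completeness, expansions\<close>

definition l2_orthonormal :: "'a measure \<Rightarrow> 'i set \<Rightarrow> ('i \<Rightarrow> 'a \<Rightarrow> complex) \<Rightarrow> bool" where
  "l2_orthonormal M I e \<longleftrightarrow> (\<forall>i\<in>I. e i \<in> L2 M) \<and>
     (\<forall>i\<in>I. \<forall>j\<in>I. l2_inner M (e i) (e j) = (if i = j then 1 else 0))"

lemma l2_orthonormalD:
  assumes "l2_orthonormal M I e"
  shows "i \<in> I \<Longrightarrow> e i \<in> L2 M"
    and "i \<in> I \<Longrightarrow> j \<in> I \<Longrightarrow> l2_inner M (e i) (e j) = (if i = j then 1 else 0)"
  using assms by (auto simp: l2_orthonormal_def)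

lemma l2_orthonormal_combination:
  assumes "l2_orthonormal M I e" "finite F" "F \<subseteq> I"
  shows "(\<lambda>x. \<Sum>i\<in>F. c i * e i x) \<in> L2 M"
  using assms by (intro L2_sum L2_scale) (auto simp: l2_orthonormal_def)

lemma l2_inner_combination:
  assumes e: "l2_orthonormal M I e" and F: "finite F" "F \<subseteq> I" and j: "j \<in> I"
  shows "l2_inner M (\<lambda>x. \<Sum>i\<in>F. c i * e i x) (e j) = (if j \<in> F then c j else 0)"
proof -
  have "l2_inner M (\<lambda>x. \<Sum>i\<in>F. c i * e i x) (e j) = (\<Sum>i\<in>F. c i * l2_inner M (e i) (e j))"
    using F j l2_orthonormalD[OF e]
    by (subst l2_inner_sum_left) (auto intro!: L2_scale simp: l2_inner_scale_left)
  also have "\<dots> = (\<Sum>i\<in>F. if i = j then c j else 0)"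
    using F j by (intro sum.cong refl) (auto simp: l2_orthonormalD(2)[OF e])
  finally show ?thesis using F(1) by simp
qed

lemma l2_norm_combination:
  assumes e: "l2_orthonormal M I e" and F: "finite F" "F \<subseteq> I"
  shows "(l2_norm M (\<lambda>x. \<Sum>i\<in>F. c i * e i x))\<^sup>2 = (\<Sum>i\<in>F. (cmod (c i))\<^sup>2)"
proof -
  let ?g = "\<lambda>x. \<Sum>i\<in>F. c i * e i x"
  have g: "?g \<in> L2 M" by (rule l2_orthonormal_combination[OF e F])
  have "l2_inner M ?g ?g = (\<Sum>i\<in>F. c i * l2_inner M (e i) ?g)"
    using F l2_orthonormalD[OF e] g
    by (subst l2_inner_sum_left) (auto intro!: L2_scale simp: l2_inner_scale_left)
  also have "\<dots> = (\<Sum>i\<in>F. c i * cnj (c i))"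
    using F by (intro sum.cong refl)
      (subst l2_inner_commute, subst l2_inner_combination[OF e F], auto)
  also have "\<dots> = of_real (\<Sum>i\<in>F. (cmod (c i))\<^sup>2)"
    by (simp add: complex_norm_square del: of_real_power)
  finally show ?thesis
    unfolding l2_inner_self of_real_eq_iff .
qed

text \<open>Completing the square: only the last sum depends on \<open>c\<close>, and it vanishes
  for the Fourier coefficients. Bessel's inequality and the optimality of Fourier sums both
  follow.\<close>

lemma l2_norm_diff_combination:
  assumes e: "l2_orthonormal M I e" and F: "finite F" "F \<subseteq> I" and f: "f \<in> L2 M"
  shows "(l2_norm M (\<lambda>x. f x - (\<Sum>i\<in>F. c i * e i x)))\<^sup>2 =
    (l2_norm M f)\<^sup>2 - (\<Sum>i\<in>F. (cmod (l2_inner M f (e i)))\<^sup>2) + (\<Sum>i\<in>F. (cmod (c i - l2_inner M f (e i)))\<^sup>2)"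
proof -
  let ?g = "\<lambda>x. \<Sum>i\<in>F. c i * e i x"
  have g: "?g \<in> L2 M" by (rule l2_orthonormal_combination[OF e F])
  have "l2_inner M f ?g = cnj (\<Sum>i\<in>F. c i * l2_inner M (e i) f)"
    using F l2_orthonormalD[OF e] f
    by (subst l2_inner_commute, subst l2_inner_sum_left)
      (auto intro!: L2_scale simp: l2_inner_scale_left)
  also have "\<dots> = (\<Sum>i\<in>F. cnj (c i) * l2_inner M f (e i))"
    by (simp add: l2_inner_commute[of M f])
  finally have ip: "l2_inner M f ?g = (\<Sum>i\<in>F. cnj (c i) * l2_inner M f (e i))" .
  have "(cmod (c - d))\<^sup>2 = (cmod c)\<^sup>2 + (cmod d)\<^sup>2 - 2 * Re (cnj c * d)" for c d
    unfolding cmod_power2 by (simp add: power2_eq_square algebra_simps)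
  then have "(\<Sum>i\<in>F. (cmod (c i - l2_inner M f (e i)))\<^sup>2) =
      (\<Sum>i\<in>F. (cmod (c i))\<^sup>2 + (cmod (l2_inner M f (e i)))\<^sup>2 - 2 * Re (cnj (c i) * l2_inner M f (e i)))"
    by (intro sum.cong refl)
  also have "\<dots> = (\<Sum>i\<in>F. (cmod (c i))\<^sup>2) + (\<Sum>i\<in>F. (cmod (l2_inner M f (e i)))\<^sup>2)
      - 2 * Re (\<Sum>i\<in>F. cnj (c i) * l2_inner M f (e i))"
    unfolding sum_subtractf sum.distrib Re_sum sum_distrib_left[symmetric] ..
  finally have S: "(\<Sum>i\<in>F. (cmod (c i - l2_inner M f (e i)))\<^sup>2) = \<dots>" .
  show ?thesis
    unfolding l2_norm_power2_diff[OF f g] l2_norm_combination[OF e F] ip S by simp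
qed

lemma l2_Bessel:
  assumes "l2_orthonormal M I e" "finite F" "F \<subseteq> I" "f \<in> L2 M"
  shows "(\<Sum>i\<in>F. (cmod (l2_inner M f (e i)))\<^sup>2) \<le> (l2_norm M f)\<^sup>2"
proof -
  have "0 \<le> (l2_norm M (\<lambda>x. f x - (\<Sum>i\<in>F. l2_inner M f (e i) * e i x)))\<^sup>2"
    by (rule zero_le_power2)
  then show ?thesis
    unfolding l2_norm_diff_combination[OF assms] by simp
qed

lemma l2_Bessel_summable:
  assumes "l2_orthonormal M I e" "f \<in> L2 M"
  shows "(\<lambda>i. (cmod (l2_inner M f (e i)))\<^sup>2) summable_on I"
  by (rule nonneg_bdd_above_summable_on)
    (use l2_Bessel[OF assms(1) _ _ assms(2)] in \<open>auto intro!: bdd_aboveI2\<close>)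

text \<open>Riesz--Fischer: the rapidly converging Cauchy sequence is dominated by the \<open>L\<^sup>2\<close> function
  \<open>|p 0| + (\<Sum>n. |p (n+1) - p n|)\<close>.\<close>

lemma l2_limit_of_rapid_Cauchy:
  fixes p :: "nat \<Rightarrow> 'a \<Rightarrow> complex"
  assumes p: "\<And>n. p n \<in> L2 M" and d: "\<And>n. l2_norm M (\<lambda>x. p (Suc n) x - p n x) \<le> (1/2) ^ n"
  obtains g where "g \<in> L2 M" "(\<lambda>n. l2_norm M (\<lambda>x. g x - p n x)) \<longlonglongrightarrow> 0"
proof -
  define D where "D n x = cmod (p (Suc n) x - p n x)" for n x
  define H where "H n x = cmod (p 0 x) + (\<Sum>k<n. D k x)" for n x
  define G where "G x = (SUP n. ennreal ((H n x)\<^sup>2))" for x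
  have [measurable]: "p n \<in> borel_measurable M" for n using p by (simp add: L2_iff)
  have [measurable]: "D n \<in> borel_measurable M" for n unfolding D_def by measurable
  have [measurable]: "H n \<in> borel_measurable M" for n unfolding H_def by measurable
  have [measurable]: "G \<in> borel_measurable M" unfolding G_def by measurable
  have D_nn: "0 \<le> D n x" for n x by (simp add: D_def)
  have H_nn: "0 \<le> H n x" for n x unfolding H_def by (intro add_nonneg_nonneg sum_nonneg D_nn) auto
  have H_mono: "H n x \<le> H m x" if "n \<le> m" for n m x
    unfolding H_def using that D_nn by (intro add_left_mono sum_mono2) auto
  have DL: "(\<lambda>x. of_real (D n x)) \<in> L2 M" and Dn: "l2_norm M (\<lambda>x. of_real (D n x)) \<le> (1/2)^n" for n
    using L2_diff[OF p[of "Suc n"] p[of n]] d[of n]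
    by (auto simp: L2_iff l2_norm_def D_def)
  have p0: "(\<lambda>x. of_real (cmod (p 0 x))) \<in> L2 M" using p[of 0] by (auto simp: L2_iff)
  \<comment> \<open>The 2 bounds the geometric series of the increments.\<close>
  define B where "B = l2_norm M (\<lambda>x. of_real (cmod (p 0 x))) + 2"
  have HB: "(\<integral>\<^sup>+x. ennreal ((H n x)\<^sup>2) \<partial>M) \<le> ennreal (B\<^sup>2)" for n
  proof -
    have HL: "(\<lambda>x. of_real (H n x)) \<in> L2 M"
      unfolding H_def of_real_add of_real_sum by (intro L2_add L2_sum p0 DL)
    have "l2_norm M (\<lambda>x. of_real (H n x)) \<le> l2_norm M (\<lambda>x. of_real (cmod (p 0 x))) + l2_norm M (\<lambda>x. \<Sum>k<n. of_real (D k x))"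
      unfolding H_def of_real_add of_real_sum by (intro l2_norm_triangle L2_sum p0 DL)
    also have "l2_norm M (\<lambda>x. \<Sum>k<n. of_real (D k x)) \<le> (\<Sum>k<n. l2_norm M (\<lambda>x. of_real (D k x)))"
      by (intro l2_norm_triangle_sum DL)
    also have "\<dots> \<le> (\<Sum>k<n. (1/2)^k)" by (intro sum_mono Dn)
    also have "\<dots> \<le> 2" by (simp add: sum_gp_strict)
    finally have "l2_norm M (\<lambda>x. of_real (H n x)) \<le> B" by (simp add: B_def)
    then have "(l2_norm M (\<lambda>x. of_real (H n x)))\<^sup>2 \<le> B\<^sup>2"
      by (intro power_mono l2_norm_nonneg)
    then have "(LINT x|M. (H n x)\<^sup>2) \<le> B\<^sup>2" by (simp add: l2_norm_power2)
    moreover have "integrable M (\<lambda>x. (H n x)\<^sup>2)" using HL by (simp add: L2_iff)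
    ultimately show ?thesis by (simp add: nn_integral_eq_integral ennreal_leI)
  qed
  have "(\<integral>\<^sup>+x. G x \<partial>M) = (SUP n. \<integral>\<^sup>+x. ennreal ((H n x)\<^sup>2) \<partial>M)"
    unfolding G_def by (rule nn_integral_monotone_convergence_SUP)
      (auto simp: incseq_def le_fun_def intro!: ennreal_leI power_mono H_mono H_nn)
  also have "\<dots> \<le> ennreal (B\<^sup>2)" by (intro SUP_least HB)
  finally have Gfin: "(\<integral>\<^sup>+x. G x \<partial>M) < \<infinity>" by (metis ennreal_less_top infinity_ennreal_def le_less_trans)
  then have GAE: "AE x in M. G x \<noteq> \<infinity>" by (intro nn_integral_noteq_infinite) auto
  \<comment> \<open>\<open>lim\<close> is a total operator; its value at divergent points is
    arbitrary, but these lie in the null set where \<open>G\<close> is infinite.\<close>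
  define g where "g x = lim (\<lambda>n. p n x)" for x
  have [measurable]: "g \<in> borel_measurable M" unfolding g_def by measurable
  \<comment> \<open>\<open>enn2real\<close> sends infinite values to 0; this happens on a null set
    and gives a real dominating function.\<close>
  define W where "W x = enn2real (G x)" for x
  have [measurable]: "W \<in> borel_measurable M" unfolding W_def by measurable
  have Wint: "integrable M W"
  proof (rule integrableI_bounded)
    have "(\<integral>\<^sup>+x. ennreal (norm (W x)) \<partial>M) \<le> (\<integral>\<^sup>+x. G x \<partial>M)"
      by (intro nn_integral_mono) (simp add: W_def, metis ennreal_enn2real_if order.refl zero_le)
    then show "(\<integral>\<^sup>+x. ennreal (norm (W x)) \<partial>M) < \<infinity>" using Gfin by (rule le_less_trans)
  qed auto
  have pt: "(\<lambda>n. p n x) \<longlonglongrightarrow> g x \<and> (\<forall>n. (cmod (p n x))\<^sup>2 \<le> W x) \<and> (cmod (g x))\<^sup>2 \<le> W x"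
    if "G x \<noteq> \<infinity>" for x
  proof -
    have W: "(H n x)\<^sup>2 \<le> W x" for n
    proof -
      have "ennreal ((H n x)\<^sup>2) \<le> G x" unfolding G_def by (rule SUP_upper) auto
      also have "G x = ennreal (W x)" using that by (simp add: W_def less_top)
      finally show ?thesis by (simp add: W_def)
    qed
    have "(\<Sum>k<n. D k x) \<le> sqrt (W x)" for n
    proof -
      have "H n x \<le> sqrt (W x)" using W[of n] H_nn[of n x] by (simp add: real_le_rsqrt)
      then show ?thesis unfolding H_def using norm_ge_zero[of "p 0 x"] by linarith
    qed
    then have "summable (\<lambda>k. D k x)"
      by (intro bounded_imp_summable[where B="sqrt (W x)"])
        (simp_all add: D_nn lessThan_Suc_atMost[symmetric] del: sum.lessThan_Suc)
    then have "summable (\<lambda>k. p (Suc k) x - p k x)" unfolding D_def by (rule summable_norm_cancel)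
    then have "convergent (\<lambda>n. \<Sum>k<n. p (Suc k) x - p k x)" by (simp add: summable_iff_convergent)
    then have "convergent (\<lambda>n. p n x - p 0 x)" by (simp only: sum_lessThan_telescope[of "\<lambda>n. p n x"])
    then have "convergent (\<lambda>n. (p n x - p 0 x) + p 0 x)" by (intro convergent_add convergent_const)
    then have lim: "(\<lambda>n. p n x) \<longlonglongrightarrow> g x" by (simp add: g_def convergent_LIMSEQ_iff)
    have "cmod (p n x) \<le> H n x" for n
    proof (induction n)
      case (Suc n)
      have "cmod (p (Suc n) x) \<le> cmod (p n x) + D n x" unfolding D_def
        by (metis add.commute diff_add_cancel norm_triangle_ineq)
      with Suc show ?case by (simp add: H_def)
    qed (simp add: H_def)
    then have b: "(cmod (p n x))\<^sup>2 \<le> W x" for n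
      by (meson W norm_ge_zero order_trans power_mono)
    moreover have "(cmod (g x))\<^sup>2 \<le> W x"
      by (rule LIMSEQ_le_const2[OF tendsto_power[OF tendsto_norm[OF lim]]]) (use b in auto)
    ultimately show ?thesis using lim by blast
  qed
  have gL: "g \<in> L2 M" unfolding L2_iff
  proof (intro conjI)
    show "integrable M (\<lambda>x. (cmod (g x))\<^sup>2)"
      by (rule Bochner_Integration.integrable_bound[OF Wint]) (use GAE pt in \<open>auto elim!: eventually_mono simp: W_def\<close>)
  qed auto
  have "(\<lambda>n. LINT x|M. (cmod (g x - p n x))\<^sup>2) \<longlonglongrightarrow> (LINT x|M. 0)"
  \<comment> \<open>The factor 4 comes from |a - b|^2 <= 2|a|^2 + 2|b|^2 with both squares at most
    \<open>W x\<close>.\<close>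
  proof (rule integral_dominated_convergence[where w="\<lambda>x. 4 * W x"])
    show "AE x in M. (\<lambda>n. (cmod (g x - p n x))\<^sup>2) \<longlonglongrightarrow> 0"
      using GAE
    proof eventually_elim
      case (elim x)
      then have "(\<lambda>n. (cmod (g x - p n x))\<^sup>2) \<longlonglongrightarrow> (cmod (g x - g x))\<^sup>2"
        using pt by (intro tendsto_intros) auto
      then show ?case by simp
    qed
    fix n
    show "AE x in M. norm ((cmod (g x - p n x))\<^sup>2) \<le> 4 * W x"
      using GAE
    proof eventually_elim
      case (elim x)
      have "(cmod (g x - p n x))\<^sup>2 \<le> (cmod (g x) + cmod (p n x))\<^sup>2"
        by (intro power_mono norm_triangle_ineq4) auto
      also have "\<dots> \<le> 2 * (cmod (g x))\<^sup>2 + 2 * (cmod (p n x))\<^sup>2"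
        using sum_squares_bound[of "cmod (g x)" "cmod (p n x)"] by (simp add: power2_sum)
      finally show ?case using pt[OF elim] by (smt (verit) real_norm_def zero_le_power2 abs_of_nonneg)
    qed
  qed (use Wint in auto)
  then have "(\<lambda>n. l2_norm M (\<lambda>x. g x - p n x)) \<longlonglongrightarrow> 0"
    unfolding l2_norm_def using tendsto_real_sqrt by fastforce
  with gL show ?thesis by (rule that)
qed

text \<open>Finite sets \<open>K n\<close> that exhaust the supremum \<open>S\<close> of the Bessel
  sums give rapidly converging Fourier sums. Their limit has the same coefficients as
  \<open>f\<close>, so totality identifies it with \<open>f\<close> up to norm zero.\<close>

lemma orthonormal_basis_of_total:
  assumes e: "l2_orthonormal M I e"
    and total: "\<And>f. f \<in> L2 M \<Longrightarrow> (\<And>i. i \<in> I \<Longrightarrow> l2_inner M f (e i) = 0) \<Longrightarrow> l2_norm M f = 0"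
  shows "orthonormal_basis M I e"
  unfolding orthonormal_basis_def
proof (intro conjI ballI allI impI)
  fix f and \<epsilon> :: real assume f: "f \<in> L2 M" and "\<epsilon> > 0"
  define a where "a i = l2_inner M f (e i)" for i
  define S where "S = (SUP F\<in>{F. finite F \<and> F \<subseteq> I}. \<Sum>i\<in>F. (cmod (a i))\<^sup>2)"
  have bdd: "bdd_above ((\<lambda>F. \<Sum>i\<in>F. (cmod (a i))\<^sup>2) ` {F. finite F \<and> F \<subseteq> I})"
    unfolding a_def by (auto intro!: bdd_aboveI2 l2_Bessel[OF e] f)
  \<comment> \<open>An error of \<open>(1/4)^n\<close> in the squared norm becomes, after the square
    root, the rate \<open>(1/2)^n\<close> required for the limit.\<close>
  have "\<exists>F\<in>{F. finite F \<and> F \<subseteq> I}. S - (1/4)^n < (\<Sum>i\<in>F. (cmod (a i))\<^sup>2)" for n :: nat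
  proof -
    have "S - (1/4)^n < S" by simp
    then show ?thesis unfolding S_def by (subst (asm) less_cSUP_iff[OF _ bdd]) auto
  qed
  then obtain F where F: "\<And>n::nat. finite (F n) \<and> F n \<subseteq> I \<and> S - (1/4)^n < (\<Sum>i\<in>F n. (cmod (a i))\<^sup>2)"
    by (metis (mono_tags, lifting) mem_Collect_eq)
  define K where "K n = (\<Union>m\<le>n. F m)" for n
  have K: "finite (K n)" "K n \<subseteq> I" "F n \<subseteq> K n" "K n \<subseteq> K (Suc n)" for n
    using F by (auto simp: K_def intro: le_SucI)
  have KS: "S - (1/4)^n < (\<Sum>i\<in>K n. (cmod (a i))\<^sup>2)" for n
    using F[of n] sum_mono2[OF K(1)[of n] K(3)[of n], of "\<lambda>i. (cmod (a i))\<^sup>2"] by force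
  have upper: "(\<Sum>i\<in>H. (cmod (a i))\<^sup>2) \<le> S" if "finite H" "H \<subseteq> I" for H
    unfolding S_def by (rule cSUP_upper[OF _ bdd]) (use that in auto)
  have tail: "(\<Sum>i\<in>H - K n. (cmod (a i))\<^sup>2) \<le> (1/4)^n" if "finite H" "H \<subseteq> I" for H n
  proof -
    have "(\<Sum>i\<in>K n \<union> (H - K n). (cmod (a i))\<^sup>2) = (\<Sum>i\<in>K n. (cmod (a i))\<^sup>2) + (\<Sum>i\<in>H - K n. (cmod (a i))\<^sup>2)"
      using that K by (intro sum.union_disjoint) auto
    moreover have "(\<Sum>i\<in>K n \<union> (H - K n). (cmod (a i))\<^sup>2) \<le> S"
      using that K by (intro upper) auto
    ultimately show ?thesis using KS[of n] by linarith
  qed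
  define p where "p n x = (\<Sum>i\<in>K n. a i * e i x)" for n x
  have p: "p n \<in> L2 M" for n
    unfolding p_def by (rule l2_orthonormal_combination[OF e K(1,2)])
  have "l2_norm M (\<lambda>x. p (Suc n) x - p n x) \<le> (1/2)^n" for n
  proof -
    have "p (Suc n) x - p n x = (\<Sum>i\<in>K (Suc n) - K n. a i * e i x)" for x
      unfolding p_def using K by (simp add: sum_diff)
    then have "(l2_norm M (\<lambda>x. p (Suc n) x - p n x))\<^sup>2 = (\<Sum>i\<in>K (Suc n) - K n. (cmod (a i))\<^sup>2)"
      using K by (simp add: l2_norm_combination[OF e] Diff_subset[THEN order_trans])
    also have "\<dots> \<le> (1/4)^n" by (rule tail[OF K(1,2)])
    also have "\<dots> = ((1/2)^n)\<^sup>2" by (simp add: power2_eq_square flip: power_mult_distrib)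
    finally show ?thesis by (rule power2_le_imp_le) simp
  qed
  then obtain g where g: "g \<in> L2 M" and lim: "(\<lambda>n. l2_norm M (\<lambda>x. g x - p n x)) \<longlonglongrightarrow> 0"
    by (rule l2_limit_of_rapid_Cauchy[OF p])
  have "l2_inner M (\<lambda>x. f x - g x) (e j) = 0" if j: "j \<in> I" for j
  proof -
    have ej: "e j \<in> L2 M" "l2_norm M (e j) = 1"
      using l2_orthonormalD[OF e j] j l2_inner_self[of M "e j"] l2_norm_nonneg[of M "e j"]
      by (auto simp: power2_eq_1_iff complex_eq_iff simp flip: of_real_power)
    have "cmod (l2_inner M (\<lambda>x. f x - g x) (e j)) \<le> l2_norm M (\<lambda>x. g x - p n x) + (1/2)^n" for n
    proof -
      have eq: "l2_inner M (\<lambda>x. f x - g x) (e j) = (a j - (if j \<in> K n then a j else 0)) - l2_inner M (\<lambda>x. g x - p n x) (e j)"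
        using l2_inner_combination[OF e K(1)[of n] K(2)[of n] j, of a]
        unfolding l2_inner_diff_left[OF f g ej(1)] l2_inner_diff_left[OF g p ej(1)]
        by (simp add: a_def[symmetric] p_def[abs_def])
      \<comment> \<open>For \<open>j\<close> outside \<open>K n\<close> the coefficient at
        \<open>j\<close> is by itself a tail.\<close>
      have "cmod (a j - (if j \<in> K n then a j else 0)) \<le> (1/2)^n"
      proof (rule power2_le_imp_le)
        show "(cmod (a j - (if j \<in> K n then a j else 0)))\<^sup>2 \<le> ((1/2)^n)\<^sup>2"
          using tail[of "{j}" n] j by (auto simp: insert_Diff_if power2_eq_square simp flip: power_mult_distrib)
      qed simp
      moreover have "cmod (l2_inner M (\<lambda>x. g x - p n x) (e j)) \<le> l2_norm M (\<lambda>x. g x - p n x)"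
        using l2_Cauchy_Schwarz[OF L2_diff[OF g p[of n]] ej(1)] ej by simp
      ultimately show ?thesis unfolding eq
        by (smt (verit, best) norm_triangle_ineq4)
    qed
    moreover have "(\<lambda>n. l2_norm M (\<lambda>x. g x - p n x) + (1/2)^n) \<longlonglongrightarrow> 0 + 0"
      by (intro tendsto_add lim LIMSEQ_power_zero) auto
    ultimately have "cmod (l2_inner M (\<lambda>x. f x - g x) (e j)) \<le> 0"
      using LIMSEQ_le_const by fastforce
    then show ?thesis by simp
  qed
  then have fg: "l2_norm M (\<lambda>x. f x - g x) = 0"
    by (intro total L2_diff f g)
  obtain n where n: "l2_norm M (\<lambda>x. g x - p n x) < \<epsilon>"
    using order_tendstoD(2)[OF lim \<open>\<epsilon> > 0\<close>] by (auto simp: eventually_sequentially)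
  have "l2_norm M (\<lambda>x. (f x - g x) + (g x - p n x)) \<le> l2_norm M (\<lambda>x. f x - g x) + l2_norm M (\<lambda>x. g x - p n x)"
    by (intro l2_norm_triangle L2_diff f g p)
  then have "l2_norm M (\<lambda>x. f x - p n x) < \<epsilon>" using fg n by simp
  then show "\<exists>F c. finite F \<and> F \<subseteq> I \<and> l2_norm M (\<lambda>x. f x - (\<Sum>i\<in>F. c i * e i x)) < \<epsilon>"
    unfolding p_def using K by blast
qed (use e in \<open>auto simp: l2_orthonormal_def\<close>)

lemma orthonormal_basis_imp_orthonormal: "orthonormal_basis M I e \<Longrightarrow> l2_orthonormal M I e"
  by (simp add: orthonormal_basis_def l2_orthonormal_def)

text \<open>Density supplies one finite combination near \<open>f\<close>; Fourier coefficients over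
  any larger finite set do at least as well, which is convergence along the finite subsets.\<close>

lemma orthonormal_basis_expansion:
  assumes "orthonormal_basis M I e" "f \<in> L2 M"
  shows "l2_has_sum M (\<lambda>i x. l2_inner M f (e i) * e i x) I f"
  unfolding l2_has_sum_def
proof (rule tendstoI)
  fix \<epsilon> :: real assume "\<epsilon> > 0"
  have e: "l2_orthonormal M I e" using assms(1) by (rule orthonormal_basis_imp_orthonormal)
  obtain F c where F: "finite F" "F \<subseteq> I" and *: "l2_norm M (\<lambda>x. f x - (\<Sum>i\<in>F. c i * e i x)) < \<epsilon>"
    using assms \<open>\<epsilon> > 0\<close> unfolding orthonormal_basis_def by blast
  have "l2_norm M (\<lambda>x. f x - (\<Sum>i\<in>K. l2_inner M f (e i) * e i x)) < \<epsilon>"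
    if K: "finite K" "F \<subseteq> K" "K \<subseteq> I" for K
  proof -
    have "(l2_norm M (\<lambda>x. f x - (\<Sum>i\<in>K. l2_inner M f (e i) * e i x)))\<^sup>2
        \<le> (l2_norm M (\<lambda>x. f x - (\<Sum>i\<in>F. c i * e i x)))\<^sup>2"
      using sum_mono2[OF K(1,2), of "\<lambda>i. (cmod (l2_inner M f (e i)))\<^sup>2"]
        sum_nonneg[of F "\<lambda>i. (cmod (c i - l2_inner M f (e i)))\<^sup>2"]
      by (simp add: l2_norm_diff_combination[OF e K(1,3) assms(2)] l2_norm_diff_combination[OF e F assms(2)])
    then have "l2_norm M (\<lambda>x. f x - (\<Sum>i\<in>K. l2_inner M f (e i) * e i x))
        \<le> l2_norm M (\<lambda>x. f x - (\<Sum>i\<in>F. c i * e i x))"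
      by (rule power2_le_imp_le) (rule l2_norm_nonneg)
    with * show ?thesis by simp
  qed
  then show "\<forall>\<^sub>F K in finite_subsets_at_top I.
      dist (l2_norm M (\<lambda>x. f x - (\<Sum>i\<in>K. l2_inner M f (e i) * e i x))) 0 < \<epsilon>"
    unfolding eventually_finite_subsets_at_top using F by (auto simp: l2_norm_nonneg)
qed

section \<open>Characters of the compact quotient\<close>

definition periodic :: "'a::ab_group_add set \<Rightarrow> ('a \<Rightarrow> 'b) \<Rightarrow> bool" where
  "periodic \<Lambda> f \<longleftrightarrow> (\<forall>x. \<forall>l\<in>\<Lambda>. f (x + l) = f x)"

lemma periodicD: "periodic \<Lambda> f \<Longrightarrow> l \<in> \<Lambda> \<Longrightarrow> f (x + l) = f x"
  by (simp add: periodic_def)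

lemma periodic_compose: "periodic \<Lambda> f \<Longrightarrow> periodic \<Lambda> (\<lambda>x. g (f x))"
  by (simp add: periodic_def)

lemma periodic_compose2: "periodic \<Lambda> f \<Longrightarrow> periodic \<Lambda> g \<Longrightarrow> periodic \<Lambda> (\<lambda>x. h (f x) (g x))"
  by (simp add: periodic_def)

lemma periodic_shift: "periodic \<Lambda> f \<Longrightarrow> periodic \<Lambda> (\<lambda>x. f (x + y))"
  unfolding periodic_def
proof (intro allI ballI)
  fix x l assume f: "\<forall>x. \<forall>l\<in>\<Lambda>. f (x + l) = f x" and l: "l \<in> \<Lambda>"
  have "x + l + y = (x + y) + l" by (simp add: add_ac)
  then show "f (x + l + y) = f (x + y)" using f l by (simp only:)
qed

lemma measurable_shift:
  fixes f :: "'a::{topological_ab_group_add, second_countable_topology} \<Rightarrow> 'b"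
  assumes "f \<in> borel \<rightarrow>\<^sub>M N"
  shows "(\<lambda>x. f (x + y)) \<in> borel \<rightarrow>\<^sub>M N"
  by (rule measurable_compose[OF _ assms]) measurable

text \<open>A model of Haar measure on the compact quotient by \<open>\<Lambda>\<close>: functions on the quotient
  are \<open>\<Lambda>\<close>-periodic functions, and only those are integrated.\<close>

locale periodic_haar =
  fixes \<nu> :: "'a::{topological_ab_group_add, second_countable_topology, t2_space} measure"
    and \<Lambda> :: "'a set"
  assumes sets_eq: "sets \<nu> = sets borel"
    and total: "emeasure \<nu> UNIV = 1"
    and zero_mem: "0 \<in> \<Lambda>"
    and add_mem: "x \<in> \<Lambda> \<Longrightarrow> y \<in> \<Lambda> \<Longrightarrow> x + y \<in> \<Lambda>"
    and minus_mem: "x \<in> \<Lambda> \<Longrightarrow> - x \<in> \<Lambda>"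
    and nn_invariant: "f \<in> borel_measurable borel \<Longrightarrow> periodic \<Lambda> f \<Longrightarrow>
          (\<integral>\<^sup>+x. f (x + y) \<partial>\<nu>) = (\<integral>\<^sup>+x. f x \<partial>\<nu>)"
    and shift_continuous: "A \<in> sets borel \<Longrightarrow> periodic \<Lambda> (\<lambda>x. x \<in> A) \<Longrightarrow>
          ((\<lambda>y. measure \<nu> {x \<in> A. x + y \<notin> A}) \<longlongrightarrow> 0) (nhds 0)"
begin

lemma space_eq: "space \<nu> = UNIV"
  using sets_eq_imp_space_eq[OF sets_eq] by simp

lemma measurable_eq: "measurable \<nu> N = measurable borel N"
  by (rule measurable_cong_sets[OF sets_eq refl])

sublocale finite_measure \<nu>
  by (rule finite_measureI) (simp add: space_eq total)

lemma measure_UNIV: "measure \<nu> UNIV = 1"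
  using total by (simp add: measure_def)

lemma borel_pair:
  "(\<lambda>p. f (fst p + snd p)) \<in> borel_measurable (\<nu> \<Otimes>\<^sub>M \<nu>)" if "f \<in> borel_measurable borel" for f :: "'a \<Rightarrow> 'c::topological_space"
proof -
  have [measurable]: "fst \<in> \<nu> \<Otimes>\<^sub>M \<nu> \<rightarrow>\<^sub>M (borel :: 'a measure)" "snd \<in> \<nu> \<Otimes>\<^sub>M \<nu> \<rightarrow>\<^sub>M (borel :: 'a measure)"
    using measurable_fst[of \<nu> \<nu>] measurable_snd[of \<nu> \<nu>] measurable_cong_sets[OF refl sets_eq] by blast+
  show ?thesis by (rule measurable_compose[OF _ that]) measurable
qed

section \<open>Invariant integration of periodic functions\<close>

lemma integrable_shift:
  fixes f :: "'a \<Rightarrow> 'b::{banach, second_countable_topology}"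
  assumes "integrable \<nu> f" "periodic \<Lambda> f"
  shows "integrable \<nu> (\<lambda>x. f (x + y))"
proof (rule integrableI_bounded)
  have f: "f \<in> borel_measurable borel" using assms(1) by (auto simp: measurable_eq dest: borel_measurable_integrable)
  show "(\<lambda>x. f (x + y)) \<in> borel_measurable \<nu>"
    unfolding measurable_eq by (rule measurable_shift[OF f])
  have "(\<integral>\<^sup>+x. ennreal (norm (f (x + y))) \<partial>\<nu>) = (\<integral>\<^sup>+x. ennreal (norm (f x)) \<partial>\<nu>)"
    by (rule nn_invariant[of "\<lambda>x. ennreal (norm (f x))"])
      (use f in measurable, rule periodic_compose[OF assms(2)])
  also have "\<dots> < \<infinity>" using assms(1) by (simp add: integrable_iff_bounded)
  finally show "(\<integral>\<^sup>+x. ennreal (norm (f (x + y))) \<partial>\<nu>) < \<infinity>" .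
qed

text \<open>Invariance is known for periodic integrands only, so no change of variables through an
  image measure applies; the positive and negative parts are treated separately.\<close>

lemma integral_shift_real:
  fixes f :: "'a \<Rightarrow> real"
  assumes "integrable \<nu> f" "periodic \<Lambda> f"
  shows "(LINT x|\<nu>. f (x + y)) = (LINT x|\<nu>. f x)"
proof -
  have f: "f \<in> borel_measurable borel" using assms(1) by (auto simp: measurable_eq dest: borel_measurable_integrable)
  have "(\<integral>\<^sup>+x. ennreal (f (x + y)) \<partial>\<nu>) = (\<integral>\<^sup>+x. ennreal (f x) \<partial>\<nu>)"
    by (rule nn_invariant[of "\<lambda>x. ennreal (f x)"])
      (use f in measurable, rule periodic_compose[OF assms(2)])
  moreover have "(\<integral>\<^sup>+x. ennreal (- f (x + y)) \<partial>\<nu>) = (\<integral>\<^sup>+x. ennreal (- f x) \<partial>\<nu>)"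
    by (rule nn_invariant[of "\<lambda>x. ennreal (- f x)"])
      (use f in measurable, rule periodic_compose[OF assms(2)])
  ultimately show ?thesis
    by (simp add: real_lebesgue_integral_def assms integrable_shift)
qed

lemma integral_shift:
  fixes f :: "'a \<Rightarrow> complex"
  assumes "integrable \<nu> f" "periodic \<Lambda> f"
  shows "(LINT x|\<nu>. f (x + y)) = (LINT x|\<nu>. f x)"
proof (rule complex_eqI)
  show "Re (LINT x|\<nu>. f (x + y)) = Re (LINT x|\<nu>. f x)"
    using integral_shift_real[OF integrable_Re[OF assms(1)] periodic_compose[OF assms(2)]]
    by (simp add: assms integrable_shift flip: integral_Re)
  show "Im (LINT x|\<nu>. f (x + y)) = Im (LINT x|\<nu>. f x)"
    using integral_shift_real[OF integrable_Im[OF assms(1)] periodic_compose[OF assms(2)]]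
    by (simp add: assms integrable_shift flip: integral_Im)
qed

text \<open>The model of \<open>L^2(G/\<Lambda>)\<close>.\<close>

definition P2 :: "('a \<Rightarrow> complex) set" where
  "P2 = {f \<in> L2 \<nu>. periodic \<Lambda> f}"

abbreviation shift :: "'a \<Rightarrow> ('a \<Rightarrow> complex) \<Rightarrow> 'a \<Rightarrow> complex" where
  "shift y f \<equiv> \<lambda>x. f (x + y)"

lemma P2_L2: "f \<in> P2 \<Longrightarrow> f \<in> L2 \<nu>"
  by (simp add: P2_def)

lemma P2_borel: "f \<in> P2 \<Longrightarrow> f \<in> borel_measurable borel"
  by (simp add: P2_def L2_iff measurable_eq)

lemma P2_periodic: "f \<in> P2 \<Longrightarrow> periodic \<Lambda> f"
  by (simp add: P2_def)

lemma P2_shift: "f \<in> P2 \<Longrightarrow> shift y f \<in> P2"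
  unfolding P2_def L2_iff mem_Collect_eq measurable_eq
  by (intro conjI measurable_shift periodic_shift
      integrable_shift[of "\<lambda>x. (cmod (f x))\<^sup>2"] periodic_compose[of \<Lambda> f "\<lambda>z. (cmod z)\<^sup>2"]) auto

lemma P2_scale: "f \<in> P2 \<Longrightarrow> (\<lambda>x. c * f x) \<in> P2"
  by (simp add: P2_def L2_scale periodic_compose)

lemma P2_add: "f \<in> P2 \<Longrightarrow> g \<in> P2 \<Longrightarrow> (\<lambda>x. f x + g x) \<in> P2"
  by (simp add: P2_def L2_add periodic_compose2)

lemma P2_diff: "f \<in> P2 \<Longrightarrow> g \<in> P2 \<Longrightarrow> (\<lambda>x. f x - g x) \<in> P2"
  by (simp add: P2_def L2_diff periodic_compose2)

lemma bounded_P2: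
  assumes "f \<in> borel_measurable borel" "periodic \<Lambda> f" "\<And>x. cmod (f x) \<le> B"
  shows "f \<in> P2"
proof -
  have "integrable \<nu> (\<lambda>x. (cmod (f x))\<^sup>2)"
    using assms(1,3) by (intro integrable_const_bound[where B="B\<^sup>2"]) (auto simp: measurable_eq intro!: power_mono)
  then show ?thesis using assms by (simp add: P2_def L2_iff measurable_eq)
qed

section \<open>Translations as unitary operators and their strong continuity\<close>

lemma inner_shift:
  assumes "f \<in> P2" "g \<in> P2"
  shows "l2_inner \<nu> (shift y f) (shift y g) = l2_inner \<nu> f g"
  unfolding l2_inner_def
  by (rule integral_shift[of "\<lambda>x. f x * cnj (g x)"])
    (use assms in \<open>auto simp: P2_def intro: L2_mult_integrable periodic_compose2\<close>)

lemma norm_shift: "f \<in> P2 \<Longrightarrow> l2_norm \<nu> (shift y f) = l2_norm \<nu> f"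
  using inner_shift[of f f y] l2_norm_nonneg[of \<nu> "shift y f"] l2_norm_nonneg[of \<nu> f]
  by (simp add: l2_inner_self del: of_real_power)

text \<open>The squared norm is the measure of a symmetric difference. The points outside
  \<open>A\<close> that \<open>y\<close> moves into \<open>A\<close> form a translate of the points
  of \<open>A\<close> that \<open>- y\<close> moves out, so \<open>shift_continuous\<close> controls
  both halves.\<close>

lemma shift_continuous_indicator:
  assumes A: "A \<in> sets borel" "periodic \<Lambda> (\<lambda>x. x \<in> A)"
  shows "((\<lambda>y. l2_norm \<nu> (\<lambda>x. indicator A (x + y) - indicator A x)) \<longlongrightarrow> 0) (nhds 0)"
proof -
  define m where "m y = measure \<nu> {x \<in> A. x + y \<notin> A}" for y
  have m: "(m \<longlongrightarrow> 0) (nhds 0)" unfolding m_def by (rule shift_continuous[OF A])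
  have A': "{x. x + y \<in> A} \<in> sets borel" for y
  proof -
    have "(\<lambda>x. x + y) -` A \<inter> space borel \<in> sets borel"
      by (rule measurable_sets[OF _ A(1)]) measurable
    then show ?thesis by (simp add: vimage_def)
  qed
  have eq: "(l2_norm \<nu> (\<lambda>x. indicator A (x + y) - indicator A x))\<^sup>2 = m y + m (- y)" for y
  proof -
    let ?B = "{x \<in> A. x + y \<notin> A}" and ?C = "{x \<in> A. x - y \<notin> A}"
    have B: "?B \<in> sets borel" and C: "?C \<in> sets borel"
      using sets.Diff[OF A(1) A'[of y]] sets.Diff[OF A(1) A'[of "- y"]] by (simp_all add: set_diff_eq)
    have pC: "periodic \<Lambda> (indicator ?C :: 'a \<Rightarrow> real)"
      using A(2) periodic_shift[OF A(2), of "- y"] by (simp add: periodic_def indicator_def)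
    have "(cmod (indicator A (x + y) - indicator A x))\<^sup>2 = indicator ?B x + (indicator ?C (x + y) :: real)" for x
      by (auto simp: indicator_def)
    then have "(l2_norm \<nu> (\<lambda>x. indicator A (x + y) - indicator A x))\<^sup>2
        = (LINT x|\<nu>. indicator ?B x + indicator ?C (x + y))"
      by (simp add: l2_norm_power2)
    also have "\<dots> = (LINT x|\<nu>. indicator ?B x) + (LINT x|\<nu>. indicator ?C (x + y))"
      using B C pC by (intro Bochner_Integration.integral_add integrable_shift)
        (auto simp: sets_eq intro!: integrable_real_indicator simp: emeasure_finite less_top[symmetric])
    also have "(LINT x|\<nu>. indicator ?C (x + y)) = (LINT x|\<nu>. indicator ?C x :: real)"
      using C pC by (intro integral_shift_real)
        (auto simp: sets_eq intro!: integrable_real_indicator simp: emeasure_finite less_top[symmetric])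
    finally show ?thesis
      using B C by (simp add: m_def sets_eq space_eq)
  qed
  have "((\<lambda>y. m y + m (- y)) \<longlongrightarrow> 0 + 0) (nhds 0)"
  proof (intro tendsto_add m)
    have "filterlim (\<lambda>y::'a. - y) (nhds (- 0)) (nhds 0)"
      by (intro tendsto_minus filterlim_ident)
    then show "((\<lambda>y. m (- y)) \<longlongrightarrow> 0) (nhds 0)"
      using filterlim_compose[OF m] by simp
  qed
  then have "((\<lambda>y. sqrt ((l2_norm \<nu> (\<lambda>x. indicator A (x + y) - indicator A x))\<^sup>2)) \<longlongrightarrow> sqrt 0) (nhds 0)"
    unfolding eq by (intro tendsto_real_sqrt) simp
  then show ?thesis by (simp add: l2_norm_nonneg)
qed

text \<open>Level sets of a periodic function are periodic, which reduces the claim to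
  indicators.\<close>

lemma shift_continuous_simple:
  assumes f: "f \<in> borel_measurable borel" "periodic \<Lambda> f" and fin: "finite (range f)"
  shows "((\<lambda>y. l2_norm \<nu> (\<lambda>x. f (x + y) - f x)) \<longlongrightarrow> 0) (nhds 0)"
proof -
  define A where "A v = {x. f x = v}" for v
  have A: "A v \<in> sets borel" "periodic \<Lambda> (\<lambda>x. x \<in> A v)" for v
    using measurable_sets[OF f(1), of "{v}"] f(2) by (auto simp: A_def vimage_def periodic_def)
  have AP: "(indicator (A v) :: 'a \<Rightarrow> complex) \<in> P2" for v
    by (rule bounded_P2[where B=1]) (use A[of v] in \<open>auto simp: indicator_def periodic_def\<close>)
  have fA: "f x = (\<Sum>v\<in>range f. v * indicator (A v) x)" for x
    using fin by (simp add: A_def indicator_def if_distrib sum.delta cong: if_cong)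
  have le: "l2_norm \<nu> (\<lambda>x. f (x + y) - f x)
      \<le> (\<Sum>v\<in>range f. cmod v * l2_norm \<nu> (\<lambda>x. indicator (A v) (x + y) - indicator (A v) x))" for y
  proof -
    have "f (x + y) - f x = (\<Sum>v\<in>range f. v * (indicator (A v) (x + y) - indicator (A v) x))" for x
      unfolding fA[of x] fA[of "x + y"] right_diff_distrib sum_subtractf ..
    then have "l2_norm \<nu> (\<lambda>x. f (x + y) - f x) = l2_norm \<nu> (\<lambda>x. \<Sum>v\<in>range f. v * (indicator (A v) (x + y) - indicator (A v) x))"
      by simp
    also have "\<dots> \<le> (\<Sum>v\<in>range f. l2_norm \<nu> (\<lambda>x. v * (indicator (A v) (x + y) - indicator (A v) x)))"
      by (intro l2_norm_triangle_sum P2_L2 P2_scale P2_diff P2_shift AP)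
    finally show ?thesis by (simp only: l2_norm_scale)
  qed
  show ?thesis
  proof (rule tendsto_sandwich[OF always_eventually always_eventually tendsto_const])
    have "((\<lambda>y. \<Sum>v\<in>range f. cmod v * l2_norm \<nu> (\<lambda>x. indicator (A v) (x + y) - indicator (A v) x))
        \<longlongrightarrow> (\<Sum>v\<in>range f. cmod v * 0)) (nhds 0)"
      by (intro tendsto_sum tendsto_mult tendsto_const shift_continuous_indicator A)
    then show "((\<lambda>y. \<Sum>v\<in>range f. cmod v * l2_norm \<nu> (\<lambda>x. indicator (A v) (x + y) - indicator (A v) x))
        \<longlongrightarrow> 0) (nhds 0)" by simp
  qed (use le in \<open>auto simp: l2_norm_nonneg\<close>)
qed

lemma shift_continuous_L2:
  assumes f: "f \<in> P2"
  shows "((\<lambda>y. l2_norm \<nu> (\<lambda>x. f (x + y) - f x)) \<longlongrightarrow> 0) (nhds 0)"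
proof (rule tendstoI)
  fix \<epsilon> :: real assume "\<epsilon> > 0"
  text \<open>Approximating the identity of \<open>\<complex>\<close> by simple functions keeps the approximants of \<open>f\<close> periodic.\<close>
  obtain s :: "nat \<Rightarrow> complex \<Rightarrow> complex" where
    s: "\<And>i. simple_function borel (s i)" and
    s_lim: "\<And>z. (\<lambda>i. s i z) \<longlonglongrightarrow> z" and s_bound: "\<And>i z. cmod (s i z) \<le> 2 * cmod z"
    using borel_measurable_implies_sequence_metric[of "\<lambda>z::complex. z" borel 0] by auto
  have sm: "s i \<in> borel_measurable borel" for i
    using s by (rule borel_measurable_simple_function)
  have "(\<lambda>i. LINT x|\<nu>. (cmod (f x - s i (f x)))\<^sup>2) \<longlonglongrightarrow> (LINT x|\<nu>. 0)"
  \<comment> \<open>The 9 is (1 + 2)^2, by the bound \<open>s_bound\<close> on the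
    approximants.\<close>
  proof (rule integral_dominated_convergence[where w="\<lambda>x. 9 * (cmod (f x))\<^sup>2"])
    show "integrable \<nu> (\<lambda>x. 9 * (cmod (f x))\<^sup>2)"
      using L2_square_integrable[OF P2_L2[OF f]] by simp
    show "(\<lambda>x. (cmod (f x - s i (f x)))\<^sup>2) \<in> borel_measurable \<nu>" for i
      using measurable_compose[OF P2_borel[OF f] sm[of i]] P2_borel[OF f] unfolding measurable_eq by measurable
    show "AE x in \<nu>. (\<lambda>i. (cmod (f x - s i (f x)))\<^sup>2) \<longlonglongrightarrow> 0"
    proof (rule AE_I2)
      fix x
      have "(\<lambda>i. (cmod (f x - s i (f x)))\<^sup>2) \<longlonglongrightarrow> (cmod (f x - f x))\<^sup>2"
        by (intro tendsto_intros s_lim)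
      then show "(\<lambda>i. (cmod (f x - s i (f x)))\<^sup>2) \<longlonglongrightarrow> 0" by simp
    qed
    show "AE x in \<nu>. norm ((cmod (f x - s i (f x)))\<^sup>2) \<le> 9 * (cmod (f x))\<^sup>2" for i
    proof (rule AE_I2)
      fix x
      have "cmod (f x - s i (f x)) \<le> 3 * cmod (f x)"
        using norm_triangle_ineq4[of "f x" "s i (f x)"] s_bound[of i "f x"] by linarith
      then have "(cmod (f x - s i (f x)))\<^sup>2 \<le> (3 * cmod (f x))\<^sup>2" by (intro power_mono) auto
      then show "norm ((cmod (f x - s i (f x)))\<^sup>2) \<le> 9 * (cmod (f x))\<^sup>2" by (simp add: power_mult_distrib)
    qed
  qed simp
  then have "(\<lambda>i. l2_norm \<nu> (\<lambda>x. f x - s i (f x))) \<longlonglongrightarrow> 0"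
    unfolding l2_norm_def using tendsto_real_sqrt by fastforce
  then obtain i where i: "l2_norm \<nu> (\<lambda>x. f x - s i (f x)) < \<epsilon> / 3"
    using order_tendstoD(2)[of _ 0 sequentially "\<epsilon> / 3"] \<open>\<epsilon> > 0\<close> by (auto simp: eventually_sequentially)
  define g where "g x = s i (f x)" for x
  have g_borel: "g \<in> borel_measurable borel" unfolding g_def by (rule measurable_compose[OF P2_borel[OF f] sm])
  have g_per: "periodic \<Lambda> g" unfolding g_def by (rule periodic_compose[OF P2_periodic[OF f]])
  have g_fin: "finite (range g)"
    using simple_functionD(1)[OF s[of i]] by (rule finite_subset[rotated]) (auto simp: g_def)
  have gP: "g \<in> P2"
    by (rule bounded_P2[OF g_borel g_per, where B="Max (cmod ` range g)"]) (use g_fin in auto)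
  have "\<forall>\<^sub>F y in nhds 0. l2_norm \<nu> (\<lambda>x. g (x + y) - g x) < \<epsilon> / 3"
    by (rule order_tendstoD(2)[OF shift_continuous_simple[OF g_borel g_per g_fin]]) (use \<open>\<epsilon> > 0\<close> in simp)
  then show "\<forall>\<^sub>F y in nhds 0. dist (l2_norm \<nu> (\<lambda>x. f (x + y) - f x)) 0 < \<epsilon>"
  proof eventually_elim
    case (elim y)
    let ?h = "\<lambda>x. f x - g x"
    have h: "?h \<in> P2" by (rule P2_diff[OF f gP])
    have "l2_norm \<nu> (\<lambda>x. f (x + y) - f x)
        = l2_norm \<nu> (\<lambda>x. (?h (x + y) - ?h x) + (g (x + y) - g x))" by simp
    also have "\<dots> \<le> l2_norm \<nu> (\<lambda>x. ?h (x + y) - ?h x) + l2_norm \<nu> (\<lambda>x. g (x + y) - g x)"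
      by (intro l2_norm_triangle P2_L2 P2_diff P2_shift gP f)
    also have "l2_norm \<nu> (\<lambda>x. ?h (x + y) - ?h x) \<le> l2_norm \<nu> (shift y ?h) + l2_norm \<nu> ?h"
      by (intro l2_norm_triangle_diff P2_L2 P2_shift h)
    also have "l2_norm \<nu> (shift y ?h) = l2_norm \<nu> ?h" by (rule norm_shift[OF h])
    finally show ?case using elim i by (simp add: l2_norm_nonneg g_def)
  qed
qed

section \<open>Characters: automatic continuity and correction of almost characters\<close>

lemma annihilatorD:
  assumes "\<kappa> \<in> annihilator \<Lambda>"
  shows "continuous_on UNIV \<kappa>" "cmod (\<kappa> x) = 1" "\<kappa> (x + y) = \<kappa> x * \<kappa> y" "l \<in> \<Lambda> \<Longrightarrow> \<kappa> l = 1"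
    "periodic \<Lambda> \<kappa>" "\<kappa> \<in> borel_measurable borel" "\<kappa> \<in> P2"
proof -
  show 1: "continuous_on UNIV \<kappa>" "cmod (\<kappa> x) = 1" "\<kappa> (x + y) = \<kappa> x * \<kappa> y" "l \<in> \<Lambda> \<Longrightarrow> \<kappa> l = 1" for x
    using assms by (auto simp: annihilator_def dual_group_def)
  show 2: "periodic \<Lambda> \<kappa>" using assms by (auto simp: annihilator_def dual_group_def periodic_def)
  show 3: "\<kappa> \<in> borel_measurable borel" using 1(1) by (rule borel_measurable_continuous_onI)
  show "\<kappa> \<in> P2" by (rule bounded_P2[OF 3 2, of 1]) (simp add: 1)
qed

text \<open>Automatic continuity: multiplicativity makes the norm of
  \<open>shift y \<kappa> - \<kappa>\<close> equal to \<open>cmod (\<kappa> y - 1)\<close>, so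
  continuity of translations gives continuity at 0, and the homomorphism law carries it to every
  point.\<close>

lemma measurable_character:
  assumes borel: "\<kappa> \<in> borel_measurable borel" and norm: "\<And>x. cmod (\<kappa> x) = 1"
    and add: "\<And>x y. \<kappa> (x + y) = \<kappa> x * \<kappa> y" and per: "periodic \<Lambda> \<kappa>"
  shows "\<kappa> \<in> annihilator \<Lambda>"
proof -
  have nz: "\<kappa> x \<noteq> 0" for x using norm[of x] by auto
  have P: "\<kappa> \<in> P2" by (rule bounded_P2[OF borel per, of 1]) (simp add: norm)
  have "l2_norm \<nu> (\<lambda>x. \<kappa> (x + y) - \<kappa> x) = cmod (\<kappa> y - 1)" for y
  proof -
    have "\<kappa> (x + y) - \<kappa> x = \<kappa> x * (\<kappa> y - 1)" for x by (simp add: add algebra_simps)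
    then show ?thesis by (simp add: l2_norm_def norm_mult norm measure_UNIV space_eq)
  qed
  then have "((\<lambda>y. cmod (\<kappa> y - 1)) \<longlongrightarrow> 0) (nhds 0)"
    using shift_continuous_L2[OF P] by simp
  then have at0: "(\<kappa> \<longlongrightarrow> 1) (nhds 0)"
    by (simp add: tendsto_norm_zero_iff LIM_zero_iff)
  have "isCont \<kappa> a" for a
  proof -
    have "((\<lambda>x. x - a) \<longlongrightarrow> a - a) (at a)" by (intro tendsto_intros)
    then have "((\<lambda>x. \<kappa> (x - a)) \<longlongrightarrow> 1) (at a)"
      using filterlim_compose[OF at0] by simp
    then have "((\<lambda>x. \<kappa> a * \<kappa> (x - a)) \<longlongrightarrow> \<kappa> a * 1) (at a)" by (intro tendsto_intros)
    then show ?thesis by (simp add: isCont_def add[symmetric])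
  qed
  then have "continuous_on UNIV \<kappa>" by (simp add: continuous_on_eq_continuous_at)
  moreover have "\<kappa> l = 1" if "l \<in> \<Lambda>" for l
    using add[of 0 l] periodicD[OF per that, of 0] nz[of 0] by simp
  ultimately show ?thesis by (auto simp: annihilator_def dual_group_def norm add)
qed

text \<open>The defect of an almost multiplicative \<open>v\<close> has a canonical logarithm \<open>\<theta>\<close>, which is
  an exact 2-cocycle because it is small; averaging a cocycle over the group exhibits it as a coboundary.\<close>

lemma character_near_almost_character:
  assumes v: "v \<in> borel_measurable borel" "periodic \<Lambda> v" "\<And>x. cmod (v x) = 1"
    and near: "\<And>x y. Re (v (x + y) * cnj (v x) * cnj (v y)) > 0"
  obtains \<kappa> where "\<kappa> \<in> annihilator \<Lambda>" "\<And>x. Re (v x * cnj (\<kappa> x)) > 0"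
proof -
  define w where "w x y = v (x + y) * cnj (v x) * cnj (v y)" for x y
  \<comment> \<open>As \<open>w x y\<close> has positive real part, this is its argument in the open
    interval from -pi/2 to pi/2.\<close>
  define \<theta> where "\<theta> x y = arctan (Im (w x y) / Re (w x y))" for x y
  define b where "b x = (LINT y|\<nu>. \<theta> x y)" for x
  have vv: "v x * cnj (v x) = 1" "cnj (v x) * v x = 1" for x
    using v(3)[of x] complex_norm_square[of "v x"] by (simp_all add: mult.commute)
  have cis: "cis (\<theta> x y) = w x y" for x y
  proof -
    let ?a = "Re (w x y)" and ?c = "Im (w x y)"
    have a: "?a > 0" using near by (simp add: w_def)
    have "cmod (w x y) = 1" by (simp add: w_def norm_mult v)
    then have n: "?a\<^sup>2 + ?c\<^sup>2 = 1" using cmod_power2[of "w x y"] by simp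
    have "1 + (?c / ?a)\<^sup>2 = (1 / ?a)\<^sup>2"
      using a n by (simp add: field_simps power_divide)
    then have s: "sqrt (1 + (?c / ?a)\<^sup>2) = 1 / ?a" using a by (simp add: real_sqrt_unique)
    show ?thesis
      using a by (intro complex_eqI) (simp_all add: \<theta>_def cos_arctan sin_arctan s)
  qed
  have \<theta>_bound: "- (pi / 2) < \<theta> x y" "\<theta> x y < pi / 2" for x y
    unfolding \<theta>_def by (rule arctan_lbound, rule arctan_ubound)
  have per_w: "periodic \<Lambda> (\<lambda>y. w x y)" "periodic \<Lambda> (\<lambda>x. w x y)" for x y
    using v(2) by (simp_all add: w_def periodic_def add.assoc[symmetric])
      (metis add.commute add.left_commute)
  have per_\<theta>: "periodic \<Lambda> (\<lambda>y. \<theta> x y)" "periodic \<Lambda> (\<lambda>x. \<theta> x y)" for x y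
    using per_w unfolding \<theta>_def periodic_def by simp_all
  have [measurable]: "v \<in> borel_measurable \<nu>" using v(1) by (simp add: measurable_eq)
  have meas_v2[measurable]: "(\<lambda>p. v (fst p + snd p)) \<in> borel_measurable (\<nu> \<Otimes>\<^sub>M \<nu>)"
    by (rule borel_pair[OF v(1)])
  have cnj_meas[measurable]: "cnj \<in> borel_measurable borel"
    by (intro borel_measurable_continuous_onI continuous_intros)
  have meas_w: "(\<lambda>p. w (fst p) (snd p)) \<in> borel_measurable (\<nu> \<Otimes>\<^sub>M \<nu>)"
    unfolding w_def by measurable
  have arctan_meas[measurable]: "(arctan :: real \<Rightarrow> real) \<in> borel_measurable borel"
    by (intro borel_measurable_continuous_onI continuous_intros)
  have meas_\<theta>: "case_prod \<theta> \<in> borel_measurable (\<nu> \<Otimes>\<^sub>M \<nu>)"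
    unfolding \<theta>_def case_prod_beta' using meas_w by measurable
  have int_\<theta>: "integrable \<nu> (\<theta> x)" for x
  proof (rule integrable_const_bound[where B="pi/2"])
    show "\<theta> x \<in> borel_measurable \<nu>"
      using measurable_compose[OF measurable_Pair1'[of x \<nu> \<nu>] meas_\<theta>] by (simp add: space_eq)
    show "AE y in \<nu>. norm (\<theta> x y) \<le> pi / 2"
    proof (rule AE_I2)
      show "norm (\<theta> x y) \<le> pi / 2" for y
        using \<theta>_bound[of x y] by (simp add: abs_le_iff)
    qed
  qed
  \<comment> \<open>Averaging over a probability measure preserves the strict bounds; they make
    \<open>cos (b x)\<close> positive at the end.\<close>
  have b_bound: "- (pi / 2) < b x" "b x < pi / 2" for x
  proof -
    have "(LINT y|\<nu>. \<theta> x y) < (LINT y|\<nu>. pi / 2)"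
      by (rule integral_less_AE_space[OF int_\<theta> _ AE_I2[OF \<theta>_bound(2)]]) (simp_all add: space_eq total)
    then show "b x < pi / 2" by (simp add: b_def measure_UNIV space_eq)
    have "(LINT y|\<nu>. - (pi / 2)) < (LINT y|\<nu>. \<theta> x y)"
      by (rule integral_less_AE_space[OF _ int_\<theta> AE_I2[OF \<theta>_bound(1)]]) (simp_all add: space_eq total)
    then show "- (pi / 2) < b x" by (simp add: b_def measure_UNIV space_eq)
  qed
  \<comment> \<open>The identity holds for the exponentials, so \<open>d\<close> is a multiple of 2
    pi. Four terms of modulus below pi/2 leave only 0.\<close>
  have cocycle: "\<theta> y z + \<theta> x (y + z) = \<theta> (x + y) z + \<theta> x y" for x y z
  proof -
    define d where "d = \<theta> y z + \<theta> x (y + z) - (\<theta> (x + y) z + \<theta> x y)"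
    have "w y z * w x (y + z) = v (x + y + z) * cnj (v x) * cnj (v y) * cnj (v z) * (v (y + z) * cnj (v (y + z)))"
      by (simp add: w_def add.assoc mult_ac)
    also have "\<dots> = v (x + y + z) * cnj (v x) * cnj (v y) * cnj (v z) * (v (x + y) * cnj (v (x + y)))"
      by (simp only: vv)
    also have "\<dots> = w (x + y) z * w x y"
      by (simp add: w_def mult_ac)
    finally have "cis (\<theta> y z + \<theta> x (y + z)) = cis (\<theta> (x + y) z + \<theta> x y)"
      by (simp add: cis cis_mult[symmetric])
    then have "cis d = 1" unfolding d_def cis_divide[symmetric] by simp
    then have "cos d = 1" by (simp add: complex_eq_iff)
    moreover have "\<bar>d\<bar> < 2 * pi" using \<theta>_bound[of y z] \<theta>_bound[of x "y + z"] \<theta>_bound[of "x + y" z] \<theta>_bound[of x y]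
      by (simp add: d_def abs_less_iff)
    ultimately have "d = 0" unfolding cos_one_2pi
    proof (elim disjE exE)
      fix n :: nat assume "d = real n * 2 * pi" "\<bar>d\<bar> < 2 * pi"
      then have "real n < 1" by (simp add: abs_mult)
      then show ?thesis using \<open>d = real n * 2 * pi\<close> by simp
    next
      fix n :: nat assume "d = - (real n * 2 * pi)" "\<bar>d\<bar> < 2 * pi"
      then have "real n < 1" by (simp add: abs_mult)
      then show ?thesis using \<open>d = - (real n * 2 * pi)\<close> by simp
    qed
    then show ?thesis by (simp add: d_def)
  qed
  \<comment> \<open>Integrate the cocycle identity over \<open>z\<close>; invariance absorbs the
    shift by \<open>y\<close>.\<close>
  have coboundary: "b y + b x = b (x + y) + \<theta> x y" for x y
  proof -
    have sh: "(\<lambda>z. \<theta> x (y + z)) = (\<lambda>z. \<theta> x (z + y))" by (simp add: add.commute)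
    have "b y + b x = (LINT z|\<nu>. \<theta> y z) + (LINT z|\<nu>. \<theta> x (y + z))"
      unfolding b_def sh integral_shift_real[OF int_\<theta> per_\<theta>(1)] ..
    also have "\<dots> = (LINT z|\<nu>. \<theta> y z + \<theta> x (y + z))"
      by (rule Bochner_Integration.integral_add[symmetric, OF int_\<theta>])
        (unfold sh, rule integrable_shift[OF int_\<theta> per_\<theta>(1)])
    also have "\<dots> = (LINT z|\<nu>. \<theta> (x + y) z + \<theta> x y)" by (simp only: cocycle)
    also have "\<dots> = b (x + y) + \<theta> x y"
      by (subst Bochner_Integration.integral_add[OF int_\<theta>]) (simp_all add: b_def measure_UNIV space_eq)
    finally show ?thesis .
  qed
  define \<kappa> where "\<kappa> x = v x * cis (b x)" for x
  have b_meas: "b \<in> borel_measurable borel"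
    using borel_measurable_lebesgue_integral[OF meas_\<theta>] by (simp add: b_def[abs_def] measurable_eq)
  have cis_meas: "cis \<in> borel_measurable borel"
    by (intro borel_measurable_continuous_onI continuous_intros)
  have "\<kappa> \<in> annihilator \<Lambda>"
  proof (rule measurable_character)
    show "\<kappa> \<in> borel_measurable borel"
      unfolding \<kappa>_def by (intro borel_measurable_times v measurable_compose[OF b_meas cis_meas])
    show "cmod (\<kappa> x) = 1" for x by (simp add: \<kappa>_def norm_mult v)
    show "periodic \<Lambda> \<kappa>" using v(2) per_\<theta>(2) by (simp add: \<kappa>_def b_def periodic_def)
    show "\<kappa> (x + y) = \<kappa> x * \<kappa> y" for x y
    proof -
      have "cis (b x) * cis (b y) = cis (b (x + y)) * cis (\<theta> x y)"
        unfolding cis_mult using coboundary[of y x] by (simp add: add.commute)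
      then have "\<kappa> x * \<kappa> y = v (x + y) * cis (b (x + y)) * ((v x * cnj (v x)) * (v y * cnj (v y)))"
        by (simp add: \<kappa>_def cis w_def mult_ac)
      then show ?thesis by (simp add: vv \<kappa>_def)
    qed
  qed
  moreover have "Re (v x * cnj (\<kappa> x)) > 0" for x
  proof -
    have "v x * cnj (\<kappa> x) = (v x * cnj (v x)) * cnj (cis (b x))" by (simp add: \<kappa>_def)
    then show ?thesis using b_bound[of x] by (simp add: vv cos_gt_zero_pi)
  qed
  ultimately show ?thesis by (rule that)
qed

text \<open>Translates of \<open>W\<close> cover the group, and countably many suffice by the
  Lindelof property. The saturation of \<open>W\<close> is used because its translates are known to
  have equal measure, being periodic.\<close>

lemma open_positive:
  assumes "open W" "0 \<in> W"
  shows "emeasure \<nu> {x. \<exists>l\<in>\<Lambda>. x + l \<in> W} \<noteq> 0"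
proof
  let ?U = "{x. \<exists>l\<in>\<Lambda>. x + l \<in> W}"
  assume null: "emeasure \<nu> ?U = 0"
  have open_sh: "open {x. x + y \<in> W}" for y
    using open_vimage[OF assms(1), of "\<lambda>x. x + y"]
    by (simp add: vimage_def continuous_intros)
  have "?U = (\<Union>l\<in>\<Lambda>. {x. x + l \<in> W})" by auto
  then have U: "?U \<in> sets borel" using open_sh by (auto intro!: borel_open open_UN)
  have perU: "periodic \<Lambda> (\<lambda>x. x \<in> ?U)"
    unfolding periodic_def mem_Collect_eq
  proof (intro allI ballI iffI)
    fix x l assume l: "l \<in> \<Lambda>"
    { assume "\<exists>m\<in>\<Lambda>. x + l + m \<in> W"
      then show "\<exists>m\<in>\<Lambda>. x + m \<in> W" using add_mem[OF l] by (metis add.assoc) }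
    { assume "\<exists>m\<in>\<Lambda>. x + m \<in> W"
      then obtain m where m: "m \<in> \<Lambda>" "x + m \<in> W" by blast
      have "x + l + (m - l) = x + m" by (simp add: algebra_simps)
      then show "\<exists>m\<in>\<Lambda>. x + l + m \<in> W" using m add_mem[OF m(1) minus_mem[OF l]] by (metis diff_conv_add_uminus) }
  qed
  have null_sh: "{x. x + y \<in> ?U} \<in> null_sets \<nu>" for y
  proof -
    have m: "{x. x + y \<in> ?U} \<in> sets borel"
      using measurable_sets[OF measurable_shift[OF measurable_ident], of ?U y] U by (simp add: vimage_def)
    have "emeasure \<nu> {x. x + y \<in> ?U} = (\<integral>\<^sup>+x. indicator ?U (x + y) \<partial>\<nu>)"
      using m by (subst nn_integral_indicator[symmetric]) (auto simp only: sets_eq indicator_def mem_Collect_eq intro!: nn_integral_cong)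
    also have "\<dots> = (\<integral>\<^sup>+x. indicator ?U x \<partial>\<nu>)"
      by (rule nn_invariant[of "indicator ?U"]) (use U perU in \<open>auto simp: periodic_def indicator_def\<close>)
    also have "\<dots> = 0" using U null by (simp add: sets_eq)
    finally show ?thesis using m by (auto simp: null_sets_def sets_eq)
  qed
  define \<F> where "\<F> = range (\<lambda>y. {x. x + y \<in> W})"
  have "\<And>S. S \<in> \<F> \<Longrightarrow> open S" using open_sh by (auto simp: \<F>_def)
  then obtain \<F>' where F': "\<F>' \<subseteq> \<F>" "countable \<F>'" "\<Union>\<F>' = \<Union>\<F>" by (rule Lindelof)
  have "\<Union>\<F> = UNIV"
  proof -
    have "x \<in> {z. z + (- x) \<in> W}" for x using assms(2) by simp
    then show ?thesis unfolding \<F>_def by blast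
  qed
  moreover have "\<Union>\<F>' \<in> null_sets \<nu>"
  proof (rule null_sets_UN'[where N="\<lambda>S. S" and I=\<F>', simplified, OF F'(2)])
    fix S assume "S \<in> \<F>'"
    then obtain y where S: "S = {x. x + y \<in> W}" using F'(1) by (auto simp: \<F>_def)
    have "S \<subseteq> {x. x + y \<in> ?U}" using zero_mem unfolding S by (auto intro: bexI[of _ 0])
    moreover have "S \<in> sets \<nu>" unfolding S sets_eq by (rule borel_open[OF open_sh])
    ultimately show "S \<in> null_sets \<nu>" using null_sets_subset[OF null_sh] by blast
  qed
  ultimately show False using F'(3) total by (auto simp: null_sets_def)
qed

section \<open>Autocorrelation and its energy\<close>

definition corr :: "('a \<Rightarrow> complex) \<Rightarrow> 'a \<Rightarrow> complex" where
  "corr f y = l2_inner \<nu> (shift y f) f"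

text \<open>If \<open>f\<close> is a finite sum of distinct characters with coefficients c_i, then
  \<open>corr f\<close> is the same sum with coefficients |c_i|^2: phases drop out, and the energy
  measures how concentrated \<open>f\<close> is on few characters.\<close>

definition energy :: "('a \<Rightarrow> complex) \<Rightarrow> real" where
  "energy f = (LINT y|\<nu>. (cmod (corr f y))\<^sup>2)"

lemma corr_bound: "f \<in> P2 \<Longrightarrow> cmod (corr f y) \<le> (l2_norm \<nu> f)\<^sup>2"
  using l2_Cauchy_Schwarz[OF P2_L2[OF P2_shift[of f y]] P2_L2[of f]]
  by (simp add: corr_def norm_shift power2_eq_square)

lemma corr_periodic: "f \<in> P2 \<Longrightarrow> periodic \<Lambda> (corr f)"
  using P2_periodic[of f] by (simp add: periodic_def corr_def add.assoc[symmetric])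

lemma cnj_borel: "cnj \<in> borel_measurable borel"
  by (intro borel_measurable_continuous_onI continuous_intros)

lemma borel_pair_fst: "f \<in> borel_measurable borel \<Longrightarrow> (\<lambda>p. f (fst p)) \<in> borel_measurable (\<nu> \<Otimes>\<^sub>M \<nu>)"
  by (rule measurable_compose[OF measurable_fst]) (simp add: measurable_eq)

lemma borel_pair_snd: "f \<in> borel_measurable borel \<Longrightarrow> (\<lambda>p. f (snd p)) \<in> borel_measurable (\<nu> \<Otimes>\<^sub>M \<nu>)"
  by (rule measurable_compose[OF measurable_snd]) (simp add: measurable_eq)

lemma corr_borel:
  assumes "f \<in> P2"
  shows "corr f \<in> borel_measurable borel"
proof -
  have "case_prod (\<lambda>y x. f (x + y) * cnj (f x)) \<in> borel_measurable (\<nu> \<Otimes>\<^sub>M \<nu>)"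
    using borel_pair[OF P2_borel[OF assms]]
      measurable_compose[OF borel_pair_snd[OF P2_borel[OF assms]] cnj_borel]
    unfolding case_prod_beta' by (subst add.commute) (rule borel_measurable_times)
  then show ?thesis
    using borel_measurable_lebesgue_integral[of "\<lambda>y x. f (x + y) * cnj (f x)" \<nu>]
    by (simp add: corr_def[abs_def] l2_inner_def measurable_eq)
qed

lemma corr_P2: "f \<in> P2 \<Longrightarrow> corr f \<in> P2"
  by (rule bounded_P2[OF corr_borel corr_periodic corr_bound])

lemma corr_square_integrable: "f \<in> P2 \<Longrightarrow> integrable \<nu> (\<lambda>y. (cmod (corr f y))\<^sup>2)"
  by (rule L2_square_integrable[OF P2_L2[OF corr_P2]])

lemma corr_scale: "corr (\<lambda>x. c * f x) y = of_real ((cmod c)\<^sup>2) * corr f y"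
  unfolding corr_def l2_inner_scale_left l2_inner_scale_right complex_norm_square
  by (simp add: mult_ac)

lemma energy_scale: "energy (\<lambda>x. c * f x) = cmod c ^ 4 * energy f"
  unfolding energy_def corr_scale norm_mult power_mult_distrib
  by (simp del: of_real_power)

lemma energy_le:
  assumes "f \<in> P2"
  shows "energy f \<le> l2_norm \<nu> f ^ 4"
proof -
  have "(cmod (corr f y))\<^sup>2 \<le> l2_norm \<nu> f ^ 4" for y
    using power_mono[OF corr_bound[OF assms, of y] norm_ge_zero, of 2] by simp
  then have "energy f \<le> (LINT y|\<nu>. l2_norm \<nu> f ^ 4)"
    unfolding energy_def by (intro integral_mono corr_square_integrable assms) auto
  then show ?thesis by (simp add: measure_UNIV space_eq)
qed

text \<open>Both diagonal terms equal \<open>corr f y\<close>, the second because translation by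
  \<open>a\<close> is unitary and \<open>cmod c = 1\<close>; the cross terms are values of
  \<open>corr f\<close> displaced by \<open>a\<close> and \<open>- a\<close>.\<close>

lemma corr_add_shift:
  assumes f: "f \<in> P2" and c: "cmod c = 1"
  shows "corr (\<lambda>x. f x + c * f (x + a)) y = 2 * corr f y + c * corr f (y + a) + cnj c * corr f (y - a)"
proof -
  have P: "shift y f \<in> L2 \<nu>" "(\<lambda>x. c * shift y f x) \<in> L2 \<nu>" for y
    by (intro P2_L2 P2_shift f) (rule P2_L2[OF P2_scale[OF P2_shift[OF f]]])
  have sh: "l2_inner \<nu> (\<lambda>x. f (x + y)) (\<lambda>x. f (x + a)) = corr f (y - a)" for y
  proof -
    have "(\<lambda>x. f (x + y)) = shift a (shift (y - a) f)" by (simp add: algebra_simps)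
    then show ?thesis
      using inner_shift[OF P2_shift[OF f, of "y - a"] f, of a] by (simp add: corr_def)
  qed
  have cc: "c * cnj c = 1" using c complex_norm_square[of c] by simp
  have "corr (\<lambda>x. f x + c * f (x + a)) y =
      l2_inner \<nu> (\<lambda>x. f (x + y) + c * f (x + (y + a))) (\<lambda>x. f x + c * f (x + a))"
    by (simp add: corr_def add.assoc)
  also have "\<dots> = corr f y + c * corr f (y + a)
      + (cnj c * corr f (y - a) + c * (cnj c * corr f (y + a - a)))"
    using P[of y] P[of "y + a"] P[of 0] P[of a] P2_L2[OF f]
    by (simp add: l2_inner_add_left l2_inner_add_right L2_add l2_inner_scale_left l2_inner_scale_right
        sh corr_def[symmetric, of f] distrib_left)
  also have "c * (cnj c * corr f (y + a - a)) = corr f y"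
    using cc by (simp add: mult.assoc[symmetric])
  finally show ?thesis by simp
qed

lemma norm_add_shift:
  assumes f: "f \<in> P2" and c: "cmod c = 1"
  shows "(l2_norm \<nu> (\<lambda>x. f x + c * f (x + a)))\<^sup>2 = 2 * (l2_norm \<nu> f)\<^sup>2 + 2 * Re (c * corr f a)"
proof -
  have "l2_inner \<nu> f (\<lambda>x. c * f (x + a)) = cnj (c * corr f a)"
    by (simp add: l2_inner_scale_right corr_def l2_inner_commute[of \<nu> f])
  then show ?thesis
    using l2_norm_power2_add[OF P2_L2[OF f] P2_L2[OF P2_scale[OF P2_shift[OF f, of a], of c]]] c
    by (simp add: l2_norm_scale norm_shift f)
qed

text \<open>For a trigonometric sum with coefficients \<open>c\<^sub>i\<close> the energy is \<open>\<Sum>\<bar>c\<^sub>i\<bar>\<^sup>4\<close>, which on the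
  unit sphere is largest at single characters; testing with the perturbations \<open>f + c * shift a f\<close>
  shows directly that near-maximizers are almost invariant, up to scalars, under every shift.\<close>

lemma energy_parallelogram:
  assumes f: "f \<in> P2"
  shows "(\<Sum>c\<in>{1, -1, \<i>, -\<i>}. energy (\<lambda>x. f x + c * f (x + a))) = 24 * energy f"
proof -
  let ?F = "\<lambda>c x. f x + c * f (x + a)"
  \<comment> \<open>Over the fourth roots of unity both c and c^2 sum to 0, which removes all cross
    terms. By invariance the three squares integrate to the same energy, whence 24 = 16 + 4 +
    4.\<close>
  have id: "(cmod (2*u + p + q))\<^sup>2 + ((cmod (2*u - p - q))\<^sup>2 + ((cmod (2*u + \<i>*p - \<i>*q))\<^sup>2 + (cmod (2*u - \<i>*p + \<i>*q))\<^sup>2))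
      = 16 * (cmod u)\<^sup>2 + 4 * (cmod p)\<^sup>2 + 4 * (cmod q)\<^sup>2" for u p q
    unfolding cmod_power2 by (simp add: power2_eq_square algebra_simps)
  have F: "?F c \<in> P2" for c by (intro P2_add P2_scale P2_shift f)
  have int: "integrable \<nu> (\<lambda>y. (cmod (corr (?F c) y))\<^sup>2)" for c
    by (rule corr_square_integrable[OF F])
  have ints: "integrable \<nu> (\<lambda>y. (cmod (corr f (y + b)))\<^sup>2)" "(LINT y|\<nu>. (cmod (corr f (y + b)))\<^sup>2) = energy f" for b
    unfolding energy_def
    by (rule integrable_shift[of "\<lambda>y. (cmod (corr f y))\<^sup>2"] integral_shift_real[of "\<lambda>y. (cmod (corr f y))\<^sup>2"],
        rule corr_square_integrable[OF f], rule periodic_compose[OF corr_periodic[OF f]])+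
  have pt: "(cmod (corr (?F 1) y))\<^sup>2 + ((cmod (corr (?F (-1)) y))\<^sup>2 + ((cmod (corr (?F \<i>) y))\<^sup>2 + (cmod (corr (?F (-\<i>)) y))\<^sup>2))
      = 16 * (cmod (corr f y))\<^sup>2 + 4 * (cmod (corr f (y + a)))\<^sup>2 + 4 * (cmod (corr f (y + - a)))\<^sup>2" for y
    using id[of "corr f y" "corr f (y + a)" "corr f (y - a)"]
    by (simp only: corr_add_shift[OF f] norm_one norm_minus_cancel norm_ii) simp
  have "energy (?F 1) + (energy (?F (-1)) + (energy (?F \<i>) + energy (?F (-\<i>)))) =
      (LINT y|\<nu>. (cmod (corr (?F 1) y))\<^sup>2 + ((cmod (corr (?F (-1)) y))\<^sup>2 + ((cmod (corr (?F \<i>) y))\<^sup>2 + (cmod (corr (?F (-\<i>)) y))\<^sup>2)))"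
    unfolding energy_def by (simp only: Bochner_Integration.integral_add Bochner_Integration.integrable_add int)
  also have "\<dots> = (LINT y|\<nu>. 16 * (cmod (corr f y))\<^sup>2 + 4 * (cmod (corr f (y + a)))\<^sup>2 + 4 * (cmod (corr f (y + - a)))\<^sup>2)"
    by (simp only: pt)
  also have "\<dots> = 24 * energy f"
    using ints[of 0] ints[of a] ints[of "- a"] by simp
  finally show ?thesis by (simp add: complex_eq_iff)
qed

text \<open>\<open>?g\<close> is the component of \<open>shift y f\<close> orthogonal to
  \<open>f\<close>, and the right-hand side is its squared norm. The defect is the inner product of
  \<open>shift x ?g\<close> with the unit vector \<open>f\<close>.\<close>

lemma corr_almost_multiplicative:
  assumes f: "f \<in> P2" "l2_norm \<nu> f = 1"
  shows "(cmod (corr f (x + y) - corr f x * corr f y))\<^sup>2 \<le> 1 - (cmod (corr f y))\<^sup>2"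
proof -
  let ?u = "corr f" and ?g = "\<lambda>z. f (z + y) - corr f y * f z"
  have g: "?g \<in> P2" by (intro P2_diff P2_scale P2_shift f)
  have L: "f \<in> L2 \<nu>" "shift y f \<in> L2 \<nu>" "shift x f \<in> L2 \<nu>" "shift (x + y) f \<in> L2 \<nu>" "(\<lambda>z. c * f (z + x)) \<in> L2 \<nu>" "(\<lambda>z. c * f z) \<in> L2 \<nu>" for c
    by (rule P2_L2[OF f(1)] P2_L2[OF P2_shift[OF f(1)]] P2_L2[OF P2_scale[OF P2_shift[OF f(1)]]] P2_L2[OF P2_scale[OF f(1)]])+
  have "l2_inner \<nu> (shift x ?g) f = l2_inner \<nu> (\<lambda>z. shift (x + y) f z - corr f y * f (z + x)) f"
    by (simp add: add.assoc)
  also have "\<dots> = ?u (x + y) - ?u y * ?u x"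
    using L by (simp add: l2_inner_diff_left l2_inner_scale_left corr_def)
  finally have "cmod (?u (x + y) - ?u y * ?u x) \<le> l2_norm \<nu> (shift x ?g) * l2_norm \<nu> f"
    using l2_Cauchy_Schwarz[OF P2_L2[OF P2_shift[OF g, of x]] L(1)] by simp
  then have le: "cmod (?u (x + y) - ?u x * ?u y) \<le> l2_norm \<nu> ?g"
    by (simp only: norm_shift[OF g] f(2) mult_1_right mult.commute)
  have "Re (l2_inner \<nu> (shift y f) (\<lambda>z. ?u y * f z)) = (cmod (?u y))\<^sup>2"
    unfolding l2_inner_scale_right corr_def[symmetric] cmod_power2
    by (simp add: power2_eq_square)
  then have "(l2_norm \<nu> ?g)\<^sup>2 = 1 - (cmod (?u y))\<^sup>2"
    using l2_norm_power2_diff[OF L(2) L(6)[of "?u y"]]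
    by (simp add: norm_shift[OF f(1)] l2_norm_scale f(2))
  with power_mono[OF le norm_ge_zero, of 2] show ?thesis by simp
qed

text \<open>At 0 the autocorrelation is the squared norm of \<open>f\<close>. Continuity of
  translations keeps it nonzero near 0, periodicity on the lattice translates of that neighbourhood,
  and these have positive measure.\<close>

lemma energy_positive:
  assumes f: "f \<in> P2" "l2_norm \<nu> f \<noteq> 0"
  shows "energy f > 0"
proof (rule ccontr)
  assume "\<not> energy f > 0"
  moreover have "energy f \<ge> 0" by (simp add: energy_def)
  ultimately have "energy f = 0" by simp
  then have ae: "AE y in \<nu>. corr f y = 0"
    unfolding energy_def using integral_nonneg_eq_0_iff_AE[OF corr_square_integrable[OF f(1)]] by simp
  define s where "s = (l2_norm \<nu> f)\<^sup>2"
  have s: "s > 0" using f(2) by (simp add: s_def)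
  have "((\<lambda>y. l2_norm \<nu> (\<lambda>x. f (x + y) - f x) * l2_norm \<nu> f) \<longlongrightarrow> 0 * l2_norm \<nu> f) (nhds 0)"
    by (intro tendsto_mult tendsto_const shift_continuous_L2 f)
  then have "\<forall>\<^sub>F y in nhds 0. l2_norm \<nu> (\<lambda>x. f (x + y) - f x) * l2_norm \<nu> f < s"
    by (rule order_tendstoD(2)) (use s in simp)
  then obtain W where W: "open W" "0 \<in> W" "\<And>y. y \<in> W \<Longrightarrow> l2_norm \<nu> (\<lambda>x. f (x + y) - f x) * l2_norm \<nu> f < s"
    by (auto simp: eventually_nhds)
  have nz: "corr f y \<noteq> 0" if "y \<in> W" for y
  proof
    assume 0: "corr f y = 0"
    have "l2_inner \<nu> (\<lambda>x. f (x + y) - f x) f = - of_real s"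
      using l2_inner_diff_left[OF P2_L2[OF P2_shift[OF f(1), of y]] P2_L2[OF f(1)] P2_L2[OF f(1)]] 0
      by (simp add: corr_def l2_inner_self s_def)
    then have "s \<le> l2_norm \<nu> (\<lambda>x. f (x + y) - f x) * l2_norm \<nu> f"
      using l2_Cauchy_Schwarz[OF P2_L2[OF P2_diff[OF P2_shift[OF f(1), of y] f(1)]] P2_L2[OF f(1)]] s
      by simp
    with W(3)[OF that] show False by simp
  qed
  have "corr f x \<noteq> 0" if "x + l \<in> W" "l \<in> \<Lambda>" for x l
    using nz[OF that(1)] periodicD[OF corr_periodic[OF f(1)] that(2)] by simp
  then have "AE y in \<nu>. y \<notin> {x. \<exists>l\<in>\<Lambda>. x + l \<in> W}"
    using ae by (auto elim!: eventually_mono)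
  then have "{x. \<exists>l\<in>\<Lambda>. x + l \<in> W} \<in> null_sets \<nu>"
    using emeasure_neq_0_sets[OF open_positive[OF W(1,2)]] by (simp only: AE_iff_null_sets)
  with open_positive[OF W(1,2)] show False by (simp add: null_setsD1)
qed

text \<open>By Fubini the integral is |<f, \<kappa>>|^2: the inner integral over \<open>y\<close> is
  \<open>\<kappa> x\<close> times the coefficient of \<open>f\<close>.\<close>

lemma corr_orthogonal:
  assumes f: "f \<in> P2" and \<kappa>: "\<kappa> \<in> annihilator \<Lambda>" and orth: "l2_inner \<nu> f \<kappa> = 0"
  shows "(LINT y|\<nu>. corr f y * cnj (\<kappa> y)) = 0"
proof -
  interpret pair_sigma_finite \<nu> \<nu> ..
  note \<kappa>D = annihilatorD[OF \<kappa>]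
  define h where "h x y = f (x + y) * cnj (f x) * cnj (\<kappa> y)" for x y
  \<comment> \<open>Constants are square integrable for a finite measure, so \<open>f\<close> itself
    is integrable, as Fubini requires.\<close>
  have one: "(\<lambda>x. 1) \<in> P2" by (rule bounded_P2[of _ 1]) (auto simp: periodic_def)
  have f1: "integrable \<nu> f" using L2_mult_integrable[OF P2_L2[OF f] P2_L2[OF one]] by simp
  have \<kappa>f: "integrable \<nu> (\<lambda>x. f x * cnj (\<kappa> x))" by (rule L2_mult_integrable[OF P2_L2[OF f] P2_L2[OF \<kappa>D(7)]])
  have per: "periodic \<Lambda> (\<lambda>x. cmod (f x))" "periodic \<Lambda> (\<lambda>x. f x * cnj (\<kappa> x))"
    using P2_periodic[OF f] \<kappa>D(5) by (auto simp: periodic_def)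
  have inner: "(LINT y|\<nu>. f (x + y) * cnj (\<kappa> y)) = 0" and inner_int: "integrable \<nu> (\<lambda>y. f (x + y) * cnj (\<kappa> y))" for x
  proof -
    have "\<kappa> x * cnj (\<kappa> x) = 1" using \<kappa>D(2)[of x] complex_norm_square[of "\<kappa> x"] by simp
    then have eq: "f (x + y) * cnj (\<kappa> y) = \<kappa> x * (f (y + x) * cnj (\<kappa> (y + x)))" for y
      by (simp add: \<kappa>D(3) add.commute mult_ac)
    show "integrable \<nu> (\<lambda>y. f (x + y) * cnj (\<kappa> y))"
      unfolding eq by (intro Bochner_Integration.integrable_mult_right integrable_shift[OF \<kappa>f per(2)])
    have "(LINT y|\<nu>. f (x + y) * cnj (\<kappa> y)) = \<kappa> x * (LINT y|\<nu>. f (y + x) * cnj (\<kappa> (y + x)))"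
      unfolding eq by (rule integral_mult_right_zero)
    also have "\<dots> = 0"
      using integral_shift[OF \<kappa>f per(2), of x] orth by (simp add: l2_inner_def)
    finally show "(LINT y|\<nu>. f (x + y) * cnj (\<kappa> y)) = 0" .
  qed
  have h_eq: "h x y = cnj (f x) * (f (x + y) * cnj (\<kappa> y))" for x y by (simp add: h_def mult_ac)
  have "integrable (\<nu> \<Otimes>\<^sub>M \<nu>) (case_prod h)"
  proof (rule Fubini_integrable)
    show "case_prod h \<in> borel_measurable (\<nu> \<Otimes>\<^sub>M \<nu>)"
      unfolding h_def case_prod_beta'
      by (intro borel_measurable_times borel_pair[OF P2_borel[OF f]]
          measurable_compose[OF borel_pair_fst[OF P2_borel[OF f]] cnj_borel]
          measurable_compose[OF borel_pair_snd[OF \<kappa>D(6)] cnj_borel])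
    have "(LINT y|\<nu>. norm (h x y)) = cmod (f x) * (LINT y|\<nu>. cmod (f y))" for x
      using integral_shift_real[OF integrable_norm[OF f1] per(1), of x]
      by (simp add: h_def norm_mult \<kappa>D(2) mult.commute add.commute)
    then show "integrable \<nu> (\<lambda>x. LINT y|\<nu>. norm (case (x, y) of (x, y) \<Rightarrow> h x y))"
      using f1 by simp
    show "AE x in \<nu>. integrable \<nu> (\<lambda>y. case (x, y) of (x, y) \<Rightarrow> h x y)"
      by (intro AE_I2) (simp add: h_eq inner_int)
  qed
  then have "(LINT y|\<nu>. LINT x|\<nu>. h x y) = (LINT x|\<nu>. LINT y|\<nu>. h x y)"
    by (rule Fubini_integral)
  also have "\<dots> = 0" by (simp add: h_eq inner)
  also have "(LINT y|\<nu>. LINT x|\<nu>. h x y) = (LINT y|\<nu>. corr f y * cnj (\<kappa> y))"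
    by (simp add: h_def corr_def l2_inner_def)
  finally show ?thesis .
qed

text \<open>Among the characters, one is found whose product with the autocorrelation of a
  near-maximizer \<open>g\<close> in \<open>V\<close> has a nonzero integral;
  \<open>corr_orthogonal\<close> forbids this for \<open>g\<close> in \<open>V\<close>.\<close>

theorem characters_total:
  assumes f: "f \<in> P2" and orth: "\<And>\<kappa>. \<kappa> \<in> annihilator \<Lambda> \<Longrightarrow> l2_inner \<nu> f \<kappa> = 0"
  shows "l2_norm \<nu> f = 0"
proof (rule ccontr)
  assume f_nz: "l2_norm \<nu> f \<noteq> 0"
  define V where "V = {g \<in> P2. \<forall>\<kappa>\<in>annihilator \<Lambda>. l2_inner \<nu> g \<kappa> = 0}"
  have VP: "g \<in> P2" if "g \<in> V" for g using that by (simp add: V_def)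
  have V_scale: "(\<lambda>x. c * g x) \<in> V" if "g \<in> V" for g c
    using that by (simp add: V_def P2_scale l2_inner_scale_left)
  have V_add_shift: "(\<lambda>x. g x + c * g (x + a)) \<in> V" if g: "g \<in> V" for g c a
  proof -
    have "l2_inner \<nu> (shift a g) \<kappa> = 0" if \<kappa>: "\<kappa> \<in> annihilator \<Lambda>" for \<kappa>
    proof -
      note \<kappa>D = annihilatorD[OF \<kappa>]
      have "shift a \<kappa> = (\<lambda>x. \<kappa> a * \<kappa> x)" by (simp add: \<kappa>D(3) mult.commute)
      then have "cnj (\<kappa> a) * l2_inner \<nu> (shift a g) \<kappa> = l2_inner \<nu> (shift a g) (shift a \<kappa>)"
        by (simp add: l2_inner_scale_right)
      also have "\<dots> = 0" using inner_shift[OF VP[OF g] \<kappa>D(7)] g \<kappa> by (simp add: V_def)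
      finally show ?thesis using \<kappa>D(2)[of a] by auto
    qed
    then show ?thesis
      using g P2_shift[of g a] P2_scale[of "shift a g" c]
      by (auto simp: V_def P2_add l2_inner_add_left l2_inner_scale_left P2_L2 annihilatorD(7))
  qed
  define S where "S = energy ` {g \<in> V. l2_norm \<nu> g = 1}"
  define m where "m = Sup S"
  have bdd: "bdd_above S"
    unfolding S_def by (rule bdd_aboveI2[where M=1]) (use energy_le VP in force)
  \<comment> \<open>Energy is homogeneous of degree 4, so the bound on the unit sphere extends to
    all of \<open>V\<close>; norm zero is separate because it cannot be normalized.\<close>
  have normalize: "energy g \<le> m * l2_norm \<nu> g ^ 4" if g: "g \<in> V" for g
  proof (cases "l2_norm \<nu> g = 0")
    case True
    then show ?thesis using energy_le[OF VP[OF g]] by simp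
  next
    case False
    let ?c = "of_real (1 / l2_norm \<nu> g) :: complex"
    have "l2_norm \<nu> (\<lambda>x. ?c * g x) = 1"
      unfolding l2_norm_scale norm_of_real using False by (simp add: l2_norm_nonneg)
    then have "energy (\<lambda>x. ?c * g x) \<le> m"
      unfolding m_def using V_scale[OF g] by (intro cSup_upper bdd) (auto simp only: S_def)
    then show ?thesis
      unfolding energy_scale norm_of_real using False l2_norm_nonneg[of \<nu> g] by (simp add: field_simps power_divide)
  qed
  have fV: "f \<in> V" using f orth by (simp add: V_def)
  have "0 < m * l2_norm \<nu> f ^ 4"
    using energy_positive[OF f f_nz] normalize[OF fV] by linarith
  then have m_pos: "m > 0" by (simp add: zero_less_mult_iff not_less)
  have S_ne: "S \<noteq> {}"
  proof -
    have "l2_norm \<nu> (\<lambda>x. of_real (1 / l2_norm \<nu> f) * f x) = 1"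
      unfolding l2_norm_scale norm_of_real using f_nz by (simp add: l2_norm_nonneg)
    then show ?thesis unfolding S_def image_is_empty using V_scale[OF fV] by blast
  qed
  \<comment> \<open>The factor 29/30 is chosen to give 9/10 below: 24 * 29/30 = 23.2 = 16 + 8 *
    9/10.\<close>
  have "29/30 * m < Sup S" using m_pos by (simp add: m_def)
  then obtain z where "z \<in> S" "29/30 * m < z"
    unfolding less_cSup_iff[OF S_ne bdd] by blast
  then obtain g where g: "g \<in> V" "l2_norm \<nu> g = 1" "29/30 * m < energy g"
    unfolding S_def by blast
  note gP = VP[OF g(1)]
  have u_large: "(cmod (corr g a))\<^sup>2 > 9/10" for a
  proof -
    let ?F = "\<lambda>c x. g x + c * g (x + a)"
    have F_le: "energy (?F c) \<le> m * (2 + 2 * Re (c * corr g a))\<^sup>2" if "cmod c = 1" for c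
    proof -
      have "l2_norm \<nu> (?F c) ^ 4 = ((l2_norm \<nu> (?F c))\<^sup>2)\<^sup>2" by simp
      also have "\<dots> = (2 + 2 * Re (c * corr g a))\<^sup>2"
        unfolding norm_add_shift[OF gP that] g(2) by simp
      finally show ?thesis using normalize[OF V_add_shift[OF g(1), of c a]] by simp
    qed
    \<comment> \<open>The four squares sum to 16 + 8 |u|^2 for \<open>u = corr g a\<close>, again
      because c and c^2 sum to 0. An exact maximizer would force |u| = 1, the equality case of
      Cauchy-Schwarz.\<close>
    have "24 * energy g \<le> (\<Sum>c\<in>{1, -1, \<i>, -\<i>}. m * (2 + 2 * Re (c * corr g a))\<^sup>2)"
      unfolding energy_parallelogram[OF gP, symmetric, of a] by (intro sum_mono F_le) (elim insertE emptyE, simp_all)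
    also have "\<dots> = m * (16 + 8 * (cmod (corr g a))\<^sup>2)"
      unfolding cmod_power2 by (simp add: complex_eq_iff power2_eq_square algebra_simps)
    finally have "24 * (29/30 * m) < m * (16 + 8 * (cmod (corr g a))\<^sup>2)" using g(3) by linarith
    then have "m * (24 * (29/30)) < m * (16 + 8 * (cmod (corr g a))\<^sup>2)" by (simp add: mult_ac)
    then have "24 * (29/30) < 16 + 8 * (cmod (corr g a))\<^sup>2" using m_pos by (simp only: mult_less_cancel_left_pos)
    then show ?thesis by simp
  qed
  have u_nz: "corr g a \<noteq> 0" for a using u_large[of a] by auto
  define v where "v x = sgn (corr g x)" for x
  have v_pos: "corr g x = of_real (cmod (corr g x)) * v x" for x
    using u_nz[of x] by (simp add: v_def sgn_eq)
  have Re_scale: "Re (of_real r * z) = r * Re z" for r z by simp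
  \<comment> \<open>The squared defect is below 1/10, while the squared modulus of the product
    \<open>?B\<close> exceeds 81/100; hence \<open>?A\<close> and \<open>?B\<close> differ in phase
    by less than a quarter turn.\<close>
  have near: "Re (v (x + y) * cnj (v x) * cnj (v y)) > 0" for x y
  proof -
    let ?A = "corr g (x + y)" and ?B = "corr g x * corr g y"
    have "(cmod (?A - ?B))\<^sup>2 < (cmod ?B)\<^sup>2"
    proof -
      have "(cmod (?A - ?B))\<^sup>2 < 1/10"
        using corr_almost_multiplicative[OF gP g(2), of x y] u_large[of y] by linarith
      also have "(1/10::real) \<le> 9/10 * (9/10)" by simp
      also have "\<dots> \<le> (cmod (corr g x))\<^sup>2 * (cmod (corr g y))\<^sup>2"
        using u_large[of x] u_large[of y] by (intro mult_mono) auto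
      finally show ?thesis by (simp add: norm_mult power_mult_distrib)
    qed
    then have "0 < Re (?A * cnj ?B)"
    proof -
      have "(cmod (?A - ?B))\<^sup>2 = (cmod ?A)\<^sup>2 + (cmod ?B)\<^sup>2 - 2 * Re (?A * cnj ?B)"
        unfolding cmod_power2 by (simp add: power2_eq_square algebra_simps)
      then show ?thesis using \<open>(cmod (?A - ?B))\<^sup>2 < (cmod ?B)\<^sup>2\<close> zero_le_power2[of "cmod ?A"] by linarith
    qed
    also have "?A * cnj ?B = of_real (cmod ?A * cmod (corr g x) * cmod (corr g y)) * (v (x + y) * cnj (v x) * cnj (v y))"
      by (subst (1 2 3) v_pos) (simp add: mult_ac)
    finally show ?thesis
      unfolding Re_scale by (rule zero_less_mult_pos) (simp add: u_nz)
  qed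
  have v_borel: "v \<in> borel_measurable borel"
    unfolding v_def sgn_eq using corr_borel[OF gP] by (intro borel_measurable_divide) auto
  have v_per: "periodic \<Lambda> v" unfolding v_def by (rule periodic_compose[OF corr_periodic[OF gP]])
  have v_norm: "cmod (v x) = 1" for x by (simp add: v_def norm_sgn u_nz)
  obtain \<kappa> where \<kappa>: "\<kappa> \<in> annihilator \<Lambda>" and \<kappa>v: "\<And>x. Re (v x * cnj (\<kappa> x)) > 0"
    using character_near_almost_character[OF v_borel v_per v_norm near] by blast
  have pos: "Re (corr g x * cnj (\<kappa> x)) > 0" for x
    by (subst v_pos, unfold mult.assoc Re_scale, rule mult_pos_pos[OF _ \<kappa>v]) (simp add: u_nz)
  have int: "integrable \<nu> (\<lambda>x. corr g x * cnj (\<kappa> x))"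
    by (intro L2_mult_integrable P2_L2 corr_P2 gP annihilatorD \<kappa>)
  \<comment> \<open>Positivity at every point and total mass 1 make the integral strictly
    positive.\<close>
  have "(LINT x|\<nu>. 0) < (LINT x|\<nu>. Re (corr g x * cnj (\<kappa> x)))"
    by (rule integral_less_AE_space[OF _ integrable_Re[OF int] AE_I2[OF pos]]) (simp_all add: space_eq total)
  also have "\<dots> = Re (LINT x|\<nu>. corr g x * cnj (\<kappa> x))"
    by (rule integral_Re[OF int])
  also have "\<dots> = 0"
    using corr_orthogonal[OF gP \<kappa>] g(1) \<kappa> by (simp add: V_def)
  finally show False by simp
qed

text \<open>Translation by \<open>y\<close> multiplies the inner product of two characters by
  \<open>\<kappa> y * cnj (\<kappa>' y)\<close>, which differs from 1 for some \<open>y\<close>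
  unless they coincide.\<close>

lemma characters_orthonormal: "l2_orthonormal \<nu> (annihilator \<Lambda>) (\<lambda>\<kappa>. \<kappa>)"
  unfolding l2_orthonormal_def
proof (intro conjI ballI)
  fix \<kappa> \<kappa>' assume A: "\<kappa> \<in> annihilator \<Lambda>" "\<kappa>' \<in> annihilator \<Lambda>"
  note D = annihilatorD[OF A(1)] and D' = annihilatorD[OF A(2)]
  show "l2_inner \<nu> \<kappa> \<kappa>' = (if \<kappa> = \<kappa>' then 1 else 0)"
  proof (cases "\<kappa> = \<kappa>'")
    case True
    then have "\<kappa> x * cnj (\<kappa>' x) = 1" for x using D(2)[of x] complex_norm_square[of "\<kappa> x"] by simp
    then show ?thesis using True by (simp add: l2_inner_def measure_UNIV space_eq)
  next
    case False
    then obtain y where y: "\<kappa> y \<noteq> \<kappa>' y" by blast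
    have shifts: "shift y \<kappa> = (\<lambda>x. \<kappa> y * \<kappa> x)" "shift y \<kappa>' = (\<lambda>x. \<kappa>' y * \<kappa>' x)"
      by (simp_all add: D(3) D'(3) mult.commute)
    have "l2_inner \<nu> \<kappa> \<kappa>' = \<kappa> y * (cnj (\<kappa>' y) * l2_inner \<nu> \<kappa> \<kappa>')"
      using inner_shift[OF D(7) D'(7), of y]
      unfolding shifts l2_inner_scale_left l2_inner_scale_right by simp
    then have "\<kappa>' y * l2_inner \<nu> \<kappa> \<kappa>' = (\<kappa>' y * cnj (\<kappa>' y)) * (\<kappa> y * l2_inner \<nu> \<kappa> \<kappa>')"
      by (metis mult.assoc mult.left_commute)
    also have "\<kappa>' y * cnj (\<kappa>' y) = 1"
      using D'(2)[of y] complex_norm_square[of "\<kappa>' y"] by simp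
    finally show ?thesis using y False by simp
  qed
qed (use annihilatorD(7) in \<open>auto intro: P2_L2\<close>)

text \<open>Each character has a nonzero coefficient against the indicator of some saturated basic
  neighbourhood of 0, since it stays near 1 there. By Bessel each of these countably many indicators
  has only countably many nonzero coefficients.\<close>

lemma annihilator_countable: "countable (annihilator \<Lambda>)"
proof -
  obtain \<B> :: "'a set set" where B: "countable \<B>" "topological_basis \<B>"
    using ex_countable_basis by blast
  define U where "U W = {x. \<exists>l\<in>\<Lambda>. x + l \<in> W}" for W
  define \<B>0 where "\<B>0 = {W \<in> \<B>. 0 \<in> W}"
  define K where "K W = {\<kappa> \<in> annihilator \<Lambda>. l2_inner \<nu> (indicator (U W)) \<kappa> \<noteq> 0}" for W
  have L2_U: "(indicator (U W) :: 'a \<Rightarrow> complex) \<in> L2 \<nu>" and sets_U: "U W \<in> sets \<nu>"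
    and pos: "measure \<nu> (U W) > 0" if "W \<in> \<B>0" for W
  proof -
    have W: "open W" "0 \<in> W" using that topological_basis_open[OF B(2)] by (auto simp: \<B>0_def)
    have nz: "emeasure \<nu> (U W) \<noteq> 0" unfolding U_def by (rule open_positive[OF W])
    then show s: "U W \<in> sets \<nu>" by (rule emeasure_neq_0_sets)
    show "measure \<nu> (U W) > 0" using nz by (simp add: emeasure_eq_measure zero_less_measure_iff)
    have "integrable \<nu> (\<lambda>x. (cmod (indicator (U W) x))\<^sup>2)"
      using s by (intro integrable_const_bound[where B=1]) (auto simp: indicator_def)
    then show "(indicator (U W) :: 'a \<Rightarrow> complex) \<in> L2 \<nu>" using s by (simp add: L2_iff)
  qed
  have "countable (K W)" if "W \<in> \<B>0" for W
  proof -
    have "countable {\<kappa> \<in> annihilator \<Lambda>. (cmod (l2_inner \<nu> (indicator (U W)) \<kappa>))\<^sup>2 \<noteq> 0}"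
      by (rule summable_countable_real[OF l2_Bessel_summable[OF characters_orthonormal L2_U[OF that]]])
    then show ?thesis by (simp add: K_def)
  qed
  then have "countable (\<Union>W\<in>\<B>0. K W)"
    using B(1) by (intro countable_UN countable_subset[OF _ B(1)]) (auto simp: \<B>0_def)
  moreover have "annihilator \<Lambda> \<subseteq> (\<Union>W\<in>\<B>0. K W)"
  proof
    fix \<kappa> assume \<kappa>: "\<kappa> \<in> annihilator \<Lambda>"
    note D = annihilatorD[OF \<kappa>]
    \<comment> \<open>Any threshold strictly between 0 and 1 would serve.\<close>
    have "open ((\<lambda>x. Re (\<kappa> x)) -` {1/2<..})"
      by (intro open_vimage continuous_intros D)
    moreover have "0 \<in> (\<lambda>x. Re (\<kappa> x)) -` {1/2<..}" using D(4)[OF zero_mem] by simp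
    ultimately obtain W where W: "W \<in> \<B>" "0 \<in> W" "W \<subseteq> (\<lambda>x. Re (\<kappa> x)) -` {1/2<..}"
      by (rule topological_basisE[OF B(2)])
    have WB: "W \<in> \<B>0" using W by (simp add: \<B>0_def)
    have Re_large: "Re (\<kappa> x) > 1/2" if "x \<in> U W" for x
    proof -
      obtain l where "l \<in> \<Lambda>" "x + l \<in> W" using \<open>x \<in> U W\<close> by (auto simp: U_def)
      then show ?thesis using W(3) periodicD[OF D(5), of l x] by auto
    qed
    have int: "integrable \<nu> (\<lambda>x. indicator (U W) x * cnj (\<kappa> x))"
      by (rule L2_mult_integrable[OF L2_U[OF WB] P2_L2[OF D(7)]])
    have int2: "integrable \<nu> (\<lambda>x. 1/2 * indicator (U W) x :: real)"
      using sets_U[OF WB] by (intro integrable_real_mult_indicator) simp_all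
    have "1/2 * measure \<nu> (U W) = (LINT x|\<nu>. 1/2 * indicator (U W) x)"
      using sets_U[OF WB] sets.sets_into_space[OF sets_U[OF WB]] by (simp add: Int_absorb2)
    also have "\<dots> \<le> (LINT x|\<nu>. Re (indicator (U W) x * cnj (\<kappa> x)))"
      using Re_large by (intro integral_mono int2 integrable_Re int) (auto simp: indicator_def less_imp_le)
    also have "\<dots> = Re (l2_inner \<nu> (indicator (U W)) \<kappa>)"
      unfolding l2_inner_def by (rule integral_Re[OF int])
    finally have "l2_inner \<nu> (indicator (U W)) \<kappa> \<noteq> 0" using pos[OF WB] by auto
    then show "\<kappa> \<in> (\<Union>W\<in>\<B>0. K W)" using \<kappa> WB by (auto simp: K_def)
  qed
  ultimately show ?thesis by (rule countable_subset[rotated])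
qed

end

section \<open>Fundamental domains\<close>

lemma difference_neighbourhood:
  fixes T :: "'a::topological_group_add set"
  assumes "open T" "0 \<in> T"
  obtains U where "open U" "0 \<in> U" "\<And>u v. u \<in> U \<Longrightarrow> v \<in> U \<Longrightarrow> u - v \<in> T"
proof -
  have "open ((\<lambda>p. fst p - snd p) -` T)"
    by (intro open_vimage assms continuous_intros)
  moreover have "(0, 0) \<in> (\<lambda>p. fst p - snd p) -` T" using assms by simp
  ultimately obtain A B where "open A" "open B" "(0, 0) \<in> A \<times> B" "A \<times> B \<subseteq> (\<lambda>p. fst p - snd p) -` T"
    by (rule open_prod_elim)
  then show ?thesis by (intro that[of "A \<inter> B"]) auto
qed

lemma open_shift_preimage:
  fixes W :: "'a::topological_group_add set"
  assumes "open W"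
  shows "open {x. x + y \<in> W}"
  using open_vimage[OF assms, of "\<lambda>x. x + y"] by (simp add: vimage_def continuous_intros)

locale haar_lattice =
  fixes \<mu> :: "'a::{topological_ab_group_add, second_countable_topology, t2_space} measure"
    and \<Lambda> :: "'a set"
  assumes locally_compact: "locally_compact_space (euclidean :: 'a topology)"
    and haar: "haar_measure \<mu>"
    and lattice: "uniform_lattice \<Lambda>"
    and countable_lattice: "countable \<Lambda>"
begin

section \<open>Haar measure under translations\<close>

lemma sets_haar: "sets \<mu> = sets borel"
  using haar by (simp add: haar_measure_def)

lemma space_haar: "space \<mu> = UNIV"
  using sets_eq_imp_space_eq[OF sets_haar] by simp

lemma measurable_haar: "measurable \<mu> N = measurable borel N"
  by (rule measurable_cong_sets[OF sets_haar refl])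

lemma lattice_zero: "0 \<in> \<Lambda>"
  and lattice_add: "x \<in> \<Lambda> \<Longrightarrow> y \<in> \<Lambda> \<Longrightarrow> x + y \<in> \<Lambda>"
  and lattice_minus: "x \<in> \<Lambda> \<Longrightarrow> - x \<in> \<Lambda>"
  using lattice by (auto simp: uniform_lattice_def)

lemma lattice_diff: "x \<in> \<Lambda> \<Longrightarrow> y \<in> \<Lambda> \<Longrightarrow> x - y \<in> \<Lambda>"
  using lattice_add[of x "- y"] lattice_minus[of y] by simp

lemmas haarD = haar[unfolded haar_measure_def]

lemma haar_nonzero: "emeasure \<mu> UNIV \<noteq> 0"
  by (rule haarD[THEN conjunct2, THEN conjunct1])

lemma haar_translate: "A \<in> sets borel \<Longrightarrow> emeasure \<mu> ((+) x ` A) = emeasure \<mu> A"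
  by (rule haarD[THEN conjunct2, THEN conjunct2, THEN conjunct1, rule_format])

lemma haar_compact_finite: "compact K \<Longrightarrow> emeasure \<mu> K < \<infinity>"
  by (rule haarD[THEN conjunct2, THEN conjunct2, THEN conjunct2, THEN conjunct1, rule_format])

lemma haar_outer_regular: "A \<in> sets borel \<Longrightarrow> emeasure \<mu> A = (INF U\<in>{U. open U \<and> A \<subseteq> U}. emeasure \<mu> U)"
  by (rule haarD[THEN conjunct2, THEN conjunct2, THEN conjunct2, THEN conjunct2, THEN conjunct1, rule_format])

lemma haar_inner_regular: "open U \<Longrightarrow> emeasure \<mu> U = (SUP K\<in>{K. compact K \<and> K \<subseteq> U}. emeasure \<mu> K)"
  by (rule haarD[THEN conjunct2, THEN conjunct2, THEN conjunct2, THEN conjunct2, THEN conjunct2, rule_format])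

text \<open>Invariance as an image measure identity, from which integrals, integrability and almost
  everywhere statements inherit it.\<close>

lemma haar_distr: "distr \<mu> borel (\<lambda>x. x + y) = \<mu>"
proof (rule measure_eqI)
  show "sets (distr \<mu> borel (\<lambda>x. x + y)) = sets \<mu>" by (simp add: sets_haar)
  fix A assume "A \<in> sets (distr \<mu> borel (\<lambda>x. x + y))"
  then have A: "A \<in> sets borel" by simp
  have "(\<lambda>x. x + y) -` A = (+) (- y) ` A"
  proof (intro set_eqI iffI)
    fix x assume "x \<in> (\<lambda>x. x + y) -` A"
    then show "x \<in> (+) (- y) ` A" by (intro image_eqI[of _ _ "x + y"]) (auto simp: add.commute)
  qed (auto simp: add.commute)
  then have "emeasure \<mu> ((\<lambda>x. x + y) -` A) = emeasure \<mu> A"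
    by (simp only: haar_translate[OF A])
  then show "emeasure (distr \<mu> borel (\<lambda>x. x + y)) A = emeasure \<mu> A"
    using A by (subst emeasure_distr) (simp_all add: measurable_haar space_haar)
qed

lemma nn_integral_haar_shift:
  "f \<in> borel_measurable borel \<Longrightarrow> (\<integral>\<^sup>+x. f (x + y) \<partial>\<mu>) = (\<integral>\<^sup>+x. f x \<partial>\<mu>)"
  by (subst (2) haar_distr[of y, symmetric]) (simp add: nn_integral_distr measurable_haar)

lemma integral_haar_shift:
  fixes f :: "'a \<Rightarrow> 'b::{banach, second_countable_topology}"
  shows "f \<in> borel_measurable borel \<Longrightarrow> (LINT x|\<mu>. f (x + y)) = (LINT x|\<mu>. f x)"
  by (subst (2) haar_distr[of y, symmetric]) (simp add: integral_distr measurable_haar)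

lemma integrable_haar_shift:
  fixes f :: "'a \<Rightarrow> 'b::{banach, second_countable_topology}"
  assumes "integrable \<mu> f"
  shows "integrable \<mu> (\<lambda>x. f (x + y))"
  by (rule integrable_distr[of "\<lambda>x. x + y" \<mu> borel]) (simp_all add: measurable_haar haar_distr assms)

lemma AE_haar_shift:
  assumes "AE x in \<mu>. P x"
  shows "AE x in \<mu>. P (x + y)"
proof (rule AE_distrD[of "\<lambda>x. x + y" \<mu> borel])
  show "AE x in distr \<mu> borel (\<lambda>x. x + y). P x" unfolding haar_distr by (rule assms)
qed (unfold measurable_haar, measurable)

lemma emeasure_haar_shift:
  assumes "A \<in> sets borel"
  shows "emeasure \<mu> {x. x + y \<in> A} = emeasure \<mu> A"
  by (subst (2) haar_distr[of y, symmetric], subst emeasure_distr)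
    (simp_all add: assms measurable_haar space_haar vimage_def)

lemma sets_shift:
  fixes A :: "'a set"
  assumes "A \<in> sets borel"
  shows "{x. x + y \<in> A} \<in> sets borel"
proof -
  have "(\<lambda>x. x + y) -` A \<inter> space borel \<in> sets borel"
    by (rule measurable_sets[OF _ assms]) measurable
  then show ?thesis by (simp add: vimage_def)
qed

text \<open>Discreteness yields a \<open>U\<close> meeting each coset at most once; local
  compactness supplies \<open>K\<close>, which bounds measures.\<close>

lemma separating_neighbourhood:
  obtains U K where "open U" "0 \<in> U" "compact K" "U \<subseteq> K"
    "\<And>u v. u \<in> U \<Longrightarrow> v \<in> U \<Longrightarrow> u - v \<in> \<Lambda> \<Longrightarrow> u = v"
proof -
  have "0 isolated_in \<Lambda>" using lattice lattice_zero by (simp add: uniform_lattice_def discrete_def)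
  then obtain T where T: "open T" "T \<inter> \<Lambda> = {0}" by (auto simp: isolated_in_def)
  obtain V where V: "open V" "0 \<in> V" "\<And>u v. u \<in> V \<Longrightarrow> v \<in> V \<Longrightarrow> u - v \<in> T"
    by (rule difference_neighbourhood[of T]) (use T in auto)
  have "\<exists>W K. openin euclidean W \<and> compactin euclidean K \<and> (0::'a) \<in> W \<and> W \<subseteq> K"
    using locally_compact unfolding locally_compact_space_def by (rule bspec) simp
  then obtain W K :: "'a set" where W: "open W" "compact K" "0 \<in> W" "W \<subseteq> K"
    by (auto simp only: compactin_euclidean_iff open_openin)
  show ?thesis
  proof (rule that)
    show "open (V \<inter> W)" "0 \<in> V \<inter> W" "compact K" "V \<inter> W \<subseteq> K" using V W by auto
    show "u = v" if "u \<in> V \<inter> W" "v \<in> V \<inter> W" "u - v \<in> \<Lambda>" for u v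
    proof -
      have "u - v \<in> T \<inter> \<Lambda>" using V(3)[of u v] that by simp
      then show ?thesis unfolding T(2) by simp
    qed
  qed
qed

text \<open>\<open>B x\<close> is the image of \<open>x + U\<close> in the quotient. It is open
  because its preimage is a union of translates of \<open>U\<close>, so compactness leaves finitely
  many centres.\<close>

lemma finite_cover:
  assumes U: "open U" "0 \<in> U"
  obtains X where "finite X" "\<And>g. \<exists>x\<in>X. \<exists>l\<in>\<Lambda>. g + l - x \<in> U"
proof -
  define B where "B x = coset \<Lambda> ` {g. g - x \<in> U}" for x
  have coset_eq: "coset \<Lambda> g = coset \<Lambda> h \<longleftrightarrow> (\<exists>l\<in>\<Lambda>. h = g + l)" for g h
  proof
    assume "coset \<Lambda> g = coset \<Lambda> h"
    then have "h + 0 \<in> coset \<Lambda> g" using lattice_zero unfolding coset_def by blast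
    then show "\<exists>l\<in>\<Lambda>. h = g + l" by (auto simp: coset_def)
  next
    assume "\<exists>l\<in>\<Lambda>. h = g + l"
    then obtain l where l: "l \<in> \<Lambda>" "h = g + l" by blast
    show "coset \<Lambda> g = coset \<Lambda> h"
      unfolding coset_def l(2)
    proof (intro equalityI image_subsetI)
      fix m assume "m \<in> \<Lambda>"
      then show "g + m \<in> (+) (g + l) ` \<Lambda>"
        using l(1) by (intro image_eqI[of _ _ "m - l"]) (auto simp: lattice_diff algebra_simps)
    next
      fix m assume "m \<in> \<Lambda>"
      then show "g + l + m \<in> (+) g ` \<Lambda>"
        using l(1) by (intro image_eqI[of _ _ "l + m"]) (auto simp: lattice_add algebra_simps)
    qed
  qed
  have vim: "coset \<Lambda> -` B x = (\<Union>l\<in>\<Lambda>. {g. g + (l - x) \<in> U})" for x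
  proof (intro equalityI subsetI)
    fix g assume "g \<in> coset \<Lambda> -` B x"
    then obtain l where "l \<in> \<Lambda>" "g + l - x \<in> U" by (auto simp: B_def image_iff coset_eq)
    then show "g \<in> (\<Union>l\<in>\<Lambda>. {g. g + (l - x) \<in> U})" by (auto simp: add_diff_eq)
  next
    fix g assume "g \<in> (\<Union>l\<in>\<Lambda>. {g. g + (l - x) \<in> U})"
    then obtain l where l: "l \<in> \<Lambda>" "g + l - x \<in> U" by (auto simp: add_diff_eq)
    then have "coset \<Lambda> (g + l) \<in> B x" by (auto simp: B_def)
    moreover have "coset \<Lambda> g = coset \<Lambda> (g + l)" using l(1) by (auto simp: coset_eq)
    ultimately show "g \<in> coset \<Lambda> -` B x" by simp
  qed
  have open_B: "openin (coset_topology \<Lambda>) (B x)" for x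
    unfolding openin_coset_topology vim
    by (auto simp: B_def intro!: open_UN open_shift_preimage U)
  have top: "topspace (coset_topology \<Lambda>) = range (coset \<Lambda>)"
    unfolding topspace_def openin_coset_topology by (auto intro!: exI[of _ "range (coset \<Lambda>)"] simp: vimage_def)
  have cover: "range (coset \<Lambda>) \<subseteq> \<Union>(range B)"
    using U(2) by (auto simp: B_def)
  have "compactin (coset_topology \<Lambda>) (range (coset \<Lambda>))"
    using lattice by (simp add: uniform_lattice_def compact_space_def top)
  then obtain \<F> where F: "finite \<F>" "\<F> \<subseteq> range B" "range (coset \<Lambda>) \<subseteq> \<Union>\<F>"
    unfolding compactin_def using open_B cover by (auto elim!: allE[of _ "range B"])
  then obtain X where X: "finite X" "\<F> = B ` X" using finite_subset_image[of \<F> B UNIV] by blast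
  show ?thesis
  proof (rule that[OF X(1)])
    fix g
    have "coset \<Lambda> g \<in> \<Union>(B ` X)" using F(3) X(2) by blast
    then obtain x where x: "x \<in> X" "g \<in> coset \<Lambda> -` B x" by blast
    then show "\<exists>x\<in>X. \<exists>l\<in>\<Lambda>. g + l - x \<in> U"
      unfolding vim by (auto simp: algebra_simps)
  qed
qed

text \<open>Each translate of \<open>U\<close> by some \<open>p i\<close> meets a coset at most
  once, and together they meet every coset. Removing from each translate the saturations of the
  earlier ones leaves exactly one point per coset, and only open sets and differences are
  involved.\<close>

lemma fundamental_domain_exists:
  obtains Q where "Q \<in> sets borel" "emeasure \<mu> Q \<noteq> 0" "emeasure \<mu> Q \<noteq> \<infinity>" "\<And>g. \<exists>!l. l \<in> \<Lambda> \<and> g + l \<in> Q"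
proof -
  obtain U K where U: "open U" "0 \<in> U" "compact K" "U \<subseteq> K"
    and sep: "\<And>u v. u \<in> U \<Longrightarrow> v \<in> U \<Longrightarrow> u - v \<in> \<Lambda> \<Longrightarrow> u = v"
    by (rule separating_neighbourhood) blast
  obtain X where X: "finite X" "\<And>g. \<exists>x\<in>X. \<exists>l\<in>\<Lambda>. g + l - x \<in> U"
    by (rule finite_cover[OF U(1,2)]) blast
  obtain n :: nat and p where p: "X = p ` {..<n}"
    using finite_imp_nat_seg_image_inj_on[OF X(1)] unfolding lessThan_def by blast
  define Q where "Q = (\<Union>i<n. {g. g - p i \<in> U} - (\<Union>j<i. \<Union>l\<in>\<Lambda>. {g. g + (l - p j) \<in> U}))"
  have open1: "open {g. g - p i \<in> U}" for i using open_shift_preimage[OF U(1), of "- p i"] by simp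
  have Q: "Q \<in> sets borel"
    unfolding Q_def by (intro sets.finite_UN sets.Diff borel_open open1 open_UN ballI open_shift_preimage U) auto
  have ex: "\<exists>l\<in>\<Lambda>. g + l \<in> Q" for g
  proof -
    \<comment> \<open>The representative of the coset of \<open>g\<close> comes from the first
      translate that this coset meets.\<close>
    define P where "P i \<longleftrightarrow> i < n \<and> (\<exists>l\<in>\<Lambda>. g + l - p i \<in> U)" for i
    have "\<exists>i. P i" using X(2)[of g] by (auto simp: p P_def)
    then have L: "P (LEAST i. P i)" and min: "\<And>j. j < (LEAST i. P i) \<Longrightarrow> \<not> P j"
      by (auto intro: LeastI_ex dest: not_less_Least)
    define i where "i = (LEAST i. P i)"
    obtain l where l: "l \<in> \<Lambda>" "g + l - p i \<in> U" and i: "i < n" using L by (auto simp: P_def i_def)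
    have "g + l + (m - p j) \<notin> U" if "j < i" "m \<in> \<Lambda>" for j m
    proof
      assume "g + l + (m - p j) \<in> U"
      then have "g + (l + m) - p j \<in> U" by (simp add: algebra_simps)
      then have "P j" using that i lattice_add[OF l(1) that(2)] unfolding P_def by force
      with min[of j] that show False by (simp add: i_def)
    qed
    then have "g + l \<in> Q" unfolding Q_def using l i by auto
    with l show ?thesis by blast
  qed
  \<comment> \<open>Two points of one coset must come from the same translate, as the later index
    would have been removed; there \<open>sep\<close> applies.\<close>
  have uniq: "l = m" if lm: "l \<in> \<Lambda>" "m \<in> \<Lambda>" "g + l \<in> Q" "g + m \<in> Q" for g l m
  proof -
    obtain i where i: "i < n" "g + l - p i \<in> U" "\<And>j k. j < i \<Longrightarrow> k \<in> \<Lambda> \<Longrightarrow> g + l + (k - p j) \<notin> U"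
      using lm(3) by (auto simp: Q_def)
    obtain j where j: "j < n" "g + m - p j \<in> U" "\<And>i k. i < j \<Longrightarrow> k \<in> \<Lambda> \<Longrightarrow> g + m + (k - p i) \<notin> U"
      using lm(4) by (auto simp: Q_def)
    have "g + l + (m - l - p j) = g + m - p j" "g + m + (l - m - p i) = g + l - p i" by (simp_all add: algebra_simps)
    then have "\<not> j < i" "\<not> i < j"
      using i(3)[of j "m - l"] j(3)[of i "l - m"] i(2) j(2) lm by (auto simp: lattice_diff add_diff_eq)
    then have "i = j" by simp
    moreover have "(g + l - p i) - (g + m - p i) = l - m" by simp
    ultimately have "g + l - p i = g + m - p i"
      using sep[of "g + l - p i" "g + m - p i"] i(2) j(2) lm by (simp add: lattice_diff)
    then show ?thesis by simp
  qed
  show ?thesis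
  proof (rule that[OF Q])
    show "\<exists>!l. l \<in> \<Lambda> \<and> g + l \<in> Q" for g using ex[of g] uniq[of _ _ g] by blast
    \<comment> \<open>Countably many lattice translates of \<open>Q\<close> cover the group.\<close>
    show "emeasure \<mu> Q \<noteq> 0"
    proof
      assume 0: "emeasure \<mu> Q = 0"
      have "(\<Union>l\<in>\<Lambda>. {g. g + l \<in> Q}) \<in> null_sets \<mu>"
        using 0 Q by (intro null_sets_UN' countable_lattice)
          (auto simp: null_sets_def sets_haar sets_shift emeasure_haar_shift)
      also have "(\<Union>l\<in>\<Lambda>. {g. g + l \<in> Q}) = UNIV" using ex by auto
      finally show False using haar_nonzero by (simp add: null_setsD1)
    qed
    have "Q \<subseteq> (\<Union>i<n. (+) (p i) ` K)"
    proof
      fix g assume "g \<in> Q"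
      then obtain i where i: "i < n" "g - p i \<in> U" by (auto simp: Q_def)
      have "g = p i + (g - p i)" by simp
      then have "g \<in> (+) (p i) ` K" using i(2) U(4) by blast
      with i show "g \<in> (\<Union>i<n. (+) (p i) ` K)" by blast
    qed
    moreover have c: "compact (\<Union>i<n. (+) (p i) ` K)"
      by (intro compact_UN finite_lessThan compact_continuous_image continuous_intros U)
    ultimately have "emeasure \<mu> Q \<le> emeasure \<mu> (\<Union>i<n. (+) (p i) ` K)"
      by (intro emeasure_mono) (auto simp: sets_haar intro!: borel_closed compact_imp_closed)
    with haar_compact_finite[OF c] show "emeasure \<mu> Q \<noteq> \<infinity>" by auto
  qed
qed

end

section \<open>The Gabor basis of a fundamental domain\<close>

locale fundamental_domain = haar_lattice \<mu> \<Lambda>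
  for \<mu> :: "'a::{topological_ab_group_add, second_countable_topology, t2_space} measure" and \<Lambda> +
  fixes Q :: "'a set"
  assumes Q_borel: "Q \<in> sets borel"
    and Q_nonzero: "emeasure \<mu> Q \<noteq> 0"
    and Q_finite: "emeasure \<mu> Q \<noteq> \<infinity>"
    and Q_unique: "\<exists>!l. l \<in> \<Lambda> \<and> g + l \<in> Q"
begin

definition vol :: real where "vol = measure \<mu> Q"

text \<open>Normalized Haar measure of the quotient, carried over to its set of representatives
  \<open>Q\<close>.\<close>

definition \<nu> :: "'a measure" where "\<nu> = uniform_measure \<mu> Q"

section \<open>Integration over the fundamental domain\<close>

lemma emeasure_Q: "emeasure \<mu> Q = ennreal vol"
  using Q_finite by (simp add: vol_def emeasure_eq_ennreal_measure)

lemma vol_pos: "vol > 0"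
  using Q_nonzero emeasure_Q by (simp add: vol_def zero_less_measure_iff)

lemma Q_sets: "Q \<in> sets \<mu>"
  by (simp add: sets_haar Q_borel)

text \<open>The lattice translates of \<open>Q\<close> form a partition of unity; inserting it as a
  factor 1 unfolds integrals.\<close>

lemma sum_over_lattice:
  "(\<integral>\<^sup>+l. indicator Q (g + l) \<partial>count_space \<Lambda>) = 1"
  "(\<integral>\<^sup>+l. indicator Q (g - l) \<partial>count_space \<Lambda>) = 1"
proof -
  have *: "(\<integral>\<^sup>+l. f l \<partial>count_space \<Lambda>) = 1" if "l0 \<in> \<Lambda>" "\<And>l. l \<in> \<Lambda> \<Longrightarrow> f l = indicator {l0} l" for f and l0 :: 'a
  proof -
    have "(\<integral>\<^sup>+l. f l \<partial>count_space \<Lambda>) = (\<integral>\<^sup>+l. indicator {l0} l \<partial>count_space \<Lambda>)"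
      by (intro nn_integral_cong) (simp add: that)
    then show ?thesis using that(1) by simp
  qed
  obtain l0 where l0: "l0 \<in> \<Lambda>" "g + l0 \<in> Q" "\<And>l. l \<in> \<Lambda> \<Longrightarrow> g + l \<in> Q \<Longrightarrow> l = l0"
    using Q_unique[of g] by blast
  show "(\<integral>\<^sup>+l. indicator Q (g + l) \<partial>count_space \<Lambda>) = 1"
  proof (rule *[OF l0(1)])
    fix l assume l: "l \<in> \<Lambda>"
    show "indicator Q (g + l) = (indicator {l0} l :: ennreal)"
    proof -
      have "g + l \<in> Q \<longleftrightarrow> l = l0" using l0(2) l0(3)[OF l] by blast
      then show ?thesis by (simp only: indicator_def singleton_iff)
    qed
  qed
  show "(\<integral>\<^sup>+l. indicator Q (g - l) \<partial>count_space \<Lambda>) = 1"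
  proof (rule *[of "- l0"])
    show "- l0 \<in> \<Lambda>" using l0 lattice_minus by blast
    fix l assume l: "l \<in> \<Lambda>"
    have "l = - l0" if "g - l \<in> Q"
      using l0(3)[OF lattice_minus[OF l]] that by (auto simp: minus_equation_iff)
    then have "g - l \<in> Q \<longleftrightarrow> l = - l0" using l0(2) by auto
    then show "indicator Q (g - l) = (indicator {- l0} l :: ennreal)"
      by (simp only: indicator_def singleton_iff)
  qed
qed

text \<open>\<open>Q\<close> and its translate by \<open>y\<close> are both fundamental domains; cutting one along the
  \<open>\<Lambda>\<close>-translates of the other and reassembling preserves the integral of a periodic function.\<close>

lemma nn_integral_domain_shift:
  assumes f: "f \<in> borel_measurable borel" "periodic \<Lambda> f"
  shows "(\<integral>\<^sup>+x. f (x + y) * indicator Q x \<partial>\<mu>) = (\<integral>\<^sup>+x. f x * indicator Q x \<partial>\<mu>)"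
proof -
  have meas: "(\<lambda>x. indicator Q (x + z) :: ennreal) \<in> borel_measurable borel" for z
    by (rule measurable_shift[OF borel_measurable_indicator[OF Q_borel]])
  have "(\<integral>\<^sup>+x. f (x + y) * indicator Q x \<partial>\<mu>) = (\<integral>\<^sup>+x. f (x + y) * indicator Q (x + y + - y) \<partial>\<mu>)"
    by simp
  also have "\<dots> = (\<integral>\<^sup>+x. f x * indicator Q (x + - y) \<partial>\<mu>)"
    by (rule nn_integral_haar_shift[of "\<lambda>x. f x * indicator Q (x + - y)"])
      (intro borel_measurable_times_ennreal f meas)
  also have "\<dots> = (\<integral>\<^sup>+x. (\<integral>\<^sup>+l. f x * indicator Q (x + - y) * indicator Q (x + l) \<partial>count_space \<Lambda>) \<partial>\<mu>)"
    by (simp add: nn_integral_cmult sum_over_lattice)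
  also have "\<dots> = (\<integral>\<^sup>+l. (\<integral>\<^sup>+x. f x * indicator Q (x + - y) * indicator Q (x + l) \<partial>\<mu>) \<partial>count_space \<Lambda>)"
    by (rule nn_integral_count_space_nn_integral[OF countable_lattice])
      (unfold measurable_haar, intro borel_measurable_times_ennreal f meas)
  \<comment> \<open>The substitution of \<open>x - l\<close> for \<open>x\<close> leaves
    \<open>f\<close> alone by periodicity and moves the lattice variable from the indicator of
    \<open>Q\<close> to that of its translate.\<close>
  also have "\<dots> = (\<integral>\<^sup>+l. (\<integral>\<^sup>+x. f x * indicator Q x * indicator Q (x + - y - l) \<partial>\<mu>) \<partial>count_space \<Lambda>)"
  proof (rule nn_integral_cong)
    fix l assume "l \<in> space (count_space \<Lambda>)"
    then have l: "l \<in> \<Lambda>" by simp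
    have "(\<integral>\<^sup>+x. f x * indicator Q (x + - y) * indicator Q (x + l) \<partial>\<mu>)
        = (\<integral>\<^sup>+x. f (x + - l) * indicator Q (x + - l + - y) * indicator Q (x + - l + l) \<partial>\<mu>)"
      by (rule nn_integral_haar_shift[of "\<lambda>x. f x * indicator Q (x + - y) * indicator Q (x + l)", symmetric])
        (intro borel_measurable_times_ennreal f meas)
    also have "\<dots> = (\<integral>\<^sup>+x. f x * indicator Q x * indicator Q (x + - y - l) \<partial>\<mu>)"
      unfolding periodicD[OF f(2) lattice_minus[OF l]] by (intro nn_integral_cong) (simp add: algebra_simps)
    finally show "(\<integral>\<^sup>+x. f x * indicator Q (x + - y) * indicator Q (x + l) \<partial>\<mu>) = \<dots>" .
  qed
  also have "\<dots> = (\<integral>\<^sup>+x. (\<integral>\<^sup>+l. f x * indicator Q x * indicator Q (x + - y - l) \<partial>count_space \<Lambda>) \<partial>\<mu>)"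
  proof (rule nn_integral_count_space_nn_integral[OF countable_lattice, symmetric])
    fix l
    have "(\<lambda>x. indicator Q (x + (- y - l)) :: ennreal) \<in> borel_measurable borel" by (rule meas)
    then show "(\<lambda>x. f x * indicator Q x * indicator Q (x + - y - l)) \<in> borel_measurable \<mu>"
      unfolding measurable_haar add_diff_eq[symmetric] using f(1) Q_borel
      by (intro borel_measurable_times_ennreal) auto
  qed
  also have "\<dots> = (\<integral>\<^sup>+x. f x * indicator Q x \<partial>\<mu>)"
    by (simp add: nn_integral_cmult sum_over_lattice del: diff_conv_add_uminus add_uminus_conv_diff)
  finally show ?thesis .
qed

lemma sets_\<nu>: "sets \<nu> = sets borel"
  by (simp add: \<nu>_def sets_haar)

text \<open>Regularity replaces \<open>A0\<close> by an open \<open>U\<close> containing it and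
  \<open>U\<close> by a compact \<open>C\<close> inside it, with small losses. The tube lemma gives
  a neighbourhood \<open>W\<close> of 0 with \<open>W + C\<close> inside \<open>U\<close>, so a
  point of \<open>A0\<close> can leave \<open>A\<close> only through these losses.\<close>

lemma shift_continuous_domain:
  assumes A: "A \<in> sets borel" "periodic \<Lambda> (\<lambda>x. x \<in> A)"
  shows "((\<lambda>y. measure \<nu> {x \<in> A. x + y \<notin> A}) \<longlongrightarrow> 0) (nhds 0)"
proof (rule tendstoI)
  fix \<epsilon> :: real assume \<epsilon>: "\<epsilon> > 0"
  \<comment> \<open>Two losses of at most \<open>\<delta>\<close>, divided by \<open>vol\<close>,
    add up to \<epsilon>/2.\<close>
  define \<delta> where "\<delta> = \<epsilon> * vol / 4"
  have \<delta>: "\<delta> > 0" using \<epsilon> vol_pos by (simp add: \<delta>_def)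
  define A0 where "A0 = A \<inter> Q"
  have A0: "A0 \<in> sets borel" using A(1) Q_borel by (simp add: A0_def)
  have A0_fin: "emeasure \<mu> A0 < \<infinity>"
    using emeasure_mono[of A0 Q \<mu>] Q_sets Q_finite by (auto simp: A0_def less_top[symmetric] top_unique)
  obtain U where U: "open U" "A0 \<subseteq> U" "emeasure \<mu> U < emeasure \<mu> A0 + ennreal \<delta>"
    using INF_approx_ennreal[OF \<delta> haar_outer_regular[OF A0]] A0_fin by (auto simp: less_top)
  then have U_fin: "emeasure \<mu> U < \<infinity>"
    using A0_fin by (metis ennreal_add_less_top ennreal_less_top infinity_ennreal_def less_trans)
  \<comment> \<open>\<open>C\<close> approximates \<open>U\<close> and need not lie in
    \<open>A0\<close>: inner regularity is available for open sets.\<close>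
  obtain C where C: "compact C" "C \<subseteq> U" "emeasure \<mu> U < emeasure \<mu> C + ennreal \<delta>"
    using SUP_approx_ennreal[OF \<delta> _ haar_inner_regular[OF U(1)]] U_fin by (auto simp: less_top)
  have C_borel: "C \<in> sets borel" using C(1) by (intro borel_closed compact_imp_closed)
  have U_borel: "U \<in> sets borel" using U(1) by (rule borel_open)
  have small: "emeasure \<mu> (U - B) \<le> ennreal \<delta>"
    if "B \<in> sets borel" "B \<subseteq> U" "emeasure \<mu> U < emeasure \<mu> B + ennreal \<delta>" for B
  proof -
    have "emeasure \<mu> B + emeasure \<mu> (U - B) = emeasure \<mu> U"
      using that U_borel by (subst plus_emeasure) (auto simp: sets_haar Un_absorb1)
    then have "emeasure \<mu> B + emeasure \<mu> (U - B) \<le> emeasure \<mu> B + ennreal \<delta>" using that(3) by simp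
    moreover have "emeasure \<mu> B < \<infinity>"
      using emeasure_mono[of B U \<mu>] that(2) U_borel U_fin by (auto simp: sets_haar intro: le_less_trans)
    ultimately show ?thesis by (auto simp: ennreal_add_left_cancel_le)
  qed
  have op: "open ((\<lambda>p. snd p + fst p) -` U)" by (intro open_vimage U continuous_intros)
  have sub: "{0} \<times> C \<subseteq> (\<lambda>p. snd p + fst p) -` U" using C(2) by auto
  obtain W where W: "0 \<in> W" "open W" "W \<times> C \<subseteq> (\<lambda>p. snd p + fst p) -` U"
    using Elementary_Topology.tube_lemma[OF C(1) op sub] by (elim exE conjE)
  have "measure \<nu> {x \<in> A. x + w \<notin> A} < \<epsilon>" if w: "w \<in> W" for w
  proof -
    let ?S = "{x \<in> A. x + w \<notin> A}"
    have S: "?S \<in> sets borel"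
      using sets.Diff[OF A(1) sets_shift[OF A(1), of w]] by (simp add: set_diff_eq)
    have sh: "{x. x + w \<in> U - A0} \<in> sets borel" using U_borel A0 by (intro sets_shift) auto
    \<comment> \<open>A point outside \<open>C\<close> lies in \<open>U - C\<close>; a point of
      \<open>C\<close> is moved into \<open>U\<close>, but not into \<open>A\<close>, hence into
      \<open>U - A0\<close>.\<close>
    have "Q \<inter> ?S \<subseteq> (U - C) \<union> {x. x + w \<in> U - A0}"
      using W(3) w U(2) by (auto simp: A0_def)
    then have "emeasure \<mu> (Q \<inter> ?S) \<le> emeasure \<mu> ((U - C) \<union> {x. x + w \<in> U - A0})"
      using sh U_borel C_borel by (intro emeasure_mono) (auto simp: sets_haar)
    also have "\<dots> \<le> emeasure \<mu> (U - C) + emeasure \<mu> {x. x + w \<in> U - A0}"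
      using sh U_borel C_borel by (intro emeasure_subadditive) (auto simp: sets_haar)
    also have "emeasure \<mu> {x. x + w \<in> U - A0} = emeasure \<mu> (U - A0)"
      using U_borel A0 by (intro emeasure_haar_shift) auto
    also have "emeasure \<mu> (U - C) + emeasure \<mu> (U - A0) \<le> ennreal \<delta> + ennreal \<delta>"
      by (intro add_mono small C U C_borel A0)
    finally have "emeasure \<mu> (Q \<inter> ?S) \<le> ennreal (2 * \<delta>)" using \<delta> by (simp flip: ennreal_plus)
    then have "measure \<mu> (Q \<inter> ?S) \<le> 2 * \<delta>" using \<delta> by (simp add: measure_def enn2real_leI)
    then have "measure \<nu> ?S \<le> 2 * \<delta> / vol"
      using S Q_nonzero Q_finite vol_pos by (simp add: \<nu>_def sets_haar vol_def divide_right_mono)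
    also have "\<dots> < \<epsilon>" using vol_pos \<epsilon> by (simp add: \<delta>_def)
    finally show ?thesis .
  qed
  then show "\<forall>\<^sub>F y in nhds 0. dist (measure \<nu> {x \<in> A. x + y \<notin> A}) 0 < \<epsilon>"
    unfolding eventually_nhds using W by (intro exI[of _ W]) auto
qed

sublocale periodic_haar \<nu> \<Lambda>
proof
  show "sets \<nu> = sets borel" by (rule sets_\<nu>)
  show "emeasure \<nu> UNIV = 1"
    using Q_nonzero Q_finite by (simp add: \<nu>_def Q_borel sets_haar ennreal_divide_self less_top)
  show "(\<integral>\<^sup>+x. f (x + y) \<partial>\<nu>) = (\<integral>\<^sup>+x. f x \<partial>\<nu>)"
    if f: "f \<in> borel_measurable borel" "periodic \<Lambda> f" for f :: "'a \<Rightarrow> ennreal" and y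
    unfolding \<nu>_def
    using f measurable_shift[OF f(1), of y] nn_integral_domain_shift[OF f, of y]
    by (simp add: nn_integral_uniform_measure measurable_haar Q_sets)
qed (simp_all add: lattice_zero lattice_add lattice_minus shift_continuous_domain)

lemma \<nu>_density: "\<nu> = density \<mu> (\<lambda>x. ennreal (indicator Q x / vol))"
  unfolding \<nu>_def uniform_measure_def emeasure_Q
proof (rule density_cong)
  have [measurable]: "Q \<in> sets \<mu>" by (rule Q_sets)
  show "(\<lambda>x. indicator Q x / ennreal vol) \<in> borel_measurable \<mu>"
    "(\<lambda>x. ennreal (indicator Q x / vol)) \<in> borel_measurable \<mu>" by measurable
  show "AE x in \<mu>. indicator Q x / ennreal vol = ennreal (indicator Q x / vol)"
    using vol_pos by (auto simp: divide_ennreal[symmetric] ennreal_indicator)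
qed

lemma integral_\<nu>:
  fixes f :: "'a \<Rightarrow> complex"
  assumes "f \<in> borel_measurable borel"
  shows "(LINT x|\<nu>. f x) = (LINT x|\<mu>. indicator Q x * f x) / of_real vol"
proof -
  have "(LINT x|\<nu>. f x) = (LINT x|\<mu>. (indicator Q x / vol) *\<^sub>R f x)"
    unfolding \<nu>_density using vol_pos assms Q_borel
    by (intro integral_density) (auto simp: measurable_haar)
  also have "\<dots> = (LINT x|\<mu>. (indicator Q x * f x) / of_real vol)"
    by (intro Bochner_Integration.integral_cong refl) (simp add: scaleR_conv_of_real indicator_def)
  finally show ?thesis by simp
qed

lemma integrable_\<nu>:
  fixes f :: "'a \<Rightarrow> real"
  assumes "f \<in> borel_measurable borel" "integrable \<mu> (\<lambda>x. indicator Q x * f x)"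
  shows "integrable \<nu> f"
proof -
  have "integrable \<mu> (\<lambda>x. (indicator Q x * f x) / vol)" using assms(2) by simp
  then have "integrable \<mu> (\<lambda>x. (indicator Q x / vol) *\<^sub>R f x)" by simp
  then show ?thesis
    unfolding \<nu>_density using vol_pos assms(1) Q_borel
    by (subst integrable_density) (auto simp: measurable_haar)
qed

text \<open>The indices enter as \<open>-\<alpha>\<close> and \<open>-\<beta>\<close>, which makes the coefficients below symmetric.\<close>

definition basis :: "'a \<times> ('a \<Rightarrow> complex) \<Rightarrow> 'a \<Rightarrow> complex" where
  "basis = (\<lambda>(\<alpha>, \<beta>) x. of_real (1 / sqrt vol) * (cnj (\<beta> x) * indicator Q (x + \<alpha>)))"

section \<open>Orthonormality and completeness of \<open>basis\<close>\<close>

lemma indicator_shift_borel: "(\<lambda>x. indicator Q (x + \<alpha>) :: complex) \<in> borel_measurable borel"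
  by (rule measurable_shift[OF borel_measurable_indicator[OF Q_borel]])

lemma basis_borel: "\<beta> \<in> annihilator \<Lambda> \<Longrightarrow> basis (\<alpha>, \<beta>) \<in> borel_measurable borel"
  unfolding basis_def prod.case
  by (intro borel_measurable_times borel_measurable_const indicator_shift_borel
      measurable_compose[OF annihilatorD(6) cnj_borel])

lemma basis_L2:
  assumes "\<beta> \<in> annihilator \<Lambda>"
  shows "basis (\<alpha>, \<beta>) \<in> L2 \<mu>"
proof -
  have "(cmod (basis (\<alpha>, \<beta>) x))\<^sup>2 = (1 / vol) * indicator Q (x + \<alpha>)" for x
    using vol_pos annihilatorD(2)[OF assms, of x]
    by (simp add: basis_def norm_mult indicator_def power_divide norm_divide)
  moreover have "integrable \<mu> (\<lambda>x. indicator Q (x + \<alpha>) :: real)"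
    by (rule integrable_haar_shift) (use Q_sets Q_finite in \<open>auto simp: less_top\<close>)
  ultimately show ?thesis
    using basis_borel[OF assms] by (simp add: L2_iff measurable_haar)
qed

lemma cnj_annihilator:
  assumes "\<kappa> \<in> annihilator \<Lambda>"
  shows "(\<lambda>x. cnj (\<kappa> x)) \<in> annihilator \<Lambda>"
  using assms by (auto simp: annihilator_def dual_group_def intro!: continuous_intros)

lemma basis_inner:
  assumes f: "f \<in> borel_measurable borel" and \<beta>: "\<beta> \<in> annihilator \<Lambda>"
  shows "l2_inner \<mu> f (basis (\<alpha>, \<beta>)) =
    of_real (1 / sqrt vol) * (LINT x|\<mu>. f x * \<beta> x * indicator Q (x + \<alpha>))"
proof -
  have "f x * cnj (basis (\<alpha>, \<beta>) x) = of_real (1 / sqrt vol) * (f x * \<beta> x * indicator Q (x + \<alpha>))" for x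
    by (simp add: basis_def indicator_def)
  then show ?thesis unfolding l2_inner_def by simp
qed

text \<open>Different lattice points give disjoint supports, since each coset meets \<open>Q\<close>
  once. For equal ones a shift by \<open>\<alpha>\<close> reduces the claim to orthonormality of
  characters over \<open>Q\<close>.\<close>

lemma basis_orthonormal: "l2_orthonormal \<mu> (\<Lambda> \<times> annihilator \<Lambda>) basis"
  unfolding l2_orthonormal_def
proof (intro conjI ballI)
  fix i j assume ij: "i \<in> \<Lambda> \<times> annihilator \<Lambda>" "j \<in> \<Lambda> \<times> annihilator \<Lambda>"
  obtain \<alpha> \<beta> \<alpha>' \<beta>' where eq: "i = (\<alpha>, \<beta>)" "j = (\<alpha>', \<beta>')" by (cases i, cases j)
  then have m: "\<alpha> \<in> \<Lambda>" "\<beta> \<in> annihilator \<Lambda>" "\<alpha>' \<in> \<Lambda>" "\<beta>' \<in> annihilator \<Lambda>" using ij by auto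
  note D = annihilatorD[OF m(2)] and D' = annihilatorD[OF m(4)]
  define c where "c = complex_of_real (1 / sqrt vol)"
  have cc: "c * c = 1 / of_real vol"
    using vol_pos by (simp add: c_def flip: of_real_mult)
  have "l2_inner \<mu> (basis (\<alpha>, \<beta>)) (basis (\<alpha>', \<beta>')) =
      c * (LINT x|\<mu>. c * (cnj (\<beta> x) * indicator Q (x + \<alpha>)) * \<beta>' x * indicator Q (x + \<alpha>'))"
    unfolding basis_inner[OF basis_borel[OF m(2)] m(4)] by (simp add: basis_def c_def)
  also have "\<dots> = c * c * (LINT x|\<mu>. cnj (\<beta> x) * \<beta>' x * (indicator Q (x + \<alpha>) * indicator Q (x + \<alpha>')))"
    by (simp add: mult_ac flip: integral_mult_right_zero)
  also have "\<dots> = (if i = j then 1 else 0)"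
  proof (cases "\<alpha> = \<alpha>'")
    case False
    then have "indicator Q (x + \<alpha>) * indicator Q (x + \<alpha>') = (0 :: complex)" for x
      using Q_unique[of x] m by (auto simp: indicator_def)
    then have "cnj (\<beta> x) * \<beta>' x * (indicator Q (x + \<alpha>) * indicator Q (x + \<alpha>')) = 0" for x
      by (simp only: mult_zero_right)
    then have "(LINT x|\<mu>. cnj (\<beta> x) * \<beta>' x * (indicator Q (x + \<alpha>) * indicator Q (x + \<alpha>'))) = 0"
      by (simp only: Bochner_Integration.integral_zero)
    then show ?thesis using False eq by simp
  next
    case True
    have meas: "(\<lambda>x. \<beta>' x * cnj (\<beta> x)) \<in> borel_measurable borel"
      by (intro borel_measurable_times D' measurable_compose[OF D(6) cnj_borel])
    have "(LINT x|\<mu>. cnj (\<beta> x) * \<beta>' x * (indicator Q (x + \<alpha>) * indicator Q (x + \<alpha>')))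
        = (LINT x|\<mu>. indicator Q (x + \<alpha>) * (\<beta>' (x + \<alpha>) * cnj (\<beta> (x + \<alpha>))))"
      using periodicD[OF D(5) m(1)] periodicD[OF D'(5) m(1)] True
      by (intro Bochner_Integration.integral_cong refl) (auto simp: indicator_def)
    also have "\<dots> = (LINT x|\<mu>. indicator Q x * (\<beta>' x * cnj (\<beta> x)))"
      by (rule integral_haar_shift[of "\<lambda>x. indicator Q x * (\<beta>' x * cnj (\<beta> x))"])
        (intro borel_measurable_times meas borel_measurable_indicator Q_borel)
    also have "\<dots> = of_real vol * l2_inner \<nu> \<beta>' \<beta>"
      using vol_pos by (simp add: l2_inner_def integral_\<nu>[OF meas])
    finally show ?thesis
      using cc vol_pos True eq l2_orthonormalD(2)[OF characters_orthonormal m(4,2)] by auto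
  qed
  finally show "l2_inner \<mu> (basis i) (basis j) = (if i = j then 1 else 0)" by (simp add: eq)
qed (auto intro: basis_L2)

text \<open>The Borel section of the quotient map with values in \<open>Q\<close>; composing with it
  makes any function periodic without changing it on \<open>Q\<close>.\<close>

definition rep :: "'a \<Rightarrow> 'a" where
  "rep x = x + (THE l. l \<in> \<Lambda> \<and> x + l \<in> Q)"

lemma rep_eq: "l \<in> \<Lambda> \<Longrightarrow> x + l \<in> Q \<Longrightarrow> rep x = x + l"
  unfolding rep_def using the1_equality[OF Q_unique[of x]] by auto

lemma rep_id: "x \<in> Q \<Longrightarrow> rep x = x"
  using rep_eq[of 0 x] lattice_zero by simp

lemma rep_periodic: "periodic \<Lambda> rep"
  unfolding periodic_def
proof (intro allI ballI)
  fix x l assume l: "l \<in> \<Lambda>"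
  obtain m where m: "m \<in> \<Lambda>" "x + m \<in> Q" using Q_unique[of x] by blast
  have "x + l + (m - l) = x + m" by (simp add: algebra_simps)
  then show "rep (x + l) = rep x"
    using rep_eq[OF m] rep_eq[of "m - l" "x + l"] m lattice_diff[OF m(1) l] by simp
qed

lemma rep_borel: "rep \<in> borel_measurable borel"
proof (rule measurableI)
  fix B :: "'a set" assume B: "B \<in> sets borel"
  have "rep -` B = (\<Union>l\<in>\<Lambda>. {x. x + l \<in> Q \<inter> B})"
  proof (intro equalityI subsetI)
    fix x assume "x \<in> rep -` B"
    moreover obtain m where "m \<in> \<Lambda>" "x + m \<in> Q" using Q_unique[of x] by blast
    ultimately show "x \<in> (\<Union>l\<in>\<Lambda>. {x. x + l \<in> Q \<inter> B})" using rep_eq[of m x] by auto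
  qed (auto simp: rep_eq)
  then show "rep -` B \<inter> space borel \<in> sets borel"
    using B Q_borel by (auto intro!: sets.countable_UN' countable_lattice sets_shift)
qed simp

text \<open>For each \<open>\<alpha>\<close>, the part of \<open>f\<close> on the translate of
  \<open>Q\<close> by \<open>- \<alpha>\<close> is moved to \<open>Q\<close> and extended
  periodically. Orthogonality to the basis elements indexed by \<open>\<alpha>\<close> and
  \<open>cnj \<kappa>\<close> is orthogonality of this extension to \<open>\<kappa>\<close>, so it
  vanishes; countably many translates exhaust the group.\<close>

lemma basis_total:
  assumes f: "f \<in> L2 \<mu>" and orth: "\<And>i. i \<in> \<Lambda> \<times> annihilator \<Lambda> \<Longrightarrow> l2_inner \<mu> f (basis i) = 0"
  shows "l2_norm \<mu> f = 0"
proof -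
  have f_borel: "f \<in> borel_measurable borel" using f by (simp add: L2_iff measurable_haar)
  have "AE x in \<mu>. x + \<alpha> \<in> Q \<longrightarrow> f x = 0" if \<alpha>: "\<alpha> \<in> \<Lambda>" for \<alpha>
  proof -
    define g where "g x = f (rep x + - \<alpha>)" for x
    have g_Q: "g x = f (x + - \<alpha>)" if "x \<in> Q" for x using that by (simp add: g_def rep_id)
    have g_borel: "g \<in> borel_measurable borel"
      unfolding g_def by (rule measurable_compose[OF rep_borel measurable_shift[OF f_borel]])
    have "integrable \<nu> (\<lambda>x. (cmod (g x))\<^sup>2)"
    proof (rule integrable_\<nu>)
      have "integrable \<mu> (\<lambda>x. indicator Q x * (cmod (f (x + - \<alpha>)))\<^sup>2)"
        using integrable_real_mult_indicator[OF Q_sets integrable_haar_shift[OF L2_square_integrable[OF f], of "- \<alpha>"]]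
        by (simp add: mult.commute)
      then show "integrable \<mu> (\<lambda>x. indicator Q x * (cmod (g x))\<^sup>2)"
        by (rule Bochner_Integration.integrable_cong[THEN iffD1, rotated -1]) (auto simp: g_Q indicator_def)
    qed (use g_borel in measurable)
    then have gP: "g \<in> P2"
      using g_borel periodic_compose[OF rep_periodic, of "\<lambda>x. f (x + - \<alpha>)"]
      by (simp add: P2_def L2_iff measurable_eq g_def[abs_def])
    have "l2_inner \<nu> g \<kappa> = 0" if \<kappa>: "\<kappa> \<in> annihilator \<Lambda>" for \<kappa>
    proof -
      note D = annihilatorD[OF \<kappa>]
      let ?F = "\<lambda>x. f x * cnj (\<kappa> x) * indicator Q (x + \<alpha>)"
      have meas: "(\<lambda>x. g x * cnj (\<kappa> x)) \<in> borel_measurable borel"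
        by (intro borel_measurable_times g_borel measurable_compose[OF D(6) cnj_borel])
      have F: "?F \<in> borel_measurable borel"
        by (intro borel_measurable_times f_borel measurable_compose[OF D(6) cnj_borel] indicator_shift_borel)
      have "(LINT x|\<mu>. indicator Q x * (g x * cnj (\<kappa> x))) = (LINT x|\<mu>. ?F (x + - \<alpha>))"
        using periodicD[OF D(5) lattice_minus[OF \<alpha>]]
        by (intro Bochner_Integration.integral_cong refl) (auto simp: g_Q indicator_def)
      also have "\<dots> = (LINT x|\<mu>. ?F x)" by (rule integral_haar_shift[OF F])
      also have "\<dots> = 0"
        using orth[of "(\<alpha>, \<lambda>x. cnj (\<kappa> x))"] \<alpha> cnj_annihilator[OF \<kappa>] vol_pos
        by (simp add: basis_inner[OF f_borel cnj_annihilator[OF \<kappa>]])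
      finally show ?thesis by (simp add: l2_inner_def integral_\<nu>[OF meas])
    qed
    then have "l2_norm \<nu> g = 0" by (rule characters_total[OF gP])
    then have "AE x in \<nu>. g x = 0" using l2_norm_eq_0_iff[OF P2_L2[OF gP]] by simp
    then have "AE x in \<mu>. x \<in> Q \<longrightarrow> g x = 0"
      unfolding \<nu>_def using Q_nonzero Q_finite by (simp add: AE_uniform_measure less_top)
    then have "AE x in \<mu>. x + \<alpha> \<in> Q \<longrightarrow> g (x + \<alpha>) = 0" by (rule AE_haar_shift)
    then show ?thesis by (auto elim!: eventually_mono simp: g_Q)
  qed
  then have "AE x in \<mu>. \<forall>\<alpha>\<in>\<Lambda>. x + \<alpha> \<in> Q \<longrightarrow> f x = 0"
    by (intro AE_ball_countable' countable_lattice)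
  then have "AE x in \<mu>. f x = 0"
  proof eventually_elim
    case (elim x)
    then show ?case using Q_unique[of x] by blast
  qed
  then show ?thesis using l2_norm_eq_0_iff[OF f] by simp
qed

lemma basis_orthonormal_basis: "orthonormal_basis \<mu> (\<Lambda> \<times> annihilator \<Lambda>) basis"
  by (rule orthonormal_basis_of_total[OF basis_orthonormal basis_total])

section \<open>Gabor coefficients and the R-dual\<close>

lemma gabor_L2:
  assumes f: "f \<in> L2 \<mu>" and \<beta>: "\<beta> \<in> annihilator \<Lambda>"
  shows "gabor f (\<alpha>, \<beta>) \<in> L2 \<mu>"
proof -
  note D = annihilatorD[OF \<beta>]
  have f_borel: "f \<in> borel_measurable borel" using f by (simp add: L2_iff measurable_haar)
  have eq: "gabor f (\<alpha>, \<beta>) = (\<lambda>x. \<beta> x * f (x + - \<alpha>))"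
    by (simp add: gabor_def modulation_def translation_def)
  have "integrable \<mu> (\<lambda>x. (cmod (f (x + - \<alpha>)))\<^sup>2)"
    by (rule integrable_haar_shift[OF L2_square_integrable[OF f]])
  then show ?thesis
    using borel_measurable_times[OF D(6) measurable_shift[OF f_borel, of "- \<alpha>"]]
    by (simp add: L2_iff eq norm_mult D(2) measurable_haar)
qed

text \<open>\<open>E\<^sub>\<gamma> T\<^sub>\<lambda>\<close> commutes with \<open>E\<^sub>\<beta> T\<^sub>\<alpha>\<close>, which is why these coefficients are symmetric.\<close>

lemma gabor_basis_symmetric:
  assumes f: "f \<in> L2 \<mu>" and m: "\<alpha> \<in> \<Lambda>" "\<beta> \<in> annihilator \<Lambda>" "\<delta> \<in> \<Lambda>" "\<gamma> \<in> annihilator \<Lambda>"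
  shows "l2_inner \<mu> (gabor f (\<delta>, \<gamma>)) (basis (\<alpha>, \<beta>)) = l2_inner \<mu> (gabor f (\<alpha>, \<beta>)) (basis (\<delta>, \<gamma>))"
proof -
  have f_borel: "f \<in> borel_measurable borel" using f by (simp add: L2_iff measurable_haar)
  \<comment> \<open>Shifting by \<open>\<delta>\<close>, under which both characters are unchanged,
    leaves an integral that sees the two index pairs only through \<open>\<alpha> + \<delta>\<close>
    and \<open>\<beta> x * \<gamma> x\<close>.\<close>
  have main: "l2_inner \<mu> (gabor f (\<delta>, \<gamma>)) (basis (\<alpha>, \<beta>)) =
      of_real (1 / sqrt vol) * (LINT x|\<mu>. f x * (\<beta> x * \<gamma> x) * indicator Q (x + (\<alpha> + \<delta>)))"
    if m: "\<alpha> \<in> \<Lambda>" "\<beta> \<in> annihilator \<Lambda>" "\<delta> \<in> \<Lambda>" "\<gamma> \<in> annihilator \<Lambda>" for \<alpha> \<beta> \<delta> \<gamma>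
  proof -
    note D = annihilatorD[OF m(2)] and D' = annihilatorD[OF m(4)]
    let ?F = "\<lambda>x. f x * (\<beta> x * \<gamma> x) * indicator Q (x + (\<alpha> + \<delta>))"
    have F: "?F \<in> borel_measurable borel"
      by (intro borel_measurable_times f_borel D D' indicator_shift_borel)
    have g: "gabor f (\<delta>, \<gamma>) \<in> borel_measurable borel"
      using gabor_L2[OF f m(4)] by (simp add: L2_iff measurable_haar)
    have "gabor f (\<delta>, \<gamma>) x * \<beta> x * indicator Q (x + \<alpha>) = ?F (x + - \<delta>)" for x
      using periodicD[OF D(5) lattice_minus[OF m(3)], of x] periodicD[OF D'(5) lattice_minus[OF m(3)], of x]
      by (simp add: gabor_def modulation_def translation_def algebra_simps)
    then show ?thesis
      unfolding basis_inner[OF g m(2)] by (simp only: integral_haar_shift[OF F])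
  qed
  show ?thesis
    unfolding main[OF m] main[OF m(3,4,1,2)] by (simp add: mult.commute add.commute)
qed

text \<open>Summing squared coefficients in two ways shows that no orthonormal family is larger than a finite
  orthonormal basis; disjoint translates of a small open set form arbitrarily large ones.\<close>

lemma index_infinite:
  assumes inf: "infinite (UNIV :: 'a set)"
  shows "infinite (\<Lambda> \<times> annihilator \<Lambda>)"
proof
  let ?I = "\<Lambda> \<times> annihilator \<Lambda>"
  assume fin: "finite ?I"
  obtain D :: "'a set" where D: "finite D" "card D = Suc (card ?I)"
    using infinite_arbitrarily_large[OF inf] by blast
  \<comment> \<open>Excluding the nonzero differences of points of \<open>D\<close> makes the
    translates of \<open>V\<close> by points of \<open>D\<close> disjoint.\<close>
  let ?T = "- ((\<lambda>(d, d'). d - d') ` (D \<times> D) - {0})"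
  have T: "open ?T" "0 \<in> ?T"
    using D(1) by (intro open_Compl finite_imp_closed finite_Diff finite_imageI finite_cartesian_product) simp_all
  obtain V where V: "open V" "0 \<in> V" "\<And>u v. u \<in> V \<Longrightarrow> v \<in> V \<Longrightarrow> u - v \<in> ?T"
    by (rule difference_neighbourhood[OF T]) blast
  obtain U K :: "'a set" where U: "open U" "0 \<in> U" "compact K" "U \<subseteq> K"
    by (rule separating_neighbourhood)
  define W where "W = V \<inter> U"
  have W: "open W" "0 \<in> W" using V U by (auto simp: W_def)
  have W_borel: "W \<in> sets borel" using W(1) by (rule borel_open)
  have W_fin: "emeasure \<mu> W < \<infinity>"
    using emeasure_mono[of W K \<mu>] haar_compact_finite[OF U(3)] U(3,4)
    by (auto simp: W_def sets_haar intro!: borel_closed compact_imp_closed intro: le_less_trans)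
  \<comment> \<open>A null \<open>W\<close> would have a saturation that is null for
    \<open>\<mu>\<close>, hence for \<open>\<nu>\<close>, against
    \<open>open_positive\<close>.\<close>
  have W_pos: "emeasure \<mu> W \<noteq> 0"
  proof
    assume "emeasure \<mu> W = 0"
    then have "(\<Union>l\<in>\<Lambda>. {x. x + l \<in> W}) \<in> null_sets \<mu>"
      using W_borel by (intro null_sets_UN' countable_lattice)
        (auto simp: null_sets_def sets_haar sets_shift emeasure_haar_shift)
    also have "(\<Union>l\<in>\<Lambda>. {x. x + l \<in> W}) = {x. \<exists>l\<in>\<Lambda>. x + l \<in> W}" by auto
    finally have N: "{x. \<exists>l\<in>\<Lambda>. x + l \<in> W} \<in> null_sets \<mu>" .
    then have "emeasure \<mu> (Q \<inter> {x. \<exists>l\<in>\<Lambda>. x + l \<in> W}) = 0"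
      using null_set_Int1[OF N Q_sets] by (simp add: null_setsD1)
    then have "emeasure \<nu> {x. \<exists>l\<in>\<Lambda>. x + l \<in> W} = 0"
      using N Q_sets by (simp add: \<nu>_def null_setsD2)
    with open_positive[OF W] show False by simp
  qed
  define w where "w = measure \<mu> W"
  have w: "w > 0" "emeasure \<mu> W = ennreal w"
    using W_pos W_fin by (auto simp: w_def emeasure_eq_ennreal_measure less_top zero_less_measure_iff)
  define a where "a d x = (of_real (1 / sqrt w) * indicator W (x + - d) :: complex)" for d x
  have meas_ind: "(\<lambda>x. indicator W (x + - d) :: complex) \<in> borel_measurable borel" for d
    by (rule measurable_shift[OF borel_measurable_indicator[OF W_borel]])
  have int_W: "(LINT x|\<mu>. indicator W (x + - d)) = w" "integrable \<mu> (\<lambda>x. indicator W (x + - d) :: real)" for d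
  proof -
    show "(LINT x|\<mu>. indicator W (x + - d)) = w"
      using W_borel by (subst integral_haar_shift) (simp_all add: sets_haar w_def space_haar)
    show "integrable \<mu> (\<lambda>x. indicator W (x + - d) :: real)"
      using W_borel W_fin by (intro integrable_haar_shift integrable_real_indicator) (auto simp: sets_haar)
  qed
  have a_sq: "(cmod (a d x))\<^sup>2 = (1 / w) * indicator W (x + - d)" for d x
    using w by (simp add: a_def norm_mult indicator_def norm_divide power_divide)
  have a_L2: "a d \<in> L2 \<mu>" for d
    unfolding L2_iff a_sq measurable_haar
  proof
    show "a d \<in> borel_measurable borel"
      unfolding a_def by (intro borel_measurable_times borel_measurable_const meas_ind)
  qed (intro Bochner_Integration.integrable_mult_right int_W(2))
  have a_norm: "(l2_norm \<mu> (a d))\<^sup>2 = 1" for d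
    using int_W(1)[of d] w(1) by (simp add: l2_norm_power2 a_sq)
  have a_on: "l2_orthonormal \<mu> D a"
    unfolding l2_orthonormal_def
  proof (intro conjI ballI a_L2)
    fix d d' assume d: "d \<in> D" "d' \<in> D"
    show "l2_inner \<mu> (a d) (a d') = (if d = d' then 1 else 0)"
    proof (cases "d = d'")
      case True
      then show ?thesis by (simp add: l2_inner_self a_norm del: of_real_power)
    next
      case False
      have "a d x * cnj (a d' x) = 0" for x
      proof (rule ccontr)
        assume "a d x * cnj (a d' x) \<noteq> 0"
        then have "x + - d' \<in> V" "x + - d \<in> V" by (auto simp: a_def indicator_def W_def split: if_splits)
        then have "(x + - d') - (x + - d) \<in> ?T" by (rule V(3))
        moreover have "(x + - d') - (x + - d) = d - d'" by simp
        ultimately show False using d False by force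
      qed
      then have "l2_inner \<mu> (a d) (a d') = 0"
        unfolding l2_inner_def by (simp only: Bochner_Integration.integral_zero)
      then show ?thesis using False by simp
    qed
  qed
  note on = basis_orthonormal
  \<comment> \<open>The lower half of Parseval's identity, from density: an approximation within
    \<open>sqrt \<epsilon>\<close> loses at most \<open>\<epsilon>\<close> in squared norm.\<close>
  have "1 \<le> (\<Sum>i\<in>?I. (cmod (l2_inner \<mu> (a d) (basis i)))\<^sup>2)" for d
  proof (rule field_le_epsilon)
    fix \<epsilon> :: real assume \<epsilon>: "\<epsilon> > 0"
    then have \<epsilon>': "0 < sqrt \<epsilon>" by simp
    obtain F c where F: "finite F" "F \<subseteq> ?I" and lt: "l2_norm \<mu> (\<lambda>x. a d x - (\<Sum>i\<in>F. c i * basis i x)) < sqrt \<epsilon>"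
      using basis_orthonormal_basis[unfolded orthonormal_basis_def, THEN conjunct2, THEN conjunct2,
          rule_format, OF a_L2 \<epsilon>', of d] by (elim exE conjE)
    have "(l2_norm \<mu> (\<lambda>x. a d x - (\<Sum>i\<in>F. c i * basis i x)))\<^sup>2 \<le> (sqrt \<epsilon>)\<^sup>2"
      by (intro power_mono less_imp_le[OF lt] l2_norm_nonneg)
    then have "1 - (\<Sum>i\<in>F. (cmod (l2_inner \<mu> (a d) (basis i)))\<^sup>2) \<le> \<epsilon>"
      using \<epsilon> sum_nonneg[of F "\<lambda>i. (cmod (c i - l2_inner \<mu> (a d) (basis i)))\<^sup>2"]
      unfolding l2_norm_diff_combination[OF on F a_L2] a_norm by simp
    moreover have "(\<Sum>i\<in>F. (cmod (l2_inner \<mu> (a d) (basis i)))\<^sup>2) \<le> (\<Sum>i\<in>?I. (cmod (l2_inner \<mu> (a d) (basis i)))\<^sup>2)"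
      by (rule sum_mono2[OF fin F(2)]) simp
    ultimately show "1 \<le> (\<Sum>i\<in>?I. (cmod (l2_inner \<mu> (a d) (basis i)))\<^sup>2) + \<epsilon>" by linarith
  qed
  then have "(\<Sum>d\<in>D. 1) \<le> (\<Sum>d\<in>D. \<Sum>i\<in>?I. (cmod (l2_inner \<mu> (a d) (basis i)))\<^sup>2)"
    by (intro sum_mono)
  also have "\<dots> = (\<Sum>i\<in>?I. \<Sum>d\<in>D. (cmod (l2_inner \<mu> (basis i) (a d)))\<^sup>2)"
    by (subst sum.swap) (intro sum.cong refl, subst l2_inner_commute, simp)
  also have "\<dots> \<le> (\<Sum>i\<in>?I. 1)"
  proof (rule sum_mono)
    fix i assume i: "i \<in> ?I"
    have "complex_of_real ((l2_norm \<mu> (basis i))\<^sup>2) = 1"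
      using l2_orthonormalD(2)[OF on i i] by (simp only: l2_inner_self) simp
    then have "(l2_norm \<mu> (basis i))\<^sup>2 = 1" by (simp only: of_real_eq_1_iff)
    then show "(\<Sum>d\<in>D. (cmod (l2_inner \<mu> (basis i) (a d)))\<^sup>2) \<le> 1"
      using l2_Bessel[OF a_on D(1) subset_refl l2_orthonormalD(1)[OF on i]] by simp
  qed
  finally show False using D(2) by simp
qed

text \<open>By symmetry, for fixed \<open>j\<close> the coefficients of the whole system at
  \<open>basis j\<close> are the Fourier coefficients of the single vector \<open>gabor f j\<close>.
  Square summability is then Bessel's inequality for that vector.\<close>

lemma gabor_is_R_dual:
  assumes inf: "infinite (UNIV :: 'a set)" and f: "f \<in> L2 \<mu>"
  shows "is_R_dual \<mu> (\<Lambda> \<times> annihilator \<Lambda>) (\<Lambda> \<times> annihilator \<Lambda>) (gabor f) basis basis (gabor f)"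
proof -
  let ?I = "\<Lambda> \<times> annihilator \<Lambda>"
  have sym: "l2_inner \<mu> (gabor f i) (basis j) = l2_inner \<mu> (gabor f j) (basis i)" if "i \<in> ?I" "j \<in> ?I" for i j
    using that gabor_basis_symmetric[OF f] by auto
  have L2: "gabor f j \<in> L2 \<mu>" if "j \<in> ?I" for j using that gabor_L2[OF f] by auto
  have "(\<lambda>i. (cmod (l2_inner \<mu> (gabor f i) (basis j)))\<^sup>2) summable_on ?I" if j: "j \<in> ?I" for j
    using l2_Bessel_summable[OF basis_orthonormal L2[OF j]]
    by (rule summable_on_cong[THEN iffD1, rotated]) (simp add: sym[OF _ j])
  moreover have "l2_has_sum \<mu> (\<lambda>i x. l2_inner \<mu> (gabor f i) (basis j) * basis i x) ?I (gabor f j)"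
    if j: "j \<in> ?I" for j
  proof -
    have eq: "(\<Sum>i\<in>F. l2_inner \<mu> (gabor f j) (basis i) * basis i x) = (\<Sum>i\<in>F. l2_inner \<mu> (gabor f i) (basis j) * basis i x)"
      if "F \<subseteq> ?I" for F x
      using that by (intro sum.cong refl) (auto simp: sym[OF _ j])
    \<comment> \<open>Symmetry is available for indices in \<open>?I\<close> only, so the partial
      sums are exchanged eventually along the filter, where \<open>F\<close> is a subset of
      \<open>?I\<close>.\<close>
    have "\<forall>\<^sub>F F in finite_subsets_at_top ?I.
        l2_norm \<mu> (\<lambda>x. gabor f j x - (\<Sum>i\<in>F. l2_inner \<mu> (gabor f j) (basis i) * basis i x)) =
        l2_norm \<mu> (\<lambda>x. gabor f j x - (\<Sum>i\<in>F. l2_inner \<mu> (gabor f i) (basis j) * basis i x))"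
      by (rule eventually_finite_subsets_at_top_weakI) (simp add: eq)
    then show ?thesis
      using orthonormal_basis_expansion[OF basis_orthonormal_basis L2[OF j]]
      unfolding l2_has_sum_def by (rule tendsto_cong[THEN iffD1])
  qed
  ultimately show ?thesis
    unfolding is_R_dual_def
    using index_infinite[OF inf] countable_SIGMA[OF countable_lattice annihilator_countable]
      basis_orthonormal_basis L2 by blast
qed

end

text \<open>The adjoint system is again \<open>gabor f\<close> over the same index set, because the
  modulations already range over the annihilator of the translations.\<close>

theorem theorem4p3:
  fixes \<mu> :: "'a::{topological_ab_group_add, second_countable_topology, t2_space} measure"
    and \<Lambda> :: "'a set"
  assumes "locally_compact_space (euclidean :: 'a topology)"
    and "infinite (UNIV :: 'a set)"
    and "haar_measure \<mu>"
    and "uniform_lattice \<Lambda>"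
    and "countable \<Lambda>"
  shows "\<exists>e h. orthonormal_basis \<mu> (\<Lambda> \<times> annihilator \<Lambda>) e \<and>
               orthonormal_basis \<mu> (\<Lambda> \<times> annihilator \<Lambda>) h \<and>
               (\<forall>f\<in>L2 \<mu>. is_R_dual \<mu> (\<Lambda> \<times> annihilator \<Lambda>) (\<Lambda> \<times> annihilator \<Lambda>)
                           (gabor f) e h (gabor f))"
proof -
  interpret haar_lattice \<mu> \<Lambda>
    using assms by unfold_locales
  obtain Q where Q: "Q \<in> sets borel" "emeasure \<mu> Q \<noteq> 0" "emeasure \<mu> Q \<noteq> \<infinity>"
    "\<And>g. \<exists>!l. l \<in> \<Lambda> \<and> g + l \<in> Q"
    by (rule fundamental_domain_exists) blast
  interpret fundamental_domain \<mu> \<Lambda> Q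
    using Q by unfold_locales
  show ?thesis
    using basis_orthonormal_basis gabor_is_R_dual[OF assms(2)] by blast
qed

end
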